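(* For any $A=\{e_1,\dots,e_k\}\subset\mathcal{E}$, $$\mathbb{P}(A\subset\tau_Q)=\mathbb{P}(e_1,e_2,\dots,e_k\in\tau_Q)=\det\nolimits_A\mathcal{H}_Q^+,$$ with $$\mathcal{H}_Q^+(e,e')=\frac{\beta(e^+,e_-)\,J^+_{e^+}(e_-,e')-\beta(e_-,e^+)\,J^+_{e_-}(e^+,e')}{\beta(e^+,e_-)+\beta(e_-,e^+)},\qquad e,e'\in\mathcal{E},$$ where $$\beta(x,y)=E_x\left[\int_0^{T_y}q(X(t))\,dt\right],\qquad x,y\in\mathcal{X}.$$ In addition, $$\mathbb{P}(\pm e_1,\dots,\pm e_k\in\tau_Q)=\det\nolimits_A\mathcal{H}_Q,$$ with $$\mathcal{H}_Q(e,e')=\frac{\beta(e^+,e_-)\,J_{e^+}(e_-,e')+\beta(e_-,e^+)\,J_{e_-}(e^+,-e')}{\beta(e^+,e_-)+\beta(e_-,e^+)},\qquad e,e'\in\mathcal{E}.$$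
   Context: Let $X$ be an irreducible continuous-time Markov process on a finite set $\mathcal{X}$, $|\mathcal{X}|=n$, with generator $(Lf)(x)=\sum_{y\in\mathcal{X}}w(x,y)[f(y)-f(x)]$, where the rates $w(x,y)\in[0,\infty)$ are given (reversibility is not assumed). $E_x$ denotes expectation for $X$ started from $x$, and $T_y=\inf\{t\ge0:X(t)=y\}$. Let $\mathcal{E}=\{(x,y)\in\mathcal{X}\times\mathcal{X}: x\neq y,\ w(x,y)>0\}$ and $w(e)=w(x,y)$ for $e=(x,y)\in\mathcal{E}$. For an oriented edge $e=(x,y)$, write $e_-=x$, $e^+=y$, $-e=(y,x)$. A rooted spanning tree $\tau$ is an undirected tree with vertex set $\mathcal{X}$ together with a chosen root $\rho(\tau)\in\mathcal{X}$, with edges oriented towards the root and with all its oriented edges in $\mathcal{E}$; it is identified with its set of oriented edges, and $w(\tau)=\prod_{e\in\tau}w(e)$. Let $q(x)\in[0,\infty)$, $x\in\mathcal{X}$, be finite killing rates, not all zero, and $Q$ the diagonal matrix with entries $q(x)$. The random rooted spanning tree $\tau_Q$ has law $$\mathbb{P}(\tau_Q=\tau)=\frac{w(\tau)\,q(\rho(\tau))}{\sum_{\tau'}w(\tau')\,q(\rho(\tau'))},$$ the sum being over all rooted spanning trees $\tau'$ (the denominator is $Z_Q'(0)$, the derivative at $\lambda=0$ of $Z_Q(\lambda)=\det(\lambda Q-L)$). For $x,y\in\mathcal{X}$ and an oriented edge $e$, $J_y^+(x,e)$ is the expected number of crossings of $e$ (jumps from $e_-$ to $e^+$) by $X$ started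 from $x$ and stopped at time $T_y$ (zero if $w(e_-,e^+)=0$), and $J_y(x,e)=J_y^+(x,e)-J_y^+(x,-e)$ is the net flow. $\{\pm e_1,\dots,\pm e_k\in\tau_Q\}$ is the event that for all $i\le k$ either $e_i$ or $-e_i$ belongs to $\tau_Q$. For a matrix $M$ indexed by $\mathcal{E}$, $\det_A M=\det(M(e,e'))_{e,e'\in A}$.
   Formalization: The second identity is stated only for A containing no pair e, -e of opposite edges; if A contains such a pair, det_A H_Q = 0 while the probability can be positive (two states, both rates positive, A = {e, -e}: probability 1). The first identity is for every A. *)

theory Defs
  imports "HOL-Probability.Probability" "HOL-Combinatorics.Permutations"
begin

section \<open>Markov processes on a finite set\<close>

definition generator :: "('x::finite \<Rightarrow> 'x \<Rightarrow> real) \<Rightarrow> ('x \<Rightarrow> real) \<Rightarrow> 'x \<Rightarrow> real" where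
  "generator w f x = (\<Sum>y\<in>UNIV. w x y * (f y - f x))"

definition edges :: "('x \<Rightarrow> 'x \<Rightarrow> real) \<Rightarrow> ('x \<times> 'x) set" where
  "edges w = {(x, y). x \<noteq> y \<and> w x y > 0}"

definition irreducible_rates :: "('x \<Rightarrow> 'x \<Rightarrow> real) \<Rightarrow> bool" where
  "irreducible_rates w \<longleftrightarrow> (\<forall>x y. (x, y) \<in> (edges w)\<^sup>*)"

definition past :: "'w measure \<Rightarrow> (real \<Rightarrow> 'w \<Rightarrow> 'x) \<Rightarrow> real \<Rightarrow> 'w set set" where
  "past M X s = sigma_sets (space M) {X u -` {z} \<inter> space M | u z. 0 \<le> u \<and> u \<le> s}"

text \<open>
  Right-continuous paths with left limits, for the discrete topology on the state space.
  Only times \<open>t \<ge> 0\<close> matter; the values of a path at negative times are irrelevant.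
\<close>

definition step_path :: "(real \<Rightarrow> 'x) \<Rightarrow> bool" where
  "step_path c \<longleftrightarrow>
     (\<forall>t\<ge>0. \<forall>\<^sub>F s in at_right t. c s = c t) \<and>
     (\<forall>t>0. \<exists>x. \<forall>\<^sub>F s in at_left t. c s = x)"

text \<open>
  \<open>P x\<close> is the law under which the process starts from \<open>x\<close>. The last two conjuncts are the
  time-homogeneous Markov property with respect to the natural filtration (in elementary form, so
  that no division by the probability of the conditioning event occurs) and the statement that
  the generator is the derivative at time 0 of the transition semigroup.
\<close>

definition markov_process ::
    "('x::finite \<Rightarrow> 'x \<Rightarrow> real) \<Rightarrow> ('x \<Rightarrow> 'w measure) \<Rightarrow> (real \<Rightarrow> 'w \<Rightarrow> 'x) \<Rightarrow> bool" where
  "markov_process w P X \<longleftrightarrow>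
     (\<forall>x. prob_space (P x)) \<and>
     (\<forall>x. \<forall>t\<ge>0. X t \<in> P x \<rightarrow>\<^sub>M count_space UNIV) \<and>
     (\<forall>x. \<forall>\<omega>\<in>space (P x). step_path (\<lambda>t. X t \<omega>)) \<and>
     (\<forall>x. AE \<omega> in P x. X 0 \<omega> = x) \<and>
     (\<forall>x. \<forall>s\<ge>0. \<forall>t\<ge>0. \<forall>B\<in>past (P x) X s. \<forall>y z.
        measure (P x) {\<omega>\<in>B. X s \<omega> = y \<and> X (s + t) \<omega> = z} =
        measure (P x) {\<omega>\<in>B. X s \<omega> = y} * measure (P y) {\<omega>\<in>space (P y). X t \<omega> = z}) \<and>
     (\<forall>f x. ((\<lambda>t. ((\<integral>\<omega>. f (X t \<omega>) \<partial>P x) - f x) / t) \<longlongrightarrow> generator w f x) (at_right 0))"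

section \<open>Hitting times, crossings and occupation functionals\<close>

text \<open>The hitting time is \<open>\<infinity>\<close> if the state is never visited.\<close>

definition hitting_time :: "(real \<Rightarrow> 'x) \<Rightarrow> 'x \<Rightarrow> ereal" where
  "hitting_time c y = Inf (ereal ` {t. 0 \<le> t \<and> c t = y})"

text \<open>
  The jump into the target state at the hitting time itself counts as a crossing.
  The value is \<open>\<infinity>\<close> if there are infinitely many crossings.
\<close>

definition crossings :: "(real \<Rightarrow> 'x) \<Rightarrow> ereal \<Rightarrow> 'x \<times> 'x \<Rightarrow> ennreal" where
  "crossings c T e = emeasure (count_space UNIV)
     {t. 0 < t \<and> ereal t \<le> T \<and> (\<forall>\<^sub>F s in at_left t. c s = fst e) \<and> c t = snd e}"

text \<open>
  The expectations below are taken in \<open>[0, \<infinity>]\<close>; they are finite for an irreducible process on a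
  finite set, and only then does the conversion to the reals lose nothing.
\<close>

definition cross_pos ::
    "('x \<Rightarrow> 'w measure) \<Rightarrow> (real \<Rightarrow> 'w \<Rightarrow> 'x) \<Rightarrow> 'x \<Rightarrow> 'x \<Rightarrow> 'x \<times> 'x \<Rightarrow> real" where
  "cross_pos P X y x e =
     enn2real (\<integral>\<^sup>+\<omega>. crossings (\<lambda>t. X t \<omega>) (hitting_time (\<lambda>t. X t \<omega>) y) e \<partial>P x)"

definition net_flow ::
    "('x \<Rightarrow> 'w measure) \<Rightarrow> (real \<Rightarrow> 'w \<Rightarrow> 'x) \<Rightarrow> 'x \<Rightarrow> 'x \<Rightarrow> 'x \<times> 'x \<Rightarrow> real" where
  "net_flow P X y x e = cross_pos P X y x e - cross_pos P X y x (prod.swap e)"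

definition killing_before ::
    "('x \<Rightarrow> 'w measure) \<Rightarrow> (real \<Rightarrow> 'w \<Rightarrow> 'x) \<Rightarrow> ('x \<Rightarrow> real) \<Rightarrow> 'x \<Rightarrow> 'x \<Rightarrow> real" where
  "killing_before P X q x y =
     enn2real (\<integral>\<^sup>+\<omega>. (\<integral>\<^sup>+t. ennreal (q (X t \<omega>)) *
        indicator {t. 0 \<le> t \<and> ereal t < hitting_time (\<lambda>t. X t \<omega>) y} t \<partial>lborel) \<partial>P x)"

section \<open>Rooted spanning trees\<close>

text \<open>
  Undirected graphs on the whole type are given by their symmetric adjacency relation; a cycle is
  a cyclic list of at least three distinct vertices.
\<close>

definition undirected_tree :: "('x \<times> 'x) set \<Rightarrow> bool" where
  "undirected_tree S \<longleftrightarrow>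
     sym S \<and> irrefl S \<and> (\<forall>x y. (x, y) \<in> S\<^sup>*) \<and>
     \<not> (\<exists>c. 3 \<le> length c \<and> distinct c \<and>
          (\<forall>i<length c. (c ! i, c ! (Suc i mod length c)) \<in> S))"

text \<open>
  Each undirected edge carries exactly one orientation, and it points towards the root \<open>r\<close>:
  following the orientation leads from every vertex to \<open>r\<close>.
\<close>

definition spanning_tree_rooted_at :: "('x \<Rightarrow> 'x \<Rightarrow> real) \<Rightarrow> 'x \<Rightarrow> ('x \<times> 'x) set \<Rightarrow> bool" where
  "spanning_tree_rooted_at w r \<tau> \<longleftrightarrow>
     \<tau> \<subseteq> edges w \<and> undirected_tree (\<tau> \<union> \<tau>\<inverse>) \<and> \<tau> \<inter> \<tau>\<inverse> = {} \<and> (\<forall>x. (x, r) \<in> \<tau>\<^sup>*)"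

definition rooted_spanning_trees :: "('x \<Rightarrow> 'x \<Rightarrow> real) \<Rightarrow> ('x \<times> 'x) set set" where
  "rooted_spanning_trees w = {\<tau>. \<exists>r. spanning_tree_rooted_at w r \<tau>}"

text \<open>The root is determined by the set of oriented edges.\<close>

definition root_of :: "('x \<times> 'x) set \<Rightarrow> 'x" where
  "root_of \<tau> = (THE r. \<forall>x. (x, r) \<in> \<tau>\<^sup>*)"

definition tree_weight :: "('x \<Rightarrow> 'x \<Rightarrow> real) \<Rightarrow> ('x \<times> 'x) set \<Rightarrow> real" where
  "tree_weight w \<tau> = (\<Prod>(x, y)\<in>\<tau>. w x y)"

definition random_rooted_tree ::
    "('x::finite \<Rightarrow> 'x \<Rightarrow> real) \<Rightarrow> ('x \<Rightarrow> real) \<Rightarrow> 'o measure \<Rightarrow> ('o \<Rightarrow> ('x \<times> 'x) set) \<Rightarrow> bool" where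
  "random_rooted_tree w q N T \<longleftrightarrow>
     prob_space N \<and> T \<in> N \<rightarrow>\<^sub>M count_space (rooted_spanning_trees w) \<and>
     (\<forall>\<tau>\<in>rooted_spanning_trees w.
        measure N {\<omega>\<in>space N. T \<omega> = \<tau>} =
        tree_weight w \<tau> * q (root_of \<tau>) /
          (\<Sum>\<tau>'\<in>rooted_spanning_trees w. tree_weight w \<tau>' * q (root_of \<tau>')))"

section \<open>The two kernels and determinants over index sets\<close>

text \<open>The Leibniz formula for the principal submatrix indexed by a finite set.\<close>

definition det_on :: "'i set \<Rightarrow> ('i \<Rightarrow> 'i \<Rightarrow> real) \<Rightarrow> real" where
  "det_on A M = (\<Sum>p | p permutes A. of_int (sign p) * (\<Prod>i\<in>A. M i (p i)))"

definition H_plus ::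
    "('x \<Rightarrow> 'w measure) \<Rightarrow> (real \<Rightarrow> 'w \<Rightarrow> 'x) \<Rightarrow> ('x \<Rightarrow> real) \<Rightarrow> 'x \<times> 'x \<Rightarrow> 'x \<times> 'x \<Rightarrow> real" where
  "H_plus P X q e e' = (let u = fst e; v = snd e; \<beta> = killing_before P X q in
     (\<beta> v u * cross_pos P X v u e' - \<beta> u v * cross_pos P X u v e') / (\<beta> v u + \<beta> u v))"

definition H_net ::
    "('x \<Rightarrow> 'w measure) \<Rightarrow> (real \<Rightarrow> 'w \<Rightarrow> 'x) \<Rightarrow> ('x \<Rightarrow> real) \<Rightarrow> 'x \<times> 'x \<Rightarrow> 'x \<times> 'x \<Rightarrow> real" where
  "H_net P X q e e' = (let u = fst e; v = snd e; \<beta> = killing_before P X q in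
     (\<beta> v u * net_flow P X v u e' + \<beta> u v * net_flow P X u v (prod.swap e')) / (\<beta> v u + \<beta> u v))"

end

theory Submission
  imports Defs "HOL-Library.Transitive_Closure_Table"
begin

text \<open>
  Fix a state \<open>c\<close> and let \<open>M\<close> be the matrix \<open>-L + q \<delta>\<^sub>c\<^sup>T\<close>. Its row \<open>a\<close> is the sum, over the choices of
  an outgoing edge \<open>(a, b)\<close> or of being the root, of a weight times \<open>\<delta>\<^sub>a - \<delta>\<^sub>b\<close> or \<open>\<delta>\<^sub>c\<close>. Expanding the
  determinant along these choices gives 1 for the rooted spanning trees and 0 for all other choices, so
  \<open>det M\<close> is the partition function. Forcing the edges of \<open>A\<close> replaces the rows
  at their starting points; multiplying by \<open>F = M\<^sup>-\<^sup>1\<close> turns all other rows into unit vectors, whence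
  the probability of \<open>A \<subseteq> \<tau>\<close> is the determinant over \<open>A\<close> of
  \<open>(F e\<^sub>- e'\<^sub>- - F e\<^sub>+ e'\<^sub>-) w e'\<close>.

  A column \<open>f = F \<delta>\<^sub>z\<close> solves \<open>-L f + \<kappa> q = \<delta>\<^sub>z\<close> with \<open>\<kappa> = f c\<close>. If \<open>G\<close> is the expected occupation
  time before hitting \<open>y\<close>, Dynkin's formula gives \<open>f x - f y = G z - \<kappa> \<beta> x y\<close>. Exchanging \<open>x\<close> and \<open>y\<close>
  and eliminating \<open>\<kappa>\<close> yields the kernel of the theorem, because the expected
  number of crossings of \<open>(z, b)\<close> before hitting \<open>y\<close> is \<open>G z * w z b\<close>.

  The facts about the process are obtained by observing it at the multiples of a small step \<open>h\<close>.
  Crossings seen on the grid before the hitting time never outnumber all the jumps of the path,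
  and they count the true crossings once \<open>h\<close> is small enough. Their expectations are products of an
  occupation sum and a transition probability by the Markov property, so Fatou's lemma makes the
  total number of jumps integrable and dominated convergence identifies the limits.

  The unoriented statement follows by expanding the columns of the antisymmetrized kernel over the
  orientations of the edges of \<open>A\<close>.
\<close>


section \<open>Determinants and tree sums\<close>

text \<open>
  A map \<open>\<phi>\<close> encodes the choice of an outgoing edge \<open>(a, \<phi> a)\<close> at every vertex \<open>a\<close>; \<open>\<phi> a = a\<close> means that
  \<open>a\<close> is declared a root.
\<close>

definition tree_map :: "('x \<Rightarrow> 'x) \<Rightarrow> bool" where
  "tree_map \<phi> \<longleftrightarrow> (\<exists>r. \<phi> r = r \<and> (\<forall>x. \<exists>k. (\<phi> ^^ k) x = r))"

text \<open>Every root declaration contributes the same row \<open>axis c 1\<close>, whichever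
  vertex makes it. Two declared roots therefore give two equal rows, so such choices have
  determinant 0.\<close>

definition choice_row :: "'x::finite \<Rightarrow> 'x \<Rightarrow> 'x \<Rightarrow> real ^ 'x" where
  "choice_row c a b = (if b = a then axis c 1 else axis a 1 - axis b 1)"

text \<open>With \<open>W a a = q a\<close> and \<open>W a b = w a b\<close> off the diagonal this
  is -L plus the column \<open>q\<close> placed at \<open>c\<close>. A diagonal killing term would
  produce spanning forests with several roots; the rank-one term makes the determinant linear in
  \<open>q\<close>, as trees with a single root require.\<close>

definition choice_matrix :: "'x::finite \<Rightarrow> ('x \<Rightarrow> 'x \<Rightarrow> real) \<Rightarrow> real ^ 'x ^ 'x" where
  "choice_matrix c W = (\<chi> a. \<Sum>b\<in>UNIV. W a b *s choice_row c a b)"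

lemma det_eq_0_if_kernel:
  fixes M :: "real ^ 'x ^ 'x"
  assumes "v \<noteq> 0" "M *v v = 0"
  shows "det M = 0"
proof (rule ccontr)
  assume "det M \<noteq> 0"
  then have "\<exists>B. B ** M = mat 1"
    by (simp add: invertible_det_nz[symmetric] invertible_left_inverse)
  then show False using assms by (simp add: matrix_left_invertible_ker)
qed

lemma choice_row_inner:
  "(\<Sum>j\<in>UNIV. choice_row c a b $ j * v j) = (if b = a then v c else v a - v b)"
  by (simp add: choice_row_def axis_def algebra_simps sum_subtractf if_distrib[of "\<lambda>t. _ * t"]
      cong: if_cong)

lemma tree_map_fix_unique:
  assumes "\<phi> r = r" "\<forall>x. \<exists>k. (\<phi> ^^ k) x = r" "\<phi> x = x"
  shows "x = r"
proof -
  have "(\<phi> ^^ k) x = x" for k using assms(3) by (induction k) auto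
  then show ?thesis using assms(2) by metis
qed

text \<open>Induction on the distance to \<open>r\<close>: the root is fixed by \<open>p\<close>,
  and once \<open>\<phi> x\<close> is fixed, injectivity rules out \<open>p x = \<phi> x\<close> for
  \<open>x\<close> not fixed. In the Leibniz expansion of rows supported on \<open>a\<close> and
  \<open>\<phi> a\<close> only the diagonal term then survives.\<close>

lemma permutes_choices_eq_id:
  assumes r: "\<phi> r = r" "\<forall>x. \<exists>k. (\<phi> ^^ k) x = r"
    and p: "p permutes UNIV" "\<And>a. p a = a \<or> p a = \<phi> a"
  shows "p = id"
proof -
  have fixed: "(\<phi> ^^ k) x = r \<Longrightarrow> p x = x" for k x
  proof (induction k arbitrary: x)
    case 0
    then show ?case using p(2)[of x] r(1) by auto
  next
    case (Suc k)
    have "p (\<phi> x) = \<phi> x" by (rule Suc.IH) (use Suc.prems in \<open>simp add: funpow_swap1\<close>)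
    then show ?case using p(2)[of x] permutes_inj[OF p(1)] by (metis injD)
  qed
  then show ?thesis using r(2) fixed by (metis eq_id_iff)
qed

text \<open>Writing \<open>axis c 1\<close> as \<open>(axis c 1 - axis r 1) + axis r 1\<close> in
  the root row moves the reference state from \<open>c\<close> to \<open>r\<close>: the first
  summand gives a matrix whose rows all sum to 0, hence a singular one. For the second, each row is
  supported on \<open>a\<close> and \<open>\<phi> a\<close> with diagonal entry 1.\<close>

lemma det_choice_rows_tree:
  fixes \<phi> :: "'x::finite \<Rightarrow> 'x"
  assumes r: "\<phi> r = r" "\<forall>x. \<exists>k. (\<phi> ^^ k) x = r"
  shows "det (\<chi> a. choice_row c a (\<phi> a)) = 1"
proof -
  have uniq: "\<phi> a = a \<longleftrightarrow> a = r" for a using tree_map_fix_unique[OF r] r(1) by metis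
  let ?R = "\<lambda>a. axis a 1 - axis (\<phi> a) 1 :: real ^ 'x"
  let ?E = "(\<chi> a. if a = r then axis r 1 else ?R a) :: real ^ 'x ^ 'x"
  let ?Z = "(\<chi> a. if a = r then axis c 1 - axis r 1 else ?R a) :: real ^ 'x ^ 'x"
  have "?Z *v 1 = 0"
    by (auto simp: vec_eq_iff matrix_vector_mult_def axis_def sum_subtractf)
  then have "det ?Z = 0"
    by (rule det_eq_0_if_kernel[rotated]) (auto simp: vec_eq_iff)
  moreover have "det (\<chi> a. if a = r then (axis c 1 - axis r 1) + axis r 1 else ?R a)
      = det ?Z + det ?E"
    by (rule det_row_add)
  moreover have "(\<chi> a. if a = r then (axis c 1 - axis r 1) + axis r 1 else ?R a)
      = (\<chi> a. choice_row c a (\<phi> a))"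
    by (auto simp: vec_eq_iff choice_row_def uniq r(1))
  moreover have "det ?E = 1"
  proof -
    have z: "(\<Prod>a\<in>UNIV. ?E $ a $ p a) = 0" if p: "p permutes UNIV" and "p \<noteq> id" for p
    proof -
      obtain a where a: "p a \<noteq> a" "p a \<noteq> \<phi> a"
        using permutes_choices_eq_id[OF r p] \<open>p \<noteq> id\<close> by blast
      have "?E $ a $ p a = 0" using a r(1) by (auto simp: axis_def)
      then show ?thesis by (meson UNIV_I finite prod_zero)
    qed
    have "det ?E = (\<Sum>p\<in>{id}. of_int (sign p) * (\<Prod>a\<in>UNIV. ?E $ a $ p a))"
      unfolding det_def
    proof (rule sum.mono_neutral_right)
      show "\<forall>p\<in>{p. p permutes UNIV} - {id}. of_int (sign p) * (\<Prod>a\<in>UNIV. ?E $ a $ p a) = 0"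
        by (intro ballI mult_eq_0_iff[THEN iffD2] disjI2 z) auto
    qed (simp_all add: permutes_id)
    also have "\<dots> = (\<Prod>a\<in>UNIV. ?E $ a $ a)" by (simp add: sign_id)
    also have "\<dots> = 1"
      by (rule prod.neutral) (auto simp: axis_def dest: uniq[THEN iffD1, OF sym])
    finally show ?thesis .
  qed
  ultimately show ?thesis by simp
qed

text \<open>A nonzero vector that is constant along \<open>\<phi>\<close> and vanishes at
  \<open>c\<close> whenever \<open>\<phi>\<close> has a fixed point lies in the kernel. Either some
  orbit never meets that of \<open>c\<close>, and an indicator works, or there is no fixed point at
  all, and the constant vector works.\<close>

lemma det_choice_rows_not_tree:
  fixes \<phi> :: "'x::finite \<Rightarrow> 'x"
  assumes "\<not> tree_map \<phi>"
  shows "det (\<chi> a. choice_row c a (\<phi> a)) = 0"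
proof -
  \<comment> \<open>The vertices whose forward orbit meets that of \<open>c\<close>. Both
    \<open>U\<close> and its complement are closed under \<open>\<phi>\<close> and under
    preimages.\<close>
  define U where "U = {x. \<exists>m n. (\<phi> ^^ m) x = (\<phi> ^^ n) c}"
  have cl: "\<phi> x \<in> U \<longleftrightarrow> x \<in> U" for x
  proof
    assume "\<phi> x \<in> U"
    then obtain m n where "(\<phi> ^^ m) (\<phi> x) = (\<phi> ^^ n) c" by (auto simp: U_def)
    then have "(\<phi> ^^ Suc m) x = (\<phi> ^^ n) c" by (simp add: funpow_swap1)
    then show "x \<in> U" unfolding U_def by blast
  next
    assume "x \<in> U"
    then obtain m n where "(\<phi> ^^ m) x = (\<phi> ^^ n) c" by (auto simp: U_def)
    then have "(\<phi> ^^ m) (\<phi> x) = (\<phi> ^^ Suc n) c" by (simp flip: funpow_swap1)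
    then show "\<phi> x \<in> U" unfolding U_def by blast
  qed
  have "(\<phi> ^^ 0) c = (\<phi> ^^ 0) c" by simp
  then have cU: "c \<in> U" unfolding U_def by blast
  have ker: ?thesis if v: "v \<noteq> 0" "\<And>a. (if \<phi> a = a then v $ c else v $ a - v $ \<phi> a) = 0" for v :: "real ^ 'x"
    by (rule det_eq_0_if_kernel[OF v(1)])
      (use v(2) in \<open>simp add: vec_eq_iff matrix_vector_mult_def choice_row_inner\<close>)
  show ?thesis
  proof (cases "U = UNIV")
    case False
    then obtain x where x: "x \<notin> U" by auto
    show ?thesis
    proof (rule ker)
      show "(\<chi> a. if a \<in> U then 0 else 1) \<noteq> (0 :: real ^ 'x)"
        using x by (auto simp: vec_eq_iff)
    qed (use cl cU in auto)
  next
    case True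
    \<comment> \<open>If every orbit meets that of \<open>c\<close>, a fixed point lies on the orbit
      of \<open>c\<close> and so attracts every vertex, which would make \<open>\<phi>\<close> a
      tree map.\<close>
    have nofix: "\<phi> r \<noteq> r" for r
    proof
      assume r: "\<phi> r = r"
      have rr: "(\<phi> ^^ k) r = r" for k using r by (induction k) auto
      have "r \<in> U" using True by simp
      then obtain m n where "(\<phi> ^^ m) r = (\<phi> ^^ n) c" unfolding U_def by blast
      then have n: "r = (\<phi> ^^ n) c" using rr[of m] by simp
      have "\<exists>k. (\<phi> ^^ k) x = r" for x
      proof -
        have "x \<in> U" using True by simp
        then obtain m k where mk: "(\<phi> ^^ m) x = (\<phi> ^^ k) c" unfolding U_def by blast
        have "(\<phi> ^^ (n + m)) x = (\<phi> ^^ (n + k)) c" by (simp add: funpow_add mk)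
        also have "\<dots> = (\<phi> ^^ k) r" unfolding n unfolding add.commute[of n k] by (simp add: funpow_add)
        finally have "(\<phi> ^^ (n + m)) x = (\<phi> ^^ k) r" .
        then show ?thesis unfolding rr by blast
      qed
      then show False using assms r unfolding tree_map_def by blast
    qed
    show ?thesis
      by (rule ker[of 1]) (auto simp: vec_eq_iff nofix)
  qed
qed

text \<open>A matrix-tree theorem by multilinearity: expanding every row over its choices leaves one
  determinant per map, equal to 1 for tree maps and 0 otherwise, without any cancellation.\<close>

lemma det_choice_matrix:
  "det (choice_matrix c W) = (\<Sum>\<phi> | tree_map \<phi>. \<Prod>a\<in>UNIV. W a (\<phi> a))"
proof -
  have "det (choice_matrix c W)
      = (\<Sum>\<phi> | \<forall>a. \<phi> a \<in> UNIV. det (\<chi> a. W a (\<phi> a) *s choice_row c a (\<phi> a)))"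
    unfolding choice_matrix_def by (rule det_linear_rows_sum) simp
  also have "\<dots> = (\<Sum>\<phi>\<in>UNIV. (\<Prod>a\<in>UNIV. W a (\<phi> a)) * det (\<chi> a. choice_row c a (\<phi> a)))"
    by (rule sum.cong) (simp, rule det_rows_mul)
  also have "\<dots> = (\<Sum>\<phi>\<in>UNIV. if tree_map \<phi> then \<Prod>a\<in>UNIV. W a (\<phi> a) else 0)"
    by (rule sum.cong)
      (auto simp: det_choice_rows_not_tree tree_map_def det_choice_rows_tree)
  also have "\<dots> = (\<Sum>\<phi> | tree_map \<phi>. \<Prod>a\<in>UNIV. W a (\<phi> a))"
    by (simp add: sum.If_cases)
  finally show ?thesis .
qed

text \<open>Outside \<open>A\<close> the matrix is padded with rows of the identity, so a
  permutation moving a point outside \<open>A\<close> picks up a factor 0.\<close>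

lemma det_on_eq_det:
  fixes M :: "'i::finite \<Rightarrow> 'i \<Rightarrow> real"
  shows "det_on A M = det (\<chi> i j. if i \<in> A then M i j else if i = j then 1 else 0)"
proof -
  let ?M = "(\<chi> i j. if i \<in> A then M i j else if i = j then 1 else 0) :: real ^ 'i ^ 'i"
  have z: "(\<Prod>i\<in>UNIV. ?M $ i $ p i) = 0" if p: "p permutes UNIV" "\<not> p permutes A" for p
  proof -
    obtain i where "i \<notin> A" "p i \<noteq> i"
      using p by (auto simp: permutes_def)
    then have "?M $ i $ p i = 0" by auto
    then show ?thesis by (meson UNIV_I finite prod_zero)
  qed
  have "det ?M = (\<Sum>p | p permutes A. of_int (sign p) * (\<Prod>i\<in>UNIV. ?M $ i $ p i))"
    unfolding det_def
  proof (rule sum.mono_neutral_right)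
    show "\<forall>p\<in>{p. p permutes UNIV} - {p. p permutes A}. of_int (sign p) * (\<Prod>i\<in>UNIV. ?M $ i $ p i) = 0"
      by (intro ballI mult_eq_0_iff[THEN iffD2] disjI2 z) auto
  qed (auto intro: permutes_subset[of _ A])
  also have "\<dots> = det_on A M"
    unfolding det_on_def
  proof (rule sum.cong)
    fix p assume p: "p \<in> {p. p permutes A}"
    have "(\<Prod>i\<in>UNIV. ?M $ i $ p i) = (\<Prod>i\<in>A. M i (p i))"
      by (rule prod.mono_neutral_cong_right) (use p in \<open>auto simp: permutes_def\<close>)
    then show "of_int (sign p) * (\<Prod>i\<in>UNIV. ?M $ i $ p i) = of_int (sign p) * (\<Prod>i\<in>A. M i (p i))"
      by simp
  qed simp
  finally show ?thesis by simp
qed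

lemma det_on_cong:
  assumes "\<And>i j. i \<in> A \<Longrightarrow> j \<in> A \<Longrightarrow> M i j = M' i j"
  shows "det_on A M = det_on A M'"
  unfolding det_on_def
  by (intro sum.cong arg_cong2[of _ _ _ _ "(*)"] prod.cong refl assms)
    (auto simp: permutes_in_image)

lemma det_on_scale_columns:
  assumes "finite A"
  shows "det_on A (\<lambda>i j. M i j * s j) = (\<Prod>j\<in>A. s j) * det_on A M"
  unfolding det_on_def sum_distrib_left
proof (rule sum.cong)
  fix p assume "p \<in> {p. p permutes A}"
  then have p: "p permutes A" by simp
  have "(\<Prod>i\<in>A. s (p i)) = (\<Prod>j\<in>A. s j)"
    using prod.permute[OF p, of s] by (simp add: comp_def)
  then show "of_int (sign p) * (\<Prod>i\<in>A. M i (p i) * s (p i))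
      = (\<Prod>j\<in>A. s j) * (of_int (sign p) * (\<Prod>i\<in>A. M i (p i)))"
    by (simp add: prod.distrib)
qed simp

lemma det_on_scale_rows:
  assumes "finite A"
  shows "det_on A (\<lambda>i j. s i * M i j) = (\<Prod>i\<in>A. s i) * det_on A M"
  unfolding det_on_def sum_distrib_left
  by (rule sum.cong) (simp_all add: prod.distrib algebra_simps)

lemma det_on_identical_columns:
  fixes M :: "'i::finite \<Rightarrow> 'i \<Rightarrow> real"
  assumes "j \<in> A" "k \<in> A" "j \<noteq> k" "\<And>i. i \<in> A \<Longrightarrow> M i j = M i k"
  shows "det_on A M = 0"
  unfolding det_on_eq_det
  by (rule det_identical_columns[OF assms(3)]) (use assms in \<open>auto simp: column_def vec_eq_iff\<close>)

lemma det_on_reindex: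
  assumes h: "bij_betw h A B"  and "finite A"
  shows "det_on B M = det_on A (\<lambda>i j. M (h i) (h j))"
proof -
  have B: "B = h ` A" and inj: "inj_on h A" using h by (auto simp: bij_betw_def)
  have "det_on A (\<lambda>i j. M (h i) (h j))
      = (\<Sum>p | p permutes A. of_int (sign (map_permutation A h p)) * (\<Prod>i\<in>B. M i (map_permutation A h p i)))"
    unfolding det_on_def
  proof (rule sum.cong)
    fix p assume "p \<in> {p. p permutes A}"
    then have p: "p permutes A" by simp
    have "(\<Prod>i\<in>B. M i (map_permutation A h p i)) = (\<Prod>i\<in>A. M (h i) (h (p i)))"
      unfolding B by (simp add: prod.reindex[OF inj] map_permutation_apply[OF inj])
    then show "of_int (sign p) * (\<Prod>i\<in>A. M (h i) (h (p i)))
        = of_int (sign (map_permutation A h p)) * (\<Prod>i\<in>B. M i (map_permutation A h p i))"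
      by (simp add: sign_map_permutation[OF inj p \<open>finite A\<close>])
  qed simp
  also have "\<dots> = det_on B M"
    unfolding det_on_def
    using sum.reindex_bij_betw[OF bij_betw_permutations[OF h], of "\<lambda>p. of_int (sign p) * (\<Prod>i\<in>B. M i (p i))"]
    by (simp add: map_permutation_def restrict_id_def comp_def B[symmetric] cong: if_cong)
  finally show ?thesis by simp
qed

text \<open>Prescribing the edges of \<open>A\<close> changes only the rows at their starting
  points. After multiplication by the inverse \<open>N\<close> all other rows are unit vectors, so
  the determinant collapses to a minor indexed by the starting points, and injectivity of
  \<open>fst\<close> lets the edges serve as indices.\<close>

lemma tree_sum_containing_inj:
  fixes W :: "'x::finite \<Rightarrow> 'x \<Rightarrow> real"
  assumes inv: "choice_matrix c W ** N = mat 1"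
    and inj: "inj_on fst A" and nl: "\<And>e. e \<in> A \<Longrightarrow> fst e \<noteq> snd e"
  shows "(\<Sum>\<phi> | tree_map \<phi> \<and> (\<forall>e\<in>A. \<phi> (fst e) = snd e). \<Prod>a\<in>UNIV. W a (\<phi> a))
    = det (choice_matrix c W) *
      det_on A (\<lambda>e e'. (N $ fst e $ fst e' - N $ snd e $ fst e') * W (fst e') (snd e'))"
proof -
  \<comment> \<open>All choices competing with an edge of \<open>A\<close> get weight 0, which turns
    the restricted sum into an unrestricted one.\<close>
  define W' where "W' a b = (if a \<in> fst ` A \<and> (a, b) \<notin> A then 0 else W a b)" for a b
  let ?M = "choice_matrix c W" and ?M' = "choice_matrix c W'"
  let ?g = "the_inv_into A fst"
  let ?w = "\<lambda>e. W (fst e) (snd e)"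
  let ?D = "\<lambda>e j. N $ fst e $ j - N $ snd e $ j"
  have g: "?g (fst e) = e" if "e \<in> A" for e
    using the_inv_into_f_f[OF inj that] .
  have "(\<Sum>\<phi> | tree_map \<phi> \<and> (\<forall>e\<in>A. \<phi> (fst e) = snd e). \<Prod>a\<in>UNIV. W a (\<phi> a))
      = (\<Sum>\<phi> | tree_map \<phi>. \<Prod>a\<in>UNIV. W' a (\<phi> a))"
  proof (rule sum.mono_neutral_cong_left)
    show "\<forall>\<phi>\<in>{\<phi>. tree_map \<phi>} - {\<phi>. tree_map \<phi> \<and> (\<forall>e\<in>A. \<phi> (fst e) = snd e)}.
        (\<Prod>a\<in>UNIV. W' a (\<phi> a)) = 0"
    proof
      fix \<phi> assume "\<phi> \<in> {\<phi>. tree_map \<phi>} - {\<phi>. tree_map \<phi> \<and> (\<forall>e\<in>A. \<phi> (fst e) = snd e)}"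
      then obtain e where e: "e \<in> A" "\<phi> (fst e) \<noteq> snd e" by auto
      have "(fst e, \<phi> (fst e)) \<notin> A"
        using e inj by (metis fst_conv inj_onD snd_conv)
      then have "W' (fst e) (\<phi> (fst e)) = 0" using e by (simp add: W'_def)
      then show "(\<Prod>a\<in>UNIV. W' a (\<phi> a)) = 0" by (meson UNIV_I finite prod_zero)
    qed
  next
    fix \<phi> assume "\<phi> \<in> {\<phi>. tree_map \<phi> \<and> (\<forall>e\<in>A. \<phi> (fst e) = snd e)}"
    then have "(a, \<phi> a) \<in> A" if "a \<in> fst ` A" for a using that by auto
    then show "(\<Prod>a\<in>UNIV. W a (\<phi> a)) = (\<Prod>a\<in>UNIV. W' a (\<phi> a))"
      by (intro prod.cong) (auto simp: W'_def)
  qed auto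
  also have "\<dots> = det ?M'" by (simp add: det_choice_matrix)
  \<comment> \<open>The factor \<open>det ?M * det N = 1\<close> is inserted so that
    \<open>?M' ** N\<close> appears.\<close>
  also have "\<dots> = det ?M * (det ?M' * det N)"
    using arg_cong[OF inv, of det] by (simp add: det_mul)
  also have "det ?M' * det N = det (?M' ** N)" by (simp add: det_mul)
  also have "?M' ** N = (\<chi> i j. if i \<in> fst ` A then ?w (?g i) * ?D (?g i) j else if i = j then 1 else 0)"
  proof (simp only: vec_eq_iff, intro allI)
    fix i j
    show "(?M' ** N) $ i $ j =
      (\<chi> i j. if i \<in> fst ` A then ?w (?g i) * ?D (?g i) j else if i = j then 1 else 0) $ i $ j"
    proof (cases "i \<in> fst ` A")
      case True
      then obtain b where b: "(i, b) \<in> A" by auto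
      have gi: "?g i = (i, b)" using g[OF b] by simp
      have uniq: "b' = b" if "(i, b') \<in> A" for b' using that b inj by (metis fst_conv inj_onD snd_conv)
      have "?M' $ i = (\<Sum>b'\<in>{b}. W' i b' *s choice_row c i b')"
        unfolding choice_matrix_def vec_lambda_beta
        by (rule sum.mono_neutral_right) (use uniq True in \<open>auto simp: W'_def\<close>)
      also have "\<dots> = W i b *s choice_row c i b" using b by (simp add: W'_def)
      finally have "(?M' ** N) $ i $ j = W i b * (\<Sum>k\<in>UNIV. choice_row c i b $ k * N $ k $ j)"
        by (simp add: matrix_matrix_mult_def sum_distrib_left mult.assoc)
      also have "\<dots> = W i b * (N $ i $ j - N $ b $ j)"
        using choice_row_inner[of c i b "\<lambda>k. N $ k $ j"] nl[OF b] by simp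
      finally show ?thesis using True gi by simp
    next
      case False
      have "?M' $ i = ?M $ i"
        using False by (simp add: choice_matrix_def W'_def)
      then have "(?M' ** N) $ i $ j = (?M ** N) $ i $ j"
        by (simp add: matrix_matrix_mult_def)
      then show ?thesis using False by (simp add: inv mat_def)
    qed
  qed
  also have "det \<dots> = det_on (fst ` A) (\<lambda>i j. ?w (?g i) * ?D (?g i) j)"
    by (simp add: det_on_eq_det)
  also have "\<dots> = det_on A (\<lambda>e e'. ?w (?g (fst e)) * ?D (?g (fst e)) (fst e'))"
    by (rule det_on_reindex[OF inj_on_imp_bij_betw[OF inj]]) simp
  also have "\<dots> = det_on A (\<lambda>e e'. ?w e * ?D e (fst e'))"
    by (rule det_on_cong) (simp add: g)
  \<comment> \<open>Scaling the rows or the columns by the same weights multiplies the determinant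
    by the same product, so the weight may pass from the row edge to the column edge.\<close>
  also have "\<dots> = det_on A (\<lambda>e e'. ?D e (fst e') * ?w e')"
    by (simp only: det_on_scale_rows[OF finite] det_on_scale_columns[OF finite])
  finally show ?thesis .
qed

text \<open>If two edges of \<open>A\<close> leave the same vertex, both sides vanish: no map takes
  two values there, and up to the factors \<open>W\<close> the columns of the kernel depend only on
  the starting point, so two of them coincide.\<close>

lemma tree_sum_containing:
  fixes W :: "'x::finite \<Rightarrow> 'x \<Rightarrow> real"
  assumes inv: "choice_matrix c W ** N = mat 1"
    and nl: "\<And>e. e \<in> A \<Longrightarrow> fst e \<noteq> snd e"
  shows "(\<Sum>\<phi> | tree_map \<phi> \<and> (\<forall>e\<in>A. \<phi> (fst e) = snd e). \<Prod>a\<in>UNIV. W a (\<phi> a))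
    = det (choice_matrix c W) *
      det_on A (\<lambda>e e'. (N $ fst e $ fst e' - N $ snd e $ fst e') * W (fst e') (snd e'))"
proof (cases "inj_on fst A")
  case True
  show ?thesis by (rule tree_sum_containing_inj[OF inv True nl])
next
  case False
  then obtain e e' where e: "e \<in> A" "e' \<in> A" "fst e = fst e'" "e \<noteq> e'"
    by (auto simp: inj_on_def)
  then have empty: "{\<phi>. tree_map \<phi> \<and> (\<forall>e\<in>A. \<phi> (fst e) = snd e)} = {}"
    by (auto simp: prod_eq_iff) metis
  have z: "det_on A (\<lambda>e e'. N $ fst e $ fst e' - N $ snd e $ fst e') = 0"
    by (rule det_on_identical_columns[OF e(1,2,4)]) (simp add: e(3))
  show ?thesis unfolding empty det_on_scale_columns[OF finite] z by simp
qed

section \<open>Rooted spanning trees as maps\<close>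

text \<open>Fixed points contribute no edge, so the graph of a tree map leaves exactly its root
  without an outgoing edge.\<close>

definition map_graph :: "('x \<Rightarrow> 'x) \<Rightarrow> ('x \<times> 'x) set" where
  "map_graph \<phi> = {(a, b). b = \<phi> a \<and> b \<noteq> a}"

lemma inj_map_graph: "inj map_graph"
proof (rule injI, rule ext)
  fix \<phi> \<psi> :: "'x \<Rightarrow> 'x" and a
  assume "map_graph \<phi> = map_graph \<psi>"
  then have "(a, b) \<in> map_graph \<phi> \<longleftrightarrow> (a, b) \<in> map_graph \<psi>" for b by simp
  then show "\<phi> a = \<psi> a" unfolding map_graph_def by (metis (mono_tags, lifting) case_prodD case_prodI mem_Collect_eq)
qed

lemma funpow_in_rtrancl_map_graph: "(x, (\<phi> ^^ k) x) \<in> (map_graph \<phi>)\<^sup>*"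
proof (induction k)
  case (Suc k)
  show ?case
  proof (cases "\<phi> ((\<phi> ^^ k) x) = (\<phi> ^^ k) x")
    case False
    then have "((\<phi> ^^ k) x, (\<phi> ^^ Suc k) x) \<in> map_graph \<phi>" by (simp add: map_graph_def)
    then show ?thesis using Suc by (rule rtrancl_into_rtrancl[rotated])
  qed (use Suc in simp)
qed simp

lemma root_of_map_graph:
  assumes r: "\<phi> r = r" "\<forall>x. \<exists>k. (\<phi> ^^ k) x = r"
  shows "root_of (map_graph \<phi>) = r"
  unfolding root_of_def
proof (rule the_equality)
  show "\<forall>x. (x, r) \<in> (map_graph \<phi>)\<^sup>*" using r(2) funpow_in_rtrancl_map_graph by metis
next
  fix r' assume "\<forall>x. (x, r') \<in> (map_graph \<phi>)\<^sup>*"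
  then have "(r, r') \<in> (map_graph \<phi>)\<^sup>*" by blast
  then show "r' = r" by (cases rule: converse_rtranclE) (auto simp: map_graph_def r(1))
qed

text \<open>The number of steps to the root drops by exactly one along each edge. A vertex of
  maximal depth on a cycle would have its parent as both neighbours, which excludes cycles, and the
  strict drop excludes pairs of opposite edges.\<close>

lemma spanning_tree_map_graph:
  assumes r: "\<phi> r = r" "\<forall>x. \<exists>k. (\<phi> ^^ k) x = r"
    and sub: "map_graph \<phi> \<subseteq> edges w"
  shows "spanning_tree_rooted_at w r (map_graph \<phi>)"
proof -
  let ?t = "map_graph \<phi>"
  let ?S = "?t \<union> ?t\<inverse>"
  define d where "d x = (LEAST k. (\<phi> ^^ k) x = r)" for x
  have d: "(\<phi> ^^ d x) x = r" for x
  proof -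
    obtain k where "(\<phi> ^^ k) x = r" using r(2) by blast
    then show ?thesis unfolding d_def by (rule LeastI)
  qed
  have dS: "d x = Suc (d (\<phi> x))" if nfix: "\<phi> x \<noteq> x" for x
  proof -
    obtain m where m: "d x = Suc m" using d[of x] nfix r(1) by (cases "d x") auto
    have "(\<phi> ^^ m) (\<phi> x) = r" using m d[of x] by (simp add: funpow_swap1)
    then have "d (\<phi> x) \<le> m" unfolding d_def by (rule Least_le)
    moreover have "d x \<le> Suc (d (\<phi> x))"
      using d[of "\<phi> x"] unfolding d_def[of x] by (intro Least_le) (simp add: funpow_swap1)
    ultimately show ?thesis using m by simp
  qed
  have reach: "(x, r) \<in> ?t\<^sup>*" for x using funpow_in_rtrancl_map_graph[of x "d x" \<phi>] by (simp add: d)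
  have "sym ?S" by (auto simp: sym_def)
  have conn: "(x, y) \<in> ?S\<^sup>*" for x y
  proof -
    have *: "(z, r) \<in> ?S\<^sup>*" for z using reach by (meson Un_upper1 rtrancl_mono subsetD)
    then have "(r, y) \<in> ?S\<^sup>*" using \<open>sym ?S\<close> by (meson sym_rtrancl symD)
    then show ?thesis using *[of x] by simp
  qed
  \<comment> \<open>Of two adjacent vertices the one that is not deeper is the parent of the
    other.\<close>
  have parent: "v = \<phi> u" if "(u, v) \<in> ?S" "d v \<le> d u" for u v
    using that dS[of v] by (auto simp: map_graph_def)
  have acyc: False if c: "3 \<le> length c" "distinct c"
      "\<And>i. i < length c \<Longrightarrow> (c ! i, c ! (Suc i mod length c)) \<in> ?S" for c
  proof -
    let ?n = "length c"
    have fin: "finite ((\<lambda>i. d (c ! i)) ` {..<?n})" and ne: "(\<lambda>i. d (c ! i)) ` {..<?n} \<noteq> {}"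
      using c(1) by (auto simp: lessThan_empty_iff)
    obtain i where i: "i < ?n" "\<And>j. j < ?n \<Longrightarrow> d (c ! j) \<le> d (c ! i)"
    proof -
      from Max_in[OF fin ne] obtain i where "i < ?n" "d (c ! i) = Max ((\<lambda>i. d (c ! i)) ` {..<?n})" by auto
      then show ?thesis using that[of i] Max_ge[OF fin] by auto
    qed
    \<comment> \<open>\<open>j\<close> and \<open>k\<close> are the cyclic successor and predecessor
      of the deepest position \<open>i\<close>; they differ because the cycle has at least three
      vertices.\<close>
    define j where "j = (if Suc i < ?n then Suc i else 0)"
    define k where "k = (if i = 0 then ?n - 1 else i - 1)"
    have jk: "j < ?n" "k < ?n" "j \<noteq> k"
      using i(1) c(1) by (auto simp: j_def k_def split: if_splits)
    have jmod: "Suc i mod ?n = j"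
    proof (cases "Suc i < ?n")
      case False
      then have "Suc i = ?n" using i(1) by simp
      then show ?thesis by (simp add: j_def)
    qed (simp add: j_def)
    have kmod: "Suc k mod ?n = i"
    proof (cases "i = 0")
      case True
      then have "Suc k = ?n" using c(1) by (simp add: k_def)
      then show ?thesis using True by simp
    qed (use i(1) in \<open>simp add: k_def\<close>)
    have "c ! j = \<phi> (c ! i)"
      by (rule parent) (use c(3)[OF i(1)] jmod jk i(2) in auto)
    moreover have "c ! k = \<phi> (c ! i)"
    proof (rule parent)
      show "(c ! i, c ! k) \<in> ?S" using c(3)[OF jk(2)] \<open>sym ?S\<close> unfolding kmod by (meson symD)
    qed (use i(2) jk in auto)
    ultimately have "c ! j = c ! k" by simp
    then show False using nth_eq_iff_index_eq[OF c(2) jk(1,2)] jk(3) by simp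
  qed
  have no2: "\<phi> (\<phi> x) \<noteq> x" if "\<phi> x \<noteq> x" for x
    using dS[OF that] dS[of "\<phi> x"] that by auto
  have "?t \<inter> ?t\<inverse> = {}"
  proof (rule equals0I)
    fix p assume p: "p \<in> ?t \<inter> ?t\<inverse>"
    obtain a b where "p = (a, b)" by (cases p)
    then have ab: "(a, b) \<in> ?t" "(b, a) \<in> ?t" using p by auto
    have "\<phi> a = b" "b \<noteq> a" using ab(1) by (auto simp: map_graph_def)
    moreover have "\<phi> b = a" using ab(2) by (simp add: map_graph_def)
    ultimately show False using no2[of a] by simp
  qed
  moreover have "irrefl ?S" by (auto simp: irrefl_def map_graph_def)
  moreover have "\<not> (\<exists>c. 3 \<le> length c \<and> distinct c \<and> (\<forall>i<length c. (c ! i, c ! (Suc i mod length c)) \<in> ?S))"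
  proof (intro notI, elim exE conjE)
    fix c assume "3 \<le> length c" "distinct c" "\<forall>i<length c. (c ! i, c ! (Suc i mod length c)) \<in> ?S"
    then show False by (intro acyc[of c]) simp_all
  qed
  ultimately show ?thesis
    unfolding spanning_tree_rooted_at_def undirected_tree_def
    by (intro conjI allI sub conn reach \<open>sym ?S\<close>)
qed

text \<open>Following an edge that decreases the distance to the root defines \<open>\<phi>\<close>,
  whose graph is a spanning tree inside \<open>\<tau>\<close>. Any further edge of
  \<open>\<tau>\<close> would close a cycle with the path joining its ends.\<close>

lemma spanning_tree_is_map_graph:
  assumes "spanning_tree_rooted_at w r \<tau>"
  obtains \<phi> where "tree_map \<phi>" "\<tau> = map_graph \<phi>"
proof -
  have sub: "\<tau> \<subseteq> edges w" and tree: "undirected_tree (\<tau> \<union> \<tau>\<inverse>)" and anti: "\<tau> \<inter> \<tau>\<inverse> = {}"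
    and reach: "\<And>x. (x, r) \<in> \<tau>\<^sup>*"
    using assms by (auto simp: spanning_tree_rooted_at_def)
  define d where "d x = (LEAST k. (x, r) \<in> \<tau> ^^ k)" for x
  have d: "(x, r) \<in> \<tau> ^^ d x" for x
  proof -
    obtain k where "(x, r) \<in> \<tau> ^^ k" using rtrancl_imp_relpow[OF reach] by blast
    then show ?thesis unfolding d_def by (rule LeastI)
  qed
  have step: "\<exists>y. (x, y) \<in> \<tau> \<and> d y < d x" if xr: "x \<noteq> r" for x
  proof -
    obtain m where m: "d x = Suc m" using d[of x] xr by (cases "d x") auto
    then obtain y where y: "(x, y) \<in> \<tau>" "(y, r) \<in> \<tau> ^^ m"
      using d[of x] by (metis relpow_Suc_D2)
    then have "d y \<le> m" unfolding d_def by (intro Least_le)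
    then show ?thesis using y m by auto
  qed
  define \<phi> where "\<phi> x = (if x = r then r else SOME y. (x, y) \<in> \<tau> \<and> d y < d x)" for x
  have \<phi>: "(x, \<phi> x) \<in> \<tau>" "d (\<phi> x) < d x" if "x \<noteq> r" for x
    using someI_ex[OF step[OF that]] that by (auto simp: \<phi>_def)
  have \<phi>r: "\<phi> r = r" by (simp add: \<phi>_def)
  have toroot: "\<exists>k. (\<phi> ^^ k) x = r" for x
  proof (induction "d x" arbitrary: x rule: less_induct)
    case less
    show ?case
    proof (cases "x = r")
      case True
      then have "(\<phi> ^^ 0) x = r" by simp
      then show ?thesis by blast
    next
      case False
      then obtain k where "(\<phi> ^^ k) (\<phi> x) = r" using less \<phi>(2) by blast
      then have "(\<phi> ^^ Suc k) x = r" by (simp add: funpow_swap1)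
      then show ?thesis by blast
    qed
  qed
  have sub\<tau>: "map_graph \<phi> \<subseteq> \<tau>" using \<phi>(1) \<phi>r by (force simp: map_graph_def)
  let ?S = "map_graph \<phi> \<union> (map_graph \<phi>)\<inverse>"
  have "spanning_tree_rooted_at w r (map_graph \<phi>)"
    by (rule spanning_tree_map_graph) (use \<phi>r toroot sub\<tau> sub in auto)
  then have conn: "(x, y) \<in> ?S\<^sup>*" for x y
    by (auto simp: spanning_tree_rooted_at_def undirected_tree_def)
  have "\<tau> \<subseteq> map_graph \<phi>"
  proof (rule ccontr)
    assume "\<not> \<tau> \<subseteq> map_graph \<phi>"
    then obtain x y where xy: "(x, y) \<in> \<tau>" "(x, y) \<notin> map_graph \<phi>" by auto
    \<comment> \<open>The reversed edge is excluded as well, since \<open>\<tau>\<close> never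
      contains both orientations.\<close>
    have nS: "(x, y) \<notin> ?S" using xy sub\<tau> anti by auto
    have "(\<lambda>a b. (a, b) \<in> ?S)\<^sup>*\<^sup>* x y" using conn[of x y] by (simp add: rtrancl_def)
    then obtain xs0 where "rtrancl_path (\<lambda>a b. (a, b) \<in> ?S) x xs0 y"
      by (auto simp: rtranclp_eq_rtrancl_path)
    then obtain xs where p: "rtrancl_path (\<lambda>a b. (a, b) \<in> ?S) x xs y" "distinct (x # xs)"
      by (rule rtrancl_path_distinct)
    have "x \<noteq> y" using xy(1) sub by (auto simp: edges_def)
    then have ne: "xs \<noteq> []" using p(1) by (auto elim: rtrancl_path.cases)
    have last: "xs ! (length xs - 1) = y"
      using rtrancl_path_last[OF p(1) ne] ne by (simp add: last_conv_nth)
    \<comment> \<open>A path of one step would be the edge itself, which is not in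
      \<open>?S\<close>; hence the cycle has at least three vertices, as
      \<open>undirected_tree\<close> demands.\<close>
    have "length xs \<noteq> 1"
      using last rtrancl_path_nth[OF p(1), of 0] nS ne by auto
    then have len: "3 \<le> length (x # xs)" using ne by (cases xs) (auto simp: neq_Nil_conv Suc_le_eq)
    have "((x # xs) ! i, (x # xs) ! (Suc i mod length (x # xs))) \<in> \<tau> \<union> \<tau>\<inverse>" if "i < length (x # xs)" for i
    proof (cases "i < length xs")
      case True
      then have "((x # xs) ! i, xs ! i) \<in> ?S" using rtrancl_path_nth[OF p(1)] by blast
      then show ?thesis using True sub\<tau> by auto
    next
      case False
      then have i: "i = length xs" using that by simp
      have "(x # xs) ! i = y" using last ne i by (simp add: nth_Cons')
      then show ?thesis using i xy(1) by simp
    qed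
    then show False
      using tree len p(2) unfolding undirected_tree_def by blast
  qed
  then show ?thesis using that[of \<phi>] sub\<tau> \<phi>r toroot unfolding tree_map_def by blast
qed

text \<open>The map sum may include choices that are not edges, because such a choice has rate 0.
  The property \<open>C\<close> is arbitrary so that the partition function and the containment
  events are both covered.\<close>

lemma tree_sum_eq_map_sum:
  fixes w :: "'x::finite \<Rightarrow> 'x \<Rightarrow> real"
  assumes w: "\<And>x y. w x y \<ge> 0"
  shows "(\<Sum>\<tau> | \<tau> \<in> rooted_spanning_trees w \<and> C \<tau>. tree_weight w \<tau> * q (root_of \<tau>))
    = (\<Sum>\<phi> | tree_map \<phi> \<and> C (map_graph \<phi>). \<Prod>a\<in>UNIV. if a = \<phi> a then q a else w a (\<phi> a))"
    (is "_ = sum ?P ?T")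
proof -
  have eq: "{\<tau>. \<tau> \<in> rooted_spanning_trees w \<and> C \<tau>}
      = map_graph ` {\<phi>. tree_map \<phi> \<and> C (map_graph \<phi>) \<and> map_graph \<phi> \<subseteq> edges w}" (is "_ = _ ` ?T'")
  proof (intro equalityI subsetI)
    fix \<tau> assume t: "\<tau> \<in> {\<tau>. \<tau> \<in> rooted_spanning_trees w \<and> C \<tau>}"
    then obtain r where r: "spanning_tree_rooted_at w r \<tau>" by (auto simp: rooted_spanning_trees_def)
    then obtain \<phi> where "tree_map \<phi>" "\<tau> = map_graph \<phi>" by (rule spanning_tree_is_map_graph)
    then show "\<tau> \<in> map_graph ` ?T'" using t r by (auto simp: spanning_tree_rooted_at_def)
  qed (auto simp: rooted_spanning_trees_def tree_map_def intro: spanning_tree_map_graph)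
  have weight: "tree_weight w (map_graph \<phi>) * q (root_of (map_graph \<phi>)) = ?P \<phi>" if "tree_map \<phi>" for \<phi>
  proof -
    from that obtain r where r: "\<phi> r = r" "\<forall>x. \<exists>k. (\<phi> ^^ k) x = r" by (auto simp: tree_map_def)
    have uniq: "\<phi> a = a \<longleftrightarrow> a = r" for a using tree_map_fix_unique[OF r] r(1) by metis
    have "map_graph \<phi> = (\<lambda>a. (a, \<phi> a)) ` (UNIV - {r})" by (auto simp: map_graph_def uniq)
    then have "tree_weight w (map_graph \<phi>) = (\<Prod>a\<in>UNIV - {r}. w a (\<phi> a))"
      unfolding tree_weight_def by (simp add: prod.reindex inj_on_def)
    also have "\<dots> = (\<Prod>a\<in>UNIV - {r}. if a = \<phi> a then q a else w a (\<phi> a))"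
      by (rule prod.cong) (auto dest: uniq[THEN iffD1, OF sym])
    finally show ?thesis
      using prod.remove[of UNIV r "\<lambda>a. if a = \<phi> a then q a else w a (\<phi> a)"]
      by (simp add: root_of_map_graph[OF r] r(1))
  qed
  have "(\<Sum>\<tau> | \<tau> \<in> rooted_spanning_trees w \<and> C \<tau>. tree_weight w \<tau> * q (root_of \<tau>)) = sum ?P ?T'"
    unfolding eq
    by (subst sum.reindex) (auto intro: inj_on_subset[OF inj_map_graph] intro!: sum.cong simp: weight)
  also have "\<dots> = sum ?P ?T"
  proof (rule sum.mono_neutral_left)
    show "\<forall>\<phi>\<in>?T - ?T'. ?P \<phi> = 0"
    proof
      fix \<phi> assume "\<phi> \<in> ?T - ?T'"
      then obtain a where a: "\<phi> a \<noteq> a" "(a, \<phi> a) \<notin> edges w" by (auto simp: map_graph_def)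
      then have "w a (\<phi> a) = 0" using w[of a "\<phi> a"] by (auto simp: edges_def)
      then have "(if a = \<phi> a then q a else w a (\<phi> a)) = 0" using a(1) by auto
      then show "?P \<phi> = 0" by (intro prod_zero bexI[of _ a]) simp_all
    qed
  qed auto
  finally show ?thesis .
qed

section \<open>Expansion of determinants over orientations\<close>

lemma prod_add_expand:
  fixes f g :: "'i \<Rightarrow> real"
  assumes "finite A"
  shows "(\<Prod>j\<in>A. f j + g j) = (\<Sum>B\<in>Pow A. \<Prod>j\<in>A. if j \<in> B then g j else f j)"
  unfolding add.commute[of "f _"] prod_add[OF assms]
proof (rule sum.cong)
  fix B assume "B \<in> Pow A"
  then have "A \<inter> {j. j \<in> B} = B" "A \<inter> - {j. j \<in> B} = A - B" by auto
  then show "(\<Prod>j\<in>B. g j) * (\<Prod>j\<in>A - B. f j) = (\<Prod>j\<in>A. if j \<in> B then g j else f j)"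
    using assms by (simp add: prod.If_cases)
qed simp

lemma det_on_add_columns:
  assumes "finite A"
  shows "det_on A (\<lambda>i j. f i j + g i j) = (\<Sum>B\<in>Pow A. det_on A (\<lambda>i j. if j \<in> B then g i j else f i j))"
proof -
  have "(\<Prod>i\<in>A. f i (p i) + g i (p i)) = (\<Sum>B\<in>Pow A. \<Prod>i\<in>A. if p i \<in> B then g i (p i) else f i (p i))"
    if "p permutes A" for p
  proof -
    \<comment> \<open>The inverse permutation indexes the factors by columns, where the set
      \<open>B\<close> no longer depends on \<open>p\<close>.\<close>
    have re: "(\<Prod>i\<in>A. h i (p i)) = (\<Prod>j\<in>A. h (inv p j) j)" for h :: "'a \<Rightarrow> 'a \<Rightarrow> real"
      using prod.permute[OF that, of "\<lambda>j. h (inv p j) j"] permutes_inverses(2)[OF that]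
      by (simp add: comp_def)
    have "(\<Prod>i\<in>A. f i (p i) + g i (p i)) = (\<Prod>j\<in>A. f (inv p j) j + g (inv p j) j)"
      by (rule re[of "\<lambda>i j. f i j + g i j"])
    also have "\<dots> = (\<Sum>B\<in>Pow A. \<Prod>j\<in>A. if j \<in> B then g (inv p j) j else f (inv p j) j)"
      by (rule prod_add_expand[OF assms])
    also have "\<dots> = (\<Sum>B\<in>Pow A. \<Prod>i\<in>A. if p i \<in> B then g i (p i) else f i (p i))"
      by (simp only: re[of "\<lambda>i j. if j \<in> _ then g i j else f i j"])
    finally show ?thesis .
  qed
  then show ?thesis
    unfolding det_on_def
    by (subst sum.swap) (simp add: sum_distrib_left)
qed

text \<open>In the term for \<open>B\<close> the columns in \<open>B\<close> use the reversed edge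
  with a minus sign. By antisymmetry the rows in \<open>B\<close> may be reversed at the cost of the
  same signs, and the two sign factors cancel, leaving the minor over the reoriented edges.\<close>

lemma det_on_antisymmetrized:
  fixes K :: "'x \<times> 'x \<Rightarrow> 'x \<times> 'x \<Rightarrow> real"
  assumes fin: "finite A" and anti: "\<And>e e'. K (prod.swap e) e' = - K e e'"
    and ori: "\<And>e. e \<in> A \<Longrightarrow> prod.swap e \<notin> A"
  shows "det_on A (\<lambda>e e'. K e e' - K e (prod.swap e')) =
    (\<Sum>B\<in>Pow A. det_on ((\<lambda>e. if e \<in> B then prod.swap e else e) ` A) K)"
proof -
  have "det_on A (\<lambda>e e'. if e' \<in> B then - K e (prod.swap e') else K e e')
      = det_on ((\<lambda>e. if e \<in> B then prod.swap e else e) ` A) K" for B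
  proof -
    let ?h = "\<lambda>e. if e \<in> B then prod.swap e else e"
    let ?s = "\<lambda>e. if e \<in> B then - 1 else 1 :: real"
    \<comment> \<open>Two edges could merge under reorientation only if they were opposite to each
      other, which \<open>ori\<close> excludes.\<close>
    have inj: "inj_on ?h A"
    proof (rule inj_onI)
      fix x y assume *: "x \<in> A" "y \<in> A" "?h x = ?h y"
      then show "x = y" using ori[of x] ori[of y]
        by (metis swap_swap)
    qed
    have s1: "(\<Prod>e\<in>A. ?s e) * ((\<Prod>e\<in>A. ?s e) * r) = r" for r
    proof -
      have "(\<Prod>e\<in>A. ?s e) * (\<Prod>e\<in>A. ?s e) = (\<Prod>e\<in>A. ?s e * ?s e)" by (rule prod.distrib[symmetric])
      also have "\<dots> = 1" by (rule prod.neutral) auto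
      finally show ?thesis by (simp add: mult.assoc[symmetric])
    qed
    have "det_on A (\<lambda>e e'. if e' \<in> B then - K e (prod.swap e') else K e e')
        = det_on A (\<lambda>e e'. ?s e * (K (?h e) (?h e') * ?s e'))"
      by (rule det_on_cong) (auto simp: anti)
    also have "\<dots> = det_on A (\<lambda>e e'. K (?h e) (?h e'))"
      by (simp only: det_on_scale_rows[OF fin] det_on_scale_columns[OF fin] s1)
    also have "\<dots> = det_on (?h ` A) K"
      by (rule det_on_reindex[OF inj_on_imp_bij_betw[OF inj] fin, symmetric])
    finally show ?thesis .
  qed
  then show ?thesis
    using det_on_add_columns[OF fin, of K "\<lambda>e e'. - K e (prod.swap e')"] by simp
qed

lemma rooted_spanning_tree_antisym:
  assumes "\<tau> \<in> rooted_spanning_trees w" "e \<in> \<tau>"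
  shows "prod.swap e \<notin> \<tau>"
  using assms by (cases e) (auto simp: rooted_spanning_trees_def spanning_tree_rooted_at_def)

section \<open>Events of the random rooted tree\<close>

context
  fixes w :: "'x::finite \<Rightarrow> 'x \<Rightarrow> real" and q :: "'x \<Rightarrow> real"
    and N :: "'o measure" and T :: "'o \<Rightarrow> ('x \<times> 'x) set"
  assumes T: "random_rooted_tree w q N T"
begin

interpretation prob_space N
  using T by (simp add: random_rooted_tree_def)

lemma random_tree_in: "\<omega> \<in> space N \<Longrightarrow> T \<omega> \<in> rooted_spanning_trees w"
  using T measurable_space[of T N "count_space (rooted_spanning_trees w)" \<omega>]
  by (simp add: random_rooted_tree_def)

lemma random_tree_event: "{\<omega> \<in> space N. C (T \<omega>)} \<in> sets N"
proof -
  have "T -` {\<tau>\<in>rooted_spanning_trees w. C \<tau>} \<inter> space N \<in> sets N"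
    using T by (intro measurable_sets) (auto simp: random_rooted_tree_def)
  moreover have "T -` {\<tau>\<in>rooted_spanning_trees w. C \<tau>} \<inter> space N = {\<omega> \<in> space N. C (T \<omega>)}"
    using random_tree_in by auto
  ultimately show ?thesis by simp
qed

lemma random_tree_prob:
  "measure N {\<omega>\<in>space N. C (T \<omega>)} =
    (\<Sum>\<tau> | \<tau> \<in> rooted_spanning_trees w \<and> C \<tau>. tree_weight w \<tau> * q (root_of \<tau>)) /
    (\<Sum>\<tau>\<in>rooted_spanning_trees w. tree_weight w \<tau> * q (root_of \<tau>))"
proof -
  let ?F = "{\<tau>. \<tau> \<in> rooted_spanning_trees w \<and> C \<tau>}"
  have "{\<omega>\<in>space N. C (T \<omega>)} = (\<Union>\<tau>\<in>?F. {\<omega>\<in>space N. T \<omega> = \<tau>})"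
    using random_tree_in by auto
  then have "measure N {\<omega>\<in>space N. C (T \<omega>)} = (\<Sum>\<tau>\<in>?F. measure N {\<omega>\<in>space N. T \<omega> = \<tau>})"
    using random_tree_event
    by (simp only:) (rule finite_measure_finite_Union, auto simp: disjoint_family_on_def)
  also have "\<dots> = (\<Sum>\<tau>\<in>?F. tree_weight w \<tau> * q (root_of \<tau>) /
    (\<Sum>\<tau>\<in>rooted_spanning_trees w. tree_weight w \<tau> * q (root_of \<tau>)))"
    using T by (intro sum.cong) (auto simp: random_rooted_tree_def)
  finally show ?thesis by (simp add: sum_divide_distrib)
qed

text \<open>Division by 0 yields 0, so a vanishing normalization would give every event probability
  0, including the whole space.\<close>

lemma tree_partition_nonzero:
  "(\<Sum>\<tau>\<in>rooted_spanning_trees w. tree_weight w \<tau> * q (root_of \<tau>)) \<noteq> 0"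
  using random_tree_prob[of "\<lambda>_. True"] prob_space by auto

text \<open>The determinant of the choice matrix is the partition function, hence nonzero. The
  inverse is fixed before \<open>A\<close>, so one kernel serves all edge sets; the unoriented
  statement needs this for all reorientations at once.\<close>

lemma random_tree_contains:
  assumes w: "\<And>x y. w x y \<ge> 0"
  obtains N' :: "real ^ 'x ^ 'x" where
    "choice_matrix c (\<lambda>a b. if a = b then q a else w a b) ** N' = mat 1"
    "\<And>A. (\<And>e. e \<in> A \<Longrightarrow> fst e \<noteq> snd e) \<Longrightarrow> measure N {\<omega>\<in>space N. A \<subseteq> T \<omega>} =
      det_on A (\<lambda>e e'. (N' $ fst e $ fst e' - N' $ snd e $ fst e') * w (fst e') (snd e'))"
proof -
  let ?W = "\<lambda>a b. if a = b then q a else w a b"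
  let ?Z = "\<Sum>\<tau>\<in>rooted_spanning_trees w. tree_weight w \<tau> * q (root_of \<tau>)"
  have Z: "det (choice_matrix c ?W) = ?Z"
    using tree_sum_eq_map_sum[OF w, where C = "\<lambda>_. True" and q = q] by (simp add: det_choice_matrix)
  then have "invertible (choice_matrix c ?W)"
    using tree_partition_nonzero by (simp add: invertible_det_nz)
  then obtain N' where N': "choice_matrix c ?W ** N' = mat 1" by (auto simp: invertible_def)
  have "measure N {\<omega>\<in>space N. A \<subseteq> T \<omega>} =
      det_on A (\<lambda>e e'. (N' $ fst e $ fst e' - N' $ snd e $ fst e') * w (fst e') (snd e'))"
    if nl: "\<And>e. e \<in> A \<Longrightarrow> fst e \<noteq> snd e" for A
  proof -
    have "A \<subseteq> map_graph \<phi> \<longleftrightarrow> (\<forall>e\<in>A. \<phi> (fst e) = snd e)" for \<phi>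
      using nl by (force simp: map_graph_def)
    then have "measure N {\<omega>\<in>space N. A \<subseteq> T \<omega>} =
        (\<Sum>\<phi> | tree_map \<phi> \<and> (\<forall>e\<in>A. \<phi> (fst e) = snd e). \<Prod>a\<in>UNIV. ?W a (\<phi> a)) / ?Z"
      using tree_sum_eq_map_sum[OF w, where C = "\<lambda>\<tau>. A \<subseteq> \<tau>" and q = q]
      by (simp add: random_tree_prob)
    also have "\<dots> = det_on A (\<lambda>e e'. (N' $ fst e $ fst e' - N' $ snd e $ fst e') * ?W (fst e') (snd e'))"
      using tree_sum_containing[OF N' nl] tree_partition_nonzero unfolding Z by simp
    also have "\<dots> = det_on A (\<lambda>e e'. (N' $ fst e $ fst e' - N' $ snd e $ fst e') * w (fst e') (snd e'))"
      by (rule det_on_cong) (simp add: nl)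
    finally show ?thesis .
  qed
  then show ?thesis using that N' by blast
qed

text \<open>A tree never contains an edge together with its reverse, so the set \<open>B\<close> of
  reversed edges can be read off from the tree. This makes the events for different \<open>B\<close>
  disjoint.\<close>

lemma random_tree_contains_unoriented:
  assumes ori: "\<And>e. e \<in> A \<Longrightarrow> prod.swap e \<notin> A"
  shows "measure N {\<omega>\<in>space N. \<forall>e\<in>A. e \<in> T \<omega> \<or> prod.swap e \<in> T \<omega>} =
    (\<Sum>B\<in>Pow A. measure N {\<omega>\<in>space N. (\<lambda>e. if e \<in> B then prod.swap e else e) ` A \<subseteq> T \<omega>})"
    (is "_ = (\<Sum>B\<in>_. measure N (?E B))")
proof -
  have B: "B = {e \<in> A. prod.swap e \<in> T \<omega>}" if "\<omega> \<in> ?E B" "B \<subseteq> A" for \<omega> B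
  proof -
    have \<omega>: "\<omega> \<in> space N" and sub: "\<And>e. e \<in> A \<Longrightarrow> (if e \<in> B then prod.swap e else e) \<in> T \<omega>"
      using that(1) by auto
    have "e \<in> B \<longleftrightarrow> prod.swap e \<in> T \<omega>" if "e \<in> A" for e
      using sub[OF that] rooted_spanning_tree_antisym[OF random_tree_in[OF \<omega>], of e] by (auto split: if_splits)
    then show ?thesis using that(2) by auto
  qed
  have "{\<omega>\<in>space N. \<forall>e\<in>A. e \<in> T \<omega> \<or> prod.swap e \<in> T \<omega>} = (\<Union>B\<in>Pow A. ?E B)" (is "?L = ?R")
  proof (intro equalityI subsetI)
    fix \<omega> assume "\<omega> \<in> ?L"
    then show "\<omega> \<in> ?R" by (intro UN_I[of "{e \<in> A. prod.swap e \<in> T \<omega>}"]) auto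
  next
    fix \<omega> assume "\<omega> \<in> ?R"
    then obtain B where "\<omega> \<in> ?E B" by blast
    then have "\<omega> \<in> space N" and "\<And>e. e \<in> A \<Longrightarrow> (if e \<in> B then prod.swap e else e) \<in> T \<omega>" by auto
    then show "\<omega> \<in> ?L" by (smt (verit) mem_Collect_eq)
  qed
  moreover have "measure N (\<Union>B\<in>Pow A. ?E B) = (\<Sum>B\<in>Pow A. measure N (?E B))"
  proof (rule finite_measure_finite_Union)
    show "disjoint_family_on ?E (Pow A)"
      unfolding disjoint_family_on_def using B by (metis (no_types, lifting) PowD disjoint_iff)
    show "?E ` Pow A \<subseteq> sets N" using random_tree_event by auto
  qed simp
  ultimately show ?thesis by simp
qed

end

section \<open>Step paths on a fine grid\<close>

lemma step_path_right:
  assumes "step_path c" "0 \<le> t"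
  obtains e where "e > 0" "\<And>s. t \<le> s \<Longrightarrow> s < t + e \<Longrightarrow> c s = c t"
proof -
  have "\<forall>\<^sub>F s in at_right t. c s = c t" using assms by (simp add: step_path_def)
  then obtain b where "b > t" "\<And>s. t < s \<Longrightarrow> s < b \<Longrightarrow> c s = c t"
    by (auto simp: eventually_at_right_field)
  then show ?thesis
    by (intro that[of "b - t"]) (auto simp: le_less)
qed

lemma step_path_left:
  assumes "step_path c" "0 < t"
  obtains e x where "e > 0" "\<And>s. t - e < s \<Longrightarrow> s < t \<Longrightarrow> c s = x"
proof -
  obtain x where "\<forall>\<^sub>F s in at_left t. c s = x" using assms by (auto simp: step_path_def)
  then obtain b where "b < t" "\<And>s. b < s \<Longrightarrow> s < t \<Longrightarrow> c s = x"
    by (auto simp: eventually_at_left_field)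
  then show ?thesis by (intro that[of "t - b" x]) auto
qed

text \<open>If \<open>y\<close> is avoided up to and including \<open>t\<close>, right continuity
  extends this to a short interval after \<open>t\<close>, so the infimum lies strictly beyond
  \<open>t\<close>. In particular a finite infimum is attained.\<close>

lemma less_hitting_time_iff:
  assumes c: "step_path c" and t: "0 \<le> t"
  shows "ereal t < hitting_time c y \<longleftrightarrow> (\<forall>s\<in>{0..t}. c s \<noteq> y)"
proof
  assume *: "ereal t < hitting_time c y"
  show "\<forall>s\<in>{0..t}. c s \<noteq> y"
  proof (intro ballI notI)
    fix s assume "s \<in> {0..t}" "c s = y"
    then have "hitting_time c y \<le> ereal s" unfolding hitting_time_def by (intro Inf_lower) auto
    then show False using * \<open>s \<in> {0..t}\<close> by (metis atLeastAtMost_iff ereal_less_eq(3) le_less_trans not_less)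
  qed
next
  assume *: "\<forall>s\<in>{0..t}. c s \<noteq> y"
  obtain e where e: "e > 0" "\<And>s. t \<le> s \<Longrightarrow> s < t + e \<Longrightarrow> c s = c t"
    using step_path_right[OF c t] by blast
  have "ereal (t + e) \<le> hitting_time c y"
    unfolding hitting_time_def
  proof (rule Inf_greatest)
    fix v assume "v \<in> ereal ` {t. 0 \<le> t \<and> c t = y}"
    then obtain s where s: "v = ereal s" "0 \<le> s" "c s = y" by auto
    have "\<not> s < t + e"
      using s(2,3) * e(2)[of s] t by (cases "s \<le> t") force+
    then show "ereal (t + e) \<le> v" using s(1) by simp
  qed
  moreover have "ereal t < ereal (t + e)" using e(1) by simp
  ultimately show "ereal t < hitting_time c y" by (rule less_le_trans[rotated])
qed

lemma hitting_time_finite: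
  assumes c: "step_path c" and fin: "hitting_time c y < \<infinity>"
  obtains \<tau> where "hitting_time c y = ereal \<tau>" "0 \<le> \<tau>" "c \<tau> = y" "\<And>s. 0 \<le> s \<Longrightarrow> s < \<tau> \<Longrightarrow> c s \<noteq> y"
proof -
  have nn: "0 \<le> hitting_time c y" unfolding hitting_time_def by (rule Inf_greatest) auto
  then obtain \<tau> where \<tau>: "hitting_time c y = ereal \<tau>" "0 \<le> \<tau>"
    using fin by (cases "hitting_time c y") auto
  have before: "c s \<noteq> y" if "0 \<le> s" "s < \<tau>" for s
    using less_hitting_time_iff[OF c that(1), of y] that by (auto simp: \<tau>(1))
  have "\<not> ereal \<tau> < hitting_time c y" by (simp add: \<tau>(1))
  then obtain s where s: "0 \<le> s" "s \<le> \<tau>" "c s = y"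
    using less_hitting_time_iff[OF c \<tau>(2), of y] by auto
  then have "c \<tau> = y" using before[of s] by (cases "s = \<tau>") auto
  then show ?thesis using that \<tau> before by blast
qed

text \<open>Every time has a neighbourhood on each side of which the path is constant. The Lebesgue
  number of this cover of \<open>{0..R}\<close> is a window length for which the path changes at
  most once, at the centre of the covering ball.\<close>

lemma step_path_uniform:
  assumes c: "step_path c"
  obtains \<delta> where "\<delta> > 0" "\<And>s s'. 0 \<le> s \<Longrightarrow> s \<le> s' \<Longrightarrow> s' \<le> R \<Longrightarrow> s' - s < \<delta> \<Longrightarrow>
     \<exists>u\<in>{s..s'}. (\<forall>r. s \<le> r \<and> r < u \<longrightarrow> c r = c s) \<and> (\<forall>r\<in>{u..s'}. c r = c s')"
proof -
  \<comment> \<open>The restriction \<open>0 \<le> s\<close> makes the condition on the left void at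
    \<open>t = 0\<close>, where no left limit is given.\<close>
  have "\<exists>e>0. \<exists>x. (\<forall>s. t \<le> s \<and> s < t + e \<longrightarrow> c s = c t) \<and> (\<forall>s. 0 \<le> s \<and> t - e < s \<and> s < t \<longrightarrow> c s = x)"
    if t: "0 \<le> t" for t
  proof -
    obtain e where e: "e > 0" "\<And>s. t \<le> s \<Longrightarrow> s < t + e \<Longrightarrow> c s = c t"
      using step_path_right[OF c t] by blast
    show ?thesis
    proof (cases "t = 0")
      case True
      then have "\<forall>s. 0 \<le> s \<and> t - e < s \<and> s < t \<longrightarrow> c s = c 0" by auto
      moreover have "\<forall>s. t \<le> s \<and> s < t + e \<longrightarrow> c s = c t" by (auto intro!: e(2))
      ultimately show ?thesis by (intro exI[of _ e] conjI exI[of _ "c 0"] e(1))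
    next
      case False
      then have "0 < t" using t by simp
      then obtain e' x where e': "e' > 0" "\<And>s. t - e' < s \<Longrightarrow> s < t \<Longrightarrow> c s = x"
        by (rule step_path_left[OF c]) (rule that)
      show ?thesis
      proof (intro exI conjI allI impI)
        show "0 < min e e'" using e(1) e'(1) by simp
        show "c s = c t" if "t \<le> s \<and> s < t + min e e'" for s by (rule e(2)) (use that in auto)
        show "c s = x" if "0 \<le> s \<and> t - min e e' < s \<and> s < t" for s by (rule e'(2)) (use that in auto)
      qed
    qed
  qed
  then obtain e x where ex: "\<And>t. 0 \<le> t \<Longrightarrow> e t > 0"
    "\<And>t s. 0 \<le> t \<Longrightarrow> t \<le> s \<Longrightarrow> s < t + e t \<Longrightarrow> c s = c t"
    "\<And>t s. 0 \<le> t \<Longrightarrow> 0 \<le> s \<Longrightarrow> t - e t < s \<Longrightarrow> s < t \<Longrightarrow> c s = x t"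
    by metis
  have opens: "open B" if "B \<in> (\<lambda>t. ball t (e t)) ` {0..R}" for B using that by auto
  have "{0..R} \<subseteq> (\<Union>t\<in>{0..R}. ball t (e t))" using ex(1) by force
  then obtain \<delta> where \<delta>: "\<delta> > 0" "\<And>s. s \<in> {0..R} \<Longrightarrow> \<exists>B\<in>(\<lambda>t. ball t (e t)) ` {0..R}. ball s \<delta> \<subseteq> B"
    by (rule Heine_Borel_lemma[OF compact_Icc _ opens]) (use that in blast)+
  show ?thesis
  proof (rule that[OF \<delta>(1)])
    fix s s' assume s: "0 \<le> s" "s \<le> s'" "s' \<le> R" "s' - s < \<delta>"
    then obtain t where t: "0 \<le> t" "ball s \<delta> \<subseteq> ball t (e t)"
      using \<delta>(2)[of s] by auto
    have in_ball: "t - e t < r" "r < t + e t" if "r \<in> {s..s'}" for r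
    proof -
      have "r \<in> ball s \<delta>" using that s by (auto simp: dist_real_def)
      then have "r \<in> ball t (e t)" using t(2) by blast
      then show "t - e t < r" "r < t + e t" by (auto simp: dist_real_def)
    qed
    have up: "c r = c t" if "r \<in> {s..s'}" "t \<le> r" for r
      using ex(2)[OF t(1) that(2) in_ball(2)[OF that(1)]] .
    have lo: "c r = x t" if "r \<in> {s..s'}" "r < t" for r
      using ex(3)[OF t(1) _ in_ball(1)[OF that(1)] that(2)] that(1) s(1) by auto
    show "\<exists>u\<in>{s..s'}. (\<forall>r. s \<le> r \<and> r < u \<longrightarrow> c r = c s) \<and> (\<forall>r\<in>{u..s'}. c r = c s')"
    \<comment> \<open>The centre \<open>t\<close> is the change point if it lies in the window after
      its start; otherwise the path is constant there and \<open>s\<close> serves.\<close>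
    proof (cases "s < t \<and> t \<le> s'")
      case True
      have cs: "x t = c s" using lo[of s] True s by simp
      have cs': "c t = c s'" using up[of s'] True s by simp
      show ?thesis
      proof (intro bexI[of _ t] conjI allI impI ballI)
        show "c r = c s" if "s \<le> r \<and> r < t" for r using lo[of r] that True cs by auto
        show "c r = c s'" if "r \<in> {t..s'}" for r using up[of r] that True cs' by auto
      qed (use True in auto)
    next
      case False
      have "c r = c s" if "r \<in> {s..s'}" for r
      proof (cases "t \<le> s")
        case True
        then show ?thesis using up[of r] up[of s] that s by auto
      next
        case nts: False
        then show ?thesis using lo[of r] lo[of s] that s False by auto
      qed
      then have const: "c r = c s'" if "r \<in> {s..s'}" for r using that s(2) by (metis atLeastAtMost_iff order_refl)
      show ?thesis using s(2) by (intro bexI[of _ s] conjI ballI const allI impI) auto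
    qed
  qed
qed

section \<open>True jumps and jumps seen on a grid\<close>

definition jumps :: "(real \<Rightarrow> 'x) \<Rightarrow> real \<Rightarrow> 'x \<Rightarrow> 'x \<Rightarrow> real set" where
  "jumps c \<tau> a b = {t. 0 < t \<and> t \<le> \<tau> \<and> (\<forall>\<^sub>F s in at_left t. c s = a) \<and> c t = b}"

text \<open>Only the left end of a cell has to precede \<open>\<tau>\<close>; the last cell may
  reach beyond it. This is the form to which the Markov property at the left end applies.\<close>

definition grid_jumps :: "(real \<Rightarrow> 'x) \<Rightarrow> real \<Rightarrow> real \<Rightarrow> 'x \<Rightarrow> 'x \<Rightarrow> nat set" where
  "grid_jumps c \<tau> h a b = {k. real k * h < \<tau> \<and> c (real k * h) = a \<and> c (real (Suc k) * h) = b}"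

lemma at_left_const:
  assumes "\<forall>\<^sub>F s in at_left t. c s = a" "(s::real) < t" "\<And>r. s \<le> r \<Longrightarrow> r < t \<Longrightarrow> c r = b"
  shows "a = b"
proof -
  have "\<forall>\<^sub>F r in at_left t. s < r \<and> r < t"
    using assms(2) by (auto simp: eventually_at_left_field)
  with assms(1) have "\<forall>\<^sub>F r in at_left t. a = b"
    by eventually_elim (use assms(3) in force)
  then show ?thesis by simp
qed

text \<open>The first change happens at the infimum of the later times with a different value, and
  right continuity puts the new value at the infimum itself.\<close>

lemma exists_jump:
  assumes c: "step_path c" and s: "0 \<le> s" "s \<le> s'" "c s \<noteq> c s'"
  obtains t where "s < t" "t \<le> s'" "\<forall>\<^sub>F r in at_left t. c r = c s" "c t \<noteq> c s"
proof -
  let ?B = "{r. s \<le> r \<and> r \<le> s' \<and> c r \<noteq> c s}"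
  define t where "t = Inf ?B"
  have s'B: "s' \<in> ?B" using s by auto
  have bdd: "bdd_below ?B" by (rule bdd_belowI[of _ s]) auto
  have t: "s \<le> t" "t \<le> s'"
    unfolding t_def using s'B bdd by (auto intro!: cInf_greatest cInf_lower)
  have before: "c r = c s" if "s \<le> r" "r < t" for r
    using that t cInf_lower[OF _ bdd, of r] unfolding t_def[symmetric] by force
  have ct: "c t \<noteq> c s"
  proof
    assume eq: "c t = c s"
    obtain e where e: "e > 0" "\<And>s. t \<le> s \<Longrightarrow> s < t + e \<Longrightarrow> c s = c t"
      using step_path_right[OF c order_trans[OF s(1) t(1)]] by blast
    have "t + e \<le> Inf ?B"
    proof (rule cInf_greatest)
      fix r assume "r \<in> ?B"
      then have "t \<le> r" "c r \<noteq> c t" unfolding t_def using bdd eq by (auto intro: cInf_lower simp: t_def)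
      then show "t + e \<le> r" using e(2)[of r] by force
    qed (use s'B in blast)
    then show False using e(1) by (simp add: t_def)
  qed
  then have "s < t" using t(1) by (cases "s = t") auto
  moreover have "\<forall>\<^sub>F r in at_left t. c r = c s"
    unfolding eventually_at_left_field using \<open>s < t\<close> by (intro exI[of _ s] conjI allI impI before) simp_all
  ultimately show ?thesis using that t ct by blast
qed

text \<open>For \<open>t > 0\<close> this is the index \<open>k\<close> with
  \<open>k * h < t \<le> (k + 1) * h\<close>. Closing cells on the right assigns a jump at a grid
  point to the cell ending there.\<close>

definition cell :: "real \<Rightarrow> real \<Rightarrow> nat" where
  "cell h t = nat (\<lceil>t / h\<rceil> - 1)"

lemma cell_unique:
  assumes "h > 0" "real k * h < t" "t \<le> real (Suc k) * h"
  shows "cell h t = k"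
proof -
  have "\<lceil>t / h\<rceil> = int k + 1"
    using assms by (intro ceiling_unique) (auto simp: field_simps)
  then show ?thesis by (simp add: cell_def)
qed

lemma cell_bounds:
  assumes "h > 0" "t > 0"
  shows "real (cell h t) * h < t" "t \<le> real (Suc (cell h t)) * h"
proof -
  have "\<lceil>t / h\<rceil> \<ge> 1" using assms by (simp add: le_ceiling_iff)
  then have eq: "real (cell h t) = of_int \<lceil>t / h\<rceil> - 1" by (simp add: cell_def)
  show "real (cell h t) * h < t"
    using assms ceiling_correct[of "t / h"] unfolding eq by (simp add: field_simps)
  show "t \<le> real (Suc (cell h t)) * h"
    using ceiling_divide_upper[OF assms(1), of t] unfolding of_nat_Suc eq by simp
qed

lemma grid_before_iff:
  assumes "h > 0"
  shows "real k * h < \<tau> \<longleftrightarrow> k < nat \<lceil>\<tau> / h\<rceil>"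
proof -
  have "real k * h < \<tau> \<longleftrightarrow> of_int (int k) < \<tau> / h" using assms by (simp add: field_simps)
  also have "\<dots> \<longleftrightarrow> int k < \<lceil>\<tau> / h\<rceil>" by (simp only: less_ceiling_iff)
  finally show ?thesis by (simp add: zless_nat_eq_int_zless)
qed

context
  fixes c :: "real \<Rightarrow> 'x::finite" and y :: 'x and \<tau> :: real
  assumes c: "step_path c" and \<tau>: "0 \<le> \<tau>" "c \<tau> = y" "\<And>s. 0 \<le> s \<Longrightarrow> s < \<tau> \<Longrightarrow> c s \<noteq> y"
begin

text \<open>On a fine grid each cell starting before \<open>\<tau>\<close> contains at most one
  change, so a grid jump comes from exactly one true jump between the same two states.\<close>

lemma grid_jumps_bij:
  obtains \<delta> where "\<delta> > 0"
    "\<And>h a b. 0 < h \<Longrightarrow> h < \<delta> \<Longrightarrow> a \<noteq> b \<Longrightarrow> bij_betw (cell h) (jumps c \<tau> a b) (grid_jumps c \<tau> h a b)"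
proof -
  \<comment> \<open>The horizon \<open>\<tau> + 1\<close> covers the last cell, which starts before
    \<open>\<tau>\<close> and is shorter than 1.\<close>
  obtain \<delta> where \<delta>: "\<delta> > 0" "\<And>s s'. 0 \<le> s \<Longrightarrow> s \<le> s' \<Longrightarrow> s' \<le> \<tau> + 1 \<Longrightarrow> s' - s < \<delta> \<Longrightarrow>
     \<exists>u\<in>{s..s'}. (\<forall>r. s \<le> r \<and> r < u \<longrightarrow> c r = c s) \<and> (\<forall>r\<in>{u..s'}. c r = c s')"
    using step_path_uniform[OF c] by blast
  show ?thesis
  proof (rule that[of "min \<delta> 1"])
    show "min \<delta> 1 > 0" using \<delta>(1) by simp
    fix h and a b :: 'x assume h: "0 < h" "h < min \<delta> 1" and ab: "a \<noteq> b"
    \<comment> \<open>\<open>u\<close> is the only possible change point of the cell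
      \<open>k\<close>.\<close>
    have ex: "\<forall>k. \<exists>u. real k * h < \<tau> \<longrightarrow> real k * h \<le> u \<and> u \<le> real (Suc k) * h \<and>
        (\<forall>r. real k * h \<le> r \<and> r < u \<longrightarrow> c r = c (real k * h)) \<and>
        (\<forall>r. u \<le> r \<and> r \<le> real (Suc k) * h \<longrightarrow> c r = c (real (Suc k) * h))"
      (is "\<forall>k. \<exists>u. ?P k u")
    proof
      fix k show "\<exists>u. ?P k u"
      proof (cases "real k * h < \<tau>")
        case True
        have "real (Suc k) * h - real k * h < \<delta>" "real (Suc k) * h \<le> \<tau> + 1" "real k * h \<le> real (Suc k) * h"
          using h True by (auto simp: algebra_simps)
        then obtain u where "u \<in> {real k * h..real (Suc k) * h}"
          "\<forall>r. real k * h \<le> r \<and> r < u \<longrightarrow> c r = c (real k * h)"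
          "\<forall>r\<in>{u..real (Suc k) * h}. c r = c (real (Suc k) * h)"
          using \<delta>(2)[of "real k * h" "real (Suc k) * h"] h(1) by (metis mult_nonneg_nonneg less_imp_le of_nat_0_le_iff)
        then show ?thesis by (intro exI[of _ u]) (meson atLeastAtMost_iff)
      qed simp
    qed
    obtain u where "\<forall>k. real k * h < \<tau> \<longrightarrow> real k * h \<le> u k \<and> u k \<le> real (Suc k) * h \<and>
        (\<forall>r. real k * h \<le> r \<and> r < u k \<longrightarrow> c r = c (real k * h)) \<and>
        (\<forall>r. u k \<le> r \<and> r \<le> real (Suc k) * h \<longrightarrow> c r = c (real (Suc k) * h))"
      using choice[OF ex] by blast
    then have u: "\<And>k. real k * h < \<tau> \<Longrightarrow> real k * h \<le> u k"
      "\<And>k. real k * h < \<tau> \<Longrightarrow> u k \<le> real (Suc k) * h"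
      "\<And>k r. real k * h < \<tau> \<Longrightarrow> real k * h \<le> r \<Longrightarrow> r < u k \<Longrightarrow> c r = c (real k * h)"
      "\<And>k r. real k * h < \<tau> \<Longrightarrow> u k \<le> r \<Longrightarrow> r \<le> real (Suc k) * h \<Longrightarrow> c r = c (real (Suc k) * h)"
      by blast+
    have J: "t = u (cell h t) \<and> cell h t \<in> grid_jumps c \<tau> h a b" if t: "t \<in> jumps c \<tau> a b" for t
    proof -
      let ?k = "cell h t"
      have t': "0 < t" "t \<le> \<tau>" "\<forall>\<^sub>F s in at_left t. c s = a" "c t = b" using t unfolding jumps_def by blast+
      note cb = cell_bounds[OF h(1) t'(1)]
      have k: "real ?k * h < \<tau>" using cb t'(2) by simp
      have "\<not> t < u ?k"
      proof
        assume lt: "t < u ?k"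
        have "a = c (real ?k * h)"
          by (rule at_left_const[OF t'(3) cb(1)]) (rule u(3)[OF k], use lt in simp_all)
        moreover have "b = c (real ?k * h)" using u(3)[OF k, of t] lt cb t'(4) by auto
        ultimately show False using ab by simp
      qed
      moreover have "\<not> u ?k < t"
      proof
        assume lt: "u ?k < t"
        have "a = c (real (Suc ?k) * h)"
          by (rule at_left_const[OF t'(3) lt]) (rule u(4)[OF k], use cb in simp_all)
        moreover have "b = c (real (Suc ?k) * h)" using u(4)[OF k, of t] lt cb t'(4) by auto
        ultimately show False using ab by simp
      qed
      ultimately have tu: "t = u ?k" by simp
      have "a = c (real ?k * h)"
        by (rule at_left_const[OF t'(3) cb(1)]) (rule u(3)[OF k], use tu in simp_all)
      moreover have "b = c (real (Suc ?k) * h)" using u(4)[OF k, of t] cb t'(4) tu by auto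
      ultimately show ?thesis using tu k by (simp add: grid_jumps_def)
    qed
    have K: "k \<in> cell h ` jumps c \<tau> a b" if k: "k \<in> grid_jumps c \<tau> h a b" for k
    proof -
      have k': "real k * h < \<tau>" "c (real k * h) = a" "c (real (Suc k) * h) = b"
        using k by (auto simp: grid_jumps_def)
      have ku: "real k * h < u k"
      proof (rule ccontr)
        assume "\<not> real k * h < u k"
        then have "c (real k * h) = c (real (Suc k) * h)"
          using u(4)[OF k'(1), of "real k * h"] h(1) by (auto simp: algebra_simps)
        then show False using ab k' by simp
      qed
      have "\<forall>\<^sub>F s in at_left (u k). c s = a"
        unfolding eventually_at_left_field k'(2)[symmetric]
        by (intro exI[of _ "real k * h"] conjI allI impI ku u(3)[OF k'(1)]) simp_all
      moreover have "c (u k) = b" using u(4)[OF k'(1), of "u k"] u(2)[OF k'(1)] k'(3) by simp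
      \<comment> \<open>A change after \<open>\<tau>\<close> would leave the path at
        \<open>\<tau>\<close> in its state at the cell start, but it is in \<open>y\<close> at
        \<open>\<tau>\<close> and not before.\<close>
      moreover have "u k \<le> \<tau>"
      proof (rule ccontr)
        assume "\<not> u k \<le> \<tau>"
        then have "c \<tau> = c (real k * h)" using u(3)[OF k'(1), of \<tau>] k'(1) by auto
        then show False using \<tau>(2) \<tau>(3)[of "real k * h"] k'(1) h(1) by auto
      qed
      moreover have "0 < u k" using ku h(1) by (smt (verit) mult_nonneg_nonneg of_nat_0_le_iff)
      ultimately have "u k \<in> jumps c \<tau> a b" by (auto simp: jumps_def)
      moreover have "cell h (u k) = k" by (rule cell_unique[OF h(1) ku u(2)[OF k'(1)]])
      ultimately show ?thesis by (metis imageI)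
    qed
    show "bij_betw (cell h) (jumps c \<tau> a b) (grid_jumps c \<tau> h a b)"
      unfolding bij_betw_def
    proof
      show "inj_on (cell h) (jumps c \<tau> a b)" using J by (metis inj_onI)
      show "cell h ` jumps c \<tau> a b = grid_jumps c \<tau> h a b" using J K by blast
    qed
  qed
qed

lemma finite_grid_jumps:
  assumes "h > 0"
  shows "finite (grid_jumps c \<tau> h a b)"
proof (rule finite_subset)
  show "grid_jumps c \<tau> h a b \<subseteq> {k. real k * h < \<tau>}" by (auto simp: grid_jumps_def)
qed (simp add: grid_before_iff[OF assms])

lemma finite_jumps: "a \<noteq> b \<Longrightarrow> finite (jumps c \<tau> a b)"
proof (rule grid_jumps_bij)
  fix \<delta> assume ab: "a \<noteq> b" and \<delta>: "\<delta> > 0"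
    "\<And>h a b. 0 < h \<Longrightarrow> h < \<delta> \<Longrightarrow> a \<noteq> b \<Longrightarrow> bij_betw (cell h) (jumps c \<tau> a b) (grid_jumps c \<tau> h a b)"
  then have "bij_betw (cell (\<delta> / 2)) (jumps c \<tau> a b) (grid_jumps c \<tau> (\<delta> / 2) a b)" by simp
  then show ?thesis using finite_grid_jumps[of "\<delta> / 2" a b] \<delta>(1) by (simp add: bij_betw_finite)
qed

lemma card_grid_jumps_eventually:
  assumes h: "h \<longlonglongrightarrow> (0::real)" "\<And>m. h m > 0"
  shows "\<forall>\<^sub>F m in sequentially. \<forall>a b. a \<noteq> b \<longrightarrow> card (grid_jumps c \<tau> (h m) a b) = card (jumps c \<tau> a b)"
proof (rule grid_jumps_bij)
  fix \<delta> assume \<delta>: "\<delta> > 0"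
    "\<And>h a b. 0 < h \<Longrightarrow> h < \<delta> \<Longrightarrow> a \<noteq> b \<Longrightarrow> bij_betw (cell h) (jumps c \<tau> a b) (grid_jumps c \<tau> h a b)"
  have "\<forall>\<^sub>F m in sequentially. h m < \<delta>" using order_tendstoD(2)[OF h(1) \<delta>(1)] .
  then show ?thesis
    by eventually_elim (use \<delta>(2) h(2) bij_betw_same_card in metis)
qed

text \<open>This bound holds for every step, not only for fine grids, and provides the dominating
  function. A grid jump forces some true jump inside its cell, possibly between other states, and
  \<open>cell\<close> recovers the grid index from that jump.\<close>

lemma card_grid_jumps_le:
  assumes h: "h > 0" and ab: "a \<noteq> b"
  shows "card (grid_jumps c \<tau> h a b) \<le> (\<Sum>(a, b) | a \<noteq> b. card (jumps c \<tau> a b))"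
proof -
  let ?J = "\<Union>(a, b)\<in>{(a, b). a \<noteq> b}. jumps c \<tau> a b"
  have fin: "finite ?J" using finite_jumps by auto
  have "grid_jumps c \<tau> h a b \<subseteq> cell h ` ?J"
  proof
    fix k assume k: "k \<in> grid_jumps c \<tau> h a b"
    then have k': "real k * h < \<tau>" "c (real k * h) = a" "c (real (Suc k) * h) = b"
      by (auto simp: grid_jumps_def)
    \<comment> \<open>Cutting the cell at \<open>\<tau>\<close> ensures that the jump found is not
      later than \<open>\<tau>\<close>; if the cut is effective, the end value is \<open>y\<close>,
      which differs from the value at the start.\<close>
    let ?s' = "min (real (Suc k) * h) \<tau>"
    have "c (real k * h) \<noteq> c ?s'"
      using k' ab \<tau>(2) \<tau>(3)[of "real k * h"] h by (auto simp: min_def)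
    then obtain t where t: "real k * h < t" "t \<le> ?s'" "\<forall>\<^sub>F r in at_left t. c r = c (real k * h)" "c t \<noteq> c (real k * h)"
      using exists_jump[OF c, of "real k * h" ?s'] k' h by (auto simp: algebra_simps)
    have "0 < t" using t(1) h by (smt (verit) mult_nonneg_nonneg of_nat_0_le_iff)
    then have "t \<in> jumps c \<tau> (c (real k * h)) (c t)" using t by (auto simp: jumps_def)
    moreover have "cell h t = k" using t by (intro cell_unique h) auto
    ultimately show "k \<in> cell h ` ?J" using t(4) by force
  qed
  then have "card (grid_jumps c \<tau> h a b) \<le> card (cell h ` ?J)" using fin by (intro card_mono) auto
  also have "\<dots> \<le> card ?J" using fin by (rule card_image_le)
  also have "\<dots> \<le> (\<Sum>p\<in>{(a, b). a \<noteq> b}. card (case p of (a, b) \<Rightarrow> jumps c \<tau> a b))"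
    by (rule card_UN_le) simp
  finally show ?thesis by (simp add: case_prod_beta')
qed

lemma grid_end_tendsto:
  assumes h: "h \<longlonglongrightarrow> (0::real)" "\<And>m. h m > 0"
  shows "\<forall>\<^sub>F m in sequentially. c (real (nat \<lceil>\<tau> / h m\<rceil>) * h m) = y"
proof -
  obtain e where e: "e > 0" "\<And>s. \<tau> \<le> s \<Longrightarrow> s < \<tau> + e \<Longrightarrow> c s = c \<tau>"
    using step_path_right[OF c \<tau>(1)] by blast
  have "\<forall>\<^sub>F m in sequentially. h m < e" using order_tendstoD(2)[OF h(1) e(1)] .
  then show ?thesis
  proof eventually_elim
    case (elim m)
    have "0 \<le> \<tau> / h m" using \<tau>(1) h(2)[of m] by simp
    then have "real (nat \<lceil>\<tau> / h m\<rceil>) = of_int \<lceil>\<tau> / h m\<rceil>" by simp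
    moreover have "\<tau> \<le> of_int \<lceil>\<tau> / h m\<rceil> * h m"
      by (rule ceiling_divide_upper[OF h(2)])
    moreover have "of_int \<lceil>\<tau> / h m\<rceil> * h m < \<tau> + h m"
      using h(2)[of m] ceiling_correct[of "\<tau> / h m"] by (simp add: field_simps)
    ultimately have "c (real (nat \<lceil>\<tau> / h m\<rceil>) * h m) = c \<tau>" using elim by (intro e(2)) auto
    then show ?case by (simp add: \<tau>(2))
  qed
qed

text \<open>Increments of \<open>f\<close> along the grid telescope, and grouping the grid indices
  by their pair of end states yields the counts. Pairs with \<open>a = b\<close> contribute
  increment 0.\<close>

lemma sum_grid_jumps:
  assumes "h > 0"
  shows "(\<Sum>(a, b) | a \<noteq> b. (f b - f a) * real (card (grid_jumps c \<tau> h a b)))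
    = f (c (real (nat \<lceil>\<tau> / h\<rceil>) * h)) - f (c 0)"
proof -
  let ?K = "{..<nat \<lceil>\<tau> / h\<rceil>}"
  have K: "grid_jumps c \<tau> h a b = {k \<in> ?K. c (real k * h) = a \<and> c (real (Suc k) * h) = b}" for a b
    by (auto simp: grid_jumps_def grid_before_iff[OF assms])
  have "(\<Sum>(a, b) | a \<noteq> b. (f b - f a) * real (card (grid_jumps c \<tau> h a b)))
      = (\<Sum>p\<in>UNIV. (f (snd p) - f (fst p)) * real (card (grid_jumps c \<tau> h (fst p) (snd p))))"
    by (rule sum.mono_neutral_cong_left) auto
  also have "\<dots> = (\<Sum>p\<in>UNIV. \<Sum>k | k \<in> ?K \<and> (c (real k * h), c (real (Suc k) * h)) = p. f (snd p) - f (fst p))"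
    by (rule sum.cong) (auto simp: K prod_eq_iff)
  also have "\<dots> = (\<Sum>p\<in>UNIV. \<Sum>k | k \<in> ?K \<and> (c (real k * h), c (real (Suc k) * h)) = p.
      f (c (real (Suc k) * h)) - f (c (real k * h)))"
    by (intro sum.cong) auto
  also have "\<dots> = (\<Sum>k\<in>?K. f (c (real (Suc k) * h)) - f (c (real k * h)))"
    by (rule sum.group) auto
  also have "\<dots> = f (c (real (nat \<lceil>\<tau> / h\<rceil>) * h)) - f (c (real 0 * h))"
    by (rule sum_lessThan_telescope)
  finally show ?thesis by simp
qed

text \<open>For a fine grid the counts equal the true ones and the final grid value is
  \<open>y\<close>, so the grid identity carries over without enumerating the jumps in
  order.\<close>

lemma sum_jumps:
  "(\<Sum>(a, b) | a \<noteq> b. (f b - f a) * real (card (jumps c \<tau> a b))) = f y - f (c 0)"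
proof -
  let ?h = "\<lambda>m. inverse (real (Suc m))"
  have h: "?h \<longlonglongrightarrow> 0" "\<And>m. ?h m > 0" by (rule LIMSEQ_inverse_real_of_nat) simp
  have "\<forall>\<^sub>F m in sequentially.
      (\<Sum>(a, b) | a \<noteq> b. (f b - f a) * real (card (jumps c \<tau> a b))) = f y - f (c 0)"
    using card_grid_jumps_eventually[OF h] grid_end_tendsto[OF h]
  proof eventually_elim
    case (elim m)
    have "(\<Sum>(a, b) | a \<noteq> b. (f b - f a) * real (card (jumps c \<tau> a b)))
        = (\<Sum>(a, b) | a \<noteq> b. (f b - f a) * real (card (grid_jumps c \<tau> (?h m) a b)))"
      by (rule sum.cong) (use elim(1) in auto)
    also have "\<dots> = f y - f (c 0)" using sum_grid_jumps[OF h(2), of f m] elim(2) by simp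
    finally show ?case .
  qed
  then show ?thesis by simp
qed

end

text \<open>The limit \<open>v\<close> is replaced almost everywhere by the liminf of the sequence,
  which supplies its own measurability.\<close>

lemma nn_integral_dominated_convergence_AE:
  fixes u :: "nat \<Rightarrow> 'a \<Rightarrow> ennreal"
  assumes [measurable]: "\<And>i. u i \<in> borel_measurable M" "w \<in> borel_measurable M"
    and bound: "\<And>i. AE x in M. u i x \<le> w x" and w: "(\<integral>\<^sup>+x. w x \<partial>M) < \<infinity>"
    and lim: "AE x in M. (\<lambda>i. u i x) \<longlonglongrightarrow> v x"
  shows "(\<lambda>i. \<integral>\<^sup>+x. u i x \<partial>M) \<longlonglongrightarrow> (\<integral>\<^sup>+x. v x \<partial>M)"
proof -
  have eq: "AE x in M. v x = liminf (\<lambda>i. u i x)"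
    using lim by eventually_elim (simp add: lim_imp_Liminf)
  have "(\<lambda>i. \<integral>\<^sup>+x. u i x \<partial>M) \<longlonglongrightarrow> (\<integral>\<^sup>+x. liminf (\<lambda>i. u i x) \<partial>M)"
    by (rule nn_integral_dominated_convergence[OF _ _ _ bound w])
      (use lim eq in \<open>auto elim!: eventually_mono[OF eventually_conj]\<close>)
  then show ?thesis using nn_integral_cong_AE[OF eq] by simp
qed

text \<open>Here the cells are closed on the left, so a floor locates \<open>t\<close>, in contrast
  to \<open>cell\<close>: the path is sampled at the left end.\<close>

lemma cell_indicator_sum:
  fixes g :: "nat \<Rightarrow> ennreal"
  assumes "h > 0"
  shows "(\<Sum>k<n. g k * indicator {real k * h..<real (Suc k) * h} t)
    = (if 0 \<le> t \<and> nat \<lfloor>t / h\<rfloor> < n then g (nat \<lfloor>t / h\<rfloor>) else 0)"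
proof -
  have "t \<in> {real k * h..<real (Suc k) * h} \<longleftrightarrow> 0 \<le> t \<and> k = nat \<lfloor>t / h\<rfloor>" for k
  proof
    assume *: "t \<in> {real k * h..<real (Suc k) * h}"
    then have "0 \<le> t" using assms by (auto intro: order_trans[rotated])
    moreover have "\<lfloor>t / h\<rfloor> = int k"
      using * assms by (intro floor_unique) (auto simp: field_simps)
    ultimately show "0 \<le> t \<and> k = nat \<lfloor>t / h\<rfloor>" by simp
  next
    assume *: "0 \<le> t \<and> k = nat \<lfloor>t / h\<rfloor>"
    then have "0 \<le> \<lfloor>t / h\<rfloor>" using assms by simp
    then have k: "real k = of_int \<lfloor>t / h\<rfloor>" using * by simp
    show "t \<in> {real k * h..<real (Suc k) * h}"
      using floor_divide_lower[OF assms, of t] floor_divide_upper[OF assms, of t] unfolding of_nat_Suc k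
      by (simp add: add.commute)
  qed
  then have "(\<Sum>k<n. g k * indicator {real k * h..<real (Suc k) * h} t)
      = (\<Sum>k<n. if k = nat \<lfloor>t / h\<rfloor> then (if 0 \<le> t then g k else 0) else 0)"
    by (intro sum.cong) (auto simp: indicator_def)
  then show ?thesis by auto
qed

section \<open>Crossings and occupation times of a stopped path\<close>

context
  fixes c :: "real \<Rightarrow> 'x::finite" and y :: 'x and \<tau> :: real
  assumes c: "step_path c" and \<tau>: "0 \<le> \<tau>" "c \<tau> = y" "\<And>s. 0 \<le> s \<Longrightarrow> s < \<tau> \<Longrightarrow> c s \<noteq> y"
begin

lemma crossings_eq_card_jumps:
  assumes "a \<noteq> b"
  shows "crossings c (ereal \<tau>) (a, b) = of_nat (card (jumps c \<tau> a b))"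
  using finite_jumps[OF c \<tau> assms] unfolding crossings_def jumps_def
  by (simp add: emeasure_count_space)

text \<open>The pathwise form of Dynkin's formula, with losses and gains on separate sides because
  the counts live in \<open>ennreal\<close>.\<close>

lemma crossings_telescope:
  assumes f: "\<And>x. 0 \<le> f x"
  shows "(\<Sum>(a, b) | a \<noteq> b. ennreal (f b) * crossings c (ereal \<tau>) (a, b)) + ennreal (f (c 0))
    = (\<Sum>(a, b) | a \<noteq> b. ennreal (f a) * crossings c (ereal \<tau>) (a, b)) + ennreal (f y)"
proof -
  let ?n = "\<lambda>(a, b). real (card (jumps c \<tau> a b))"
  have "(\<Sum>(a, b) | a \<noteq> b. (f b - f a) * real (card (jumps c \<tau> a b))) = f y - f (c 0)"
    by (rule sum_jumps[OF c \<tau>])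
  then have "(\<Sum>p | fst p \<noteq> snd p. f (snd p) * ?n p) + f (c 0) = (\<Sum>p | fst p \<noteq> snd p. f (fst p) * ?n p) + f y"
    by (simp add: case_prod_beta' left_diff_distrib sum_subtractf)
  moreover have "(\<Sum>p | fst p \<noteq> snd p. ennreal (g p) * crossings c (ereal \<tau>) p) = ennreal (\<Sum>p | fst p \<noteq> snd p. g p * ?n p)"
    if "\<And>p. 0 \<le> g p" for g
  proof -
    have "(\<Sum>p | fst p \<noteq> snd p. ennreal (g p) * crossings c (ereal \<tau>) p)
        = (\<Sum>p | fst p \<noteq> snd p. ennreal (g p * ?n p))"
      using that by (intro sum.cong) (auto simp: crossings_eq_card_jumps ennreal_mult ennreal_of_nat_eq_real_of_nat)
    then show ?thesis using that by (simp add: sum_ennreal case_prod_beta')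
  qed
  ultimately show ?thesis
    using f by (simp add: case_prod_beta' ennreal_plus[symmetric] sum_nonneg del: ennreal_plus)
qed

lemma continuous_off_jumps:
  assumes t: "0 \<le> t" "t < \<tau>" "\<And>a b. a \<noteq> b \<Longrightarrow> t \<notin> jumps c \<tau> a b"
  obtains e where "e > 0" "\<And>s. 0 \<le> s \<Longrightarrow> t - e < s \<Longrightarrow> s \<le> t \<Longrightarrow> c s = c t"
proof (cases "t = 0")
  case True
  show ?thesis by (rule that[of 1]) (use True in auto)
next
  case False
  then have t0: "0 < t" using t by simp
  then obtain e x where e: "e > 0" "\<And>s. t - e < s \<Longrightarrow> s < t \<Longrightarrow> c s = x"
    using step_path_left[OF c] by blast
  have "\<forall>\<^sub>F s in at_left t. c s = x"
    unfolding eventually_at_left_field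
    by (intro exI[of _ "t - e"] conjI allI impI e(2)) (use e(1) in auto)
  then have "x = c t"
    using t(3)[of x "c t"] t0 t(2) by (auto simp: jumps_def)
  then show ?thesis
    by (intro that[of e] e(1)) (metis e(2) less_le)
qed

text \<open>The sums are integrals of step functions sampling the path at left grid points. Away
  from \<open>\<tau>\<close> and the finitely many jump times these eventually equal the integrand,
  and they are bounded with support in \<open>{0..\<tau> + 1}\<close>.\<close>

lemma occupation_limit:
  fixes q :: "'x \<Rightarrow> real"
  assumes q: "\<And>x. 0 \<le> q x" and h: "h \<longlonglongrightarrow> (0::real)" "\<And>m. 0 < h m" "\<And>m. h m \<le> 1"
  shows "(\<lambda>m. \<Sum>k<nat \<lceil>\<tau> / h m\<rceil>. ennreal (h m) * ennreal (q (c (real k * h m))))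
    \<longlonglongrightarrow> (\<integral>\<^sup>+t. ennreal (q (c t)) * indicator {t. 0 \<le> t \<and> t < \<tau>} t \<partial>lborel)"
proof -
  let ?n = "\<lambda>m. nat \<lceil>\<tau> / h m\<rceil>"
  define u where "u m t = (\<Sum>k<?n m. ennreal (q (c (real k * h m))) * indicator {real k * h m..<real (Suc k) * h m} t)" for m t
  have u: "u m t = (if 0 \<le> t \<and> real (nat \<lfloor>t / h m\<rfloor>) * h m < \<tau>
      then ennreal (q (c (real (nat \<lfloor>t / h m\<rfloor>) * h m))) else 0)" for m t
    unfolding u_def cell_indicator_sum[OF h(2)] grid_before_iff[OF h(2)] ..
  have fl: "real (nat \<lfloor>t / h m\<rfloor>) * h m \<le> t" "t - h m < real (nat \<lfloor>t / h m\<rfloor>) * h m" if "0 \<le> t" for t m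
  proof -
    have "0 \<le> t / h m" using that h(2)[of m] by simp
    then have "0 \<le> \<lfloor>t / h m\<rfloor>" by simp
    then have k: "real (nat \<lfloor>t / h m\<rfloor>) = of_int \<lfloor>t / h m\<rfloor>" by simp
    show "real (nat \<lfloor>t / h m\<rfloor>) * h m \<le> t" "t - h m < real (nat \<lfloor>t / h m\<rfloor>) * h m"
      using floor_divide_lower[OF h(2), of t m] floor_divide_upper[OF h(2), of t m] unfolding k
      by (simp_all add: algebra_simps)
  qed
  have "(\<lambda>m. \<integral>\<^sup>+t. u m t \<partial>lborel) \<longlonglongrightarrow> (\<integral>\<^sup>+t. ennreal (q (c t)) * indicator {t. 0 \<le> t \<and> t < \<tau>} t \<partial>lborel)"
  proof (rule nn_integral_dominated_convergence_AE)
    let ?Q = "\<Sum>x\<in>UNIV. q x"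
    show "u m \<in> borel_measurable lborel" for m unfolding u_def by measurable
    show "(\<lambda>t. ennreal ?Q * indicator {0..\<tau> + 1} t) \<in> borel_measurable lborel" by measurable
    have qQ: "q x \<le> ?Q" for x by (rule member_le_sum) (use q in auto)
    show "AE t in lborel. u m t \<le> ennreal ?Q * indicator {0..\<tau> + 1} t" for m
    proof (rule AE_I2)
      fix t
      show "u m t \<le> ennreal ?Q * indicator {0..\<tau> + 1} t"
        using fl[of t m] h(3)[of m] qQ by (auto simp: u indicator_def intro!: ennreal_leI)
    qed
    show "(\<integral>\<^sup>+t. ennreal ?Q * indicator {0..\<tau> + 1} t \<partial>lborel) < \<infinity>"
      using \<tau>(1) by (simp add: nn_integral_cmult_indicator ennreal_mult_less_top)
    let ?B = "insert \<tau> (\<Union>(a, b)\<in>{(a, b). a \<noteq> b}. jumps c \<tau> a b)"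
    have "finite ?B" using finite_jumps[OF c \<tau>] by auto
    then have "AE t in lborel. t \<notin> ?B" by (intro AE_not_in finite_imp_null_set_lborel)
    then show "AE t in lborel. (\<lambda>m. u m t) \<longlonglongrightarrow> ennreal (q (c t)) * indicator {t. 0 \<le> t \<and> t < \<tau>} t"
    proof eventually_elim
      case (elim t)
      consider "t < 0" | "t > \<tau>" "0 \<le> t" | "0 \<le> t" "t < \<tau>" using elim \<tau>(1) by force
      then show ?case
      proof cases
        case 1
        then show ?thesis by (simp add: u)
      next
        case 2
        have "\<forall>\<^sub>F m in sequentially. h m < t - \<tau>" using order_tendstoD(2)[OF h(1)] 2 by simp
        then have "\<forall>\<^sub>F m in sequentially. u m t = 0"
        proof eventually_elim
          case (elim m)
          then show ?case using fl(2)[OF 2(2), of m] by (simp add: u)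
        qed
        then show ?thesis using 2 by (simp add: tendsto_eventually)
      next
        case 3
        obtain e where e: "e > 0" "\<And>s. 0 \<le> s \<Longrightarrow> t - e < s \<Longrightarrow> s \<le> t \<Longrightarrow> c s = c t"
          using continuous_off_jumps[of t] 3 elim by blast
        have "\<forall>\<^sub>F m in sequentially. h m < e" using order_tendstoD(2)[OF h(1) e(1)] .
        then have "\<forall>\<^sub>F m in sequentially. u m t = ennreal (q (c t))"
        proof eventually_elim
          case (elim m)
          have "c (real (nat \<lfloor>t / h m\<rfloor>) * h m) = c t"
            by (rule e(2)) (use fl[OF 3(1), of m] elim h(2)[of m] in auto)
          then show ?case using 3 fl(1)[OF 3(1), of m] by (simp add: u)
        qed
        then show ?thesis using 3 by (simp add: tendsto_eventually)
      qed
    qed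
  qed
  moreover have "(\<integral>\<^sup>+t. u m t \<partial>lborel) = (\<Sum>k<?n m. ennreal (h m) * ennreal (q (c (real k * h m))))" for m
    unfolding u_def using h(2)[of m]
    by (subst nn_integral_sum) (auto simp: nn_integral_cmult_indicator mult.commute algebra_simps intro!: sum.cong)
  ultimately show ?thesis by simp
qed

end

section \<open>Expectations up to the hitting time\<close>

definition trans_prob :: "('x \<Rightarrow> 'w measure) \<Rightarrow> (real \<Rightarrow> 'w \<Rightarrow> 'x) \<Rightarrow> real \<Rightarrow> 'x \<Rightarrow> 'x \<Rightarrow> real" where
  "trans_prob P X t a b = measure (P a) {\<omega>\<in>space (P a). X t \<omega> = b}"

definition alive :: "('x \<Rightarrow> 'w measure) \<Rightarrow> (real \<Rightarrow> 'w \<Rightarrow> 'x) \<Rightarrow> 'x \<Rightarrow> 'x \<Rightarrow> real \<Rightarrow> 'w set" where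
  "alive P X x y t = {\<omega>\<in>space (P x). ereal t < hitting_time (\<lambda>s. X s \<omega>) y}"

lemma trans_prob_nonneg: "0 \<le> trans_prob P X t a b"
  by (simp add: trans_prob_def)

section \<open>Transition probabilities and survival\<close>

context
  fixes w :: "'x::finite \<Rightarrow> 'x \<Rightarrow> real" and P :: "'x \<Rightarrow> 'w measure" and X :: "real \<Rightarrow> 'w \<Rightarrow> 'x"
  assumes mp: "markov_process w P X"
begin

lemma prob_P: "prob_space (P x)"
  using mp by (simp add: markov_process_def)

lemma X_measurable: "0 \<le> t \<Longrightarrow> X t \<in> P x \<rightarrow>\<^sub>M count_space UNIV"
  using mp by (simp add: markov_process_def)

lemma X_path: "\<omega> \<in> space (P x) \<Longrightarrow> step_path (\<lambda>t. X t \<omega>)"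
  using mp by (simp add: markov_process_def)

lemma X_start: "AE \<omega> in P x. X 0 \<omega> = x"
  using mp by (simp add: markov_process_def)

lemma markov_property:
  assumes "0 \<le> s" "0 \<le> t" "B \<in> past (P x) X s"
  shows "measure (P x) {\<omega>\<in>B. X s \<omega> = a \<and> X (s + t) \<omega> = b} =
    measure (P x) {\<omega>\<in>B. X s \<omega> = a} * trans_prob P X t a b"
  using mp assms unfolding markov_process_def trans_prob_def by blast

text \<open>The generator condition is tested on the indicator of \<open>b\<close>, which vanishes
  at \<open>a\<close>.\<close>

lemma trans_prob_rate:
  assumes "a \<noteq> b"
  shows "((\<lambda>t. trans_prob P X t a b / t) \<longlongrightarrow> w a b) (at_right 0)"
proof -
  let ?f = "indicator {b} :: 'x \<Rightarrow> real"
  have lim: "((\<lambda>t. ((\<integral>\<omega>. ?f (X t \<omega>) \<partial>P a) - ?f a) / t) \<longlongrightarrow> generator w ?f a) (at_right 0)"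
    using mp unfolding markov_process_def by blast
  have gen: "generator w ?f a = w a b"
    using assms by (simp add: generator_def indicator_def if_distrib[of "\<lambda>t. _ * t"] cong: if_cong)
  have ev: "\<forall>\<^sub>F t in at_right 0. ((\<integral>\<omega>. ?f (X t \<omega>) \<partial>P a) - ?f a) / t = trans_prob P X t a b / t"
    unfolding eventually_at_right_field
  proof (intro exI[of _ 1] conjI allI impI)
    fix t :: real assume "0 < t"
    then have m: "X t \<in> P a \<rightarrow>\<^sub>M count_space UNIV" by (intro X_measurable) simp
    have "(\<integral>\<omega>. ?f (X t \<omega>) \<partial>P a) = (\<integral>\<omega>. indicator {\<omega>\<in>space (P a). X t \<omega> = b} \<omega> \<partial>P a)"
      by (rule Bochner_Integration.integral_cong) (auto simp: indicator_def)
    also have "\<dots> = trans_prob P X t a b" unfolding trans_prob_def by (simp add: Int_absorb2 subset_eq)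
    finally show "((\<integral>\<omega>. ?f (X t \<omega>) \<partial>P a) - ?f a) / t = trans_prob P X t a b / t"
      using assms by simp
  qed simp
  show ?thesis using Lim_transform_eventually[OF lim ev] gen by simp
qed

lemma trans_prob_sum:
  assumes "0 \<le> t"
  shows "(\<Sum>b\<in>UNIV. trans_prob P X t a b) = 1"
proof -
  interpret prob_space "P a" by (rule prob_P)
  have "(\<Sum>b\<in>UNIV. trans_prob P X t a b) = prob (\<Union>b\<in>UNIV. {\<omega>\<in>space (P a). X t \<omega> = b})"
    unfolding trans_prob_def using X_measurable[OF assms, of a]
    by (intro finite_measure_finite_Union[symmetric]) (auto simp: disjoint_family_on_def)
  also have "(\<Union>b\<in>UNIV. {\<omega>\<in>space (P a). X t \<omega> = b}) = space (P a)" by auto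
  finally show ?thesis by (simp add: prob_space)
qed

lemma past_sigma: "sigma_algebra (space (P x)) (past (P x) X t)"
  unfolding past_def by (rule sigma_algebra_sigma_sets) auto

lemma past_sets: "past (P x) X t \<subseteq> sets (P x)"
  unfolding past_def
  by (rule sets.sigma_sets_subset) (auto intro!: measurable_sets[OF X_measurable])

lemma alive_past:
  assumes t: "0 \<le> t"
  shows "alive P X x y t \<in> past (P x) X t"
proof -
  interpret sigma_algebra "space (P x)" "past (P x) X t" by (rule past_sigma)
  \<comment> \<open>Right continuity reduces avoidance of \<open>y\<close> to rational times;
    \<open>t\<close> is adjoined because later rational times are outside the past.\<close>
  let ?D = "insert t (\<rat> \<inter> {0..t})"
  have "alive P X x y t = (\<Inter>s\<in>?D. space (P x) - (X s -` {y} \<inter> space (P x)))"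
  proof (intro equalityI subsetI)
    fix \<omega> assume "\<omega> \<in> alive P X x y t"
    then have "\<omega> \<in> space (P x)" "\<forall>s\<in>{0..t}. X s \<omega> \<noteq> y"
      using less_hitting_time_iff[OF X_path t] by (auto simp: alive_def)
    then show "\<omega> \<in> (\<Inter>s\<in>?D. space (P x) - (X s -` {y} \<inter> space (P x)))" using t by auto
  next
    fix \<omega> assume *: "\<omega> \<in> (\<Inter>s\<in>?D. space (P x) - (X s -` {y} \<inter> space (P x)))"
    then have \<omega>: "\<omega> \<in> space (P x)" and D: "\<And>s. s \<in> ?D \<Longrightarrow> X s \<omega> \<noteq> y" by blast+
    have "X s \<omega> \<noteq> y" if s: "s \<in> {0..t}" for s
    proof (cases "s = t")
      case True
      then show ?thesis using D by auto
    next
      case False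
      have "0 \<le> s" using s by simp
      obtain e where e: "e > 0" "\<And>r. s \<le> r \<Longrightarrow> r < s + e \<Longrightarrow> X r \<omega> = X s \<omega>"
        using step_path_right[OF X_path[OF \<omega>] \<open>0 \<le> s\<close>] by blast
      obtain r where r: "r \<in> \<rat>" "s < r" "r < min t (s + e)"
        using Rats_dense_in_real[of s "min t (s + e)"] False s e(1) by auto
      then have "X r \<omega> = X s \<omega>" by (intro e(2)) auto
      moreover have "X r \<omega> \<noteq> y" by (rule D) (use r s in auto)
      ultimately show ?thesis by simp
    qed
    then show "\<omega> \<in> alive P X x y t"
      using less_hitting_time_iff[OF X_path[OF \<omega>] t] \<omega> by (auto simp: alive_def)
  qed
  also have "\<dots> \<in> past (P x) X t"
  proof (rule countable_INT')
    show "countable ?D" by (intro countable_insert countable_Int1 countable_rat)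
    show "(\<lambda>s. space (P x) - (X s -` {y} \<inter> space (P x))) ` ?D \<subseteq> past (P x) X t"
    proof (rule image_subsetI)
      fix s assume "s \<in> ?D"
      then have "X s -` {y} \<inter> space (P x) \<in> past (P x) X t"
        unfolding past_def using t by (intro sigma_sets.Basic) auto
      then show "space (P x) - (X s -` {y} \<inter> space (P x)) \<in> past (P x) X t" by (rule compl_sets)
    qed
  qed simp
  finally show ?thesis .
qed

lemma alive_sets: "0 \<le> t \<Longrightarrow> alive P X x y t \<in> sets (P x)"
  using alive_past past_sets by blast

lemma alive_X_sets: "0 \<le> t \<Longrightarrow> 0 \<le> s \<Longrightarrow> {\<omega>\<in>alive P X x y t. X s \<omega> = a} \<in> sets (P x)"
proof -
  assume t: "0 \<le> t" and s: "0 \<le> s"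
  have "{\<omega>\<in>alive P X x y t. X s \<omega> = a} = alive P X x y t \<inter> (X s -` {a} \<inter> space (P x))"
    by (auto simp: alive_def)
  then show ?thesis using alive_sets[OF t] measurable_sets[OF X_measurable[OF s], of "{a}"] by auto
qed

lemma alive_XX_sets: "0 \<le> t \<Longrightarrow> 0 \<le> s \<Longrightarrow> 0 \<le> r \<Longrightarrow> {\<omega>\<in>alive P X x y t. X s \<omega> = a \<and> X r \<omega> = b} \<in> sets (P x)"
proof -
  assume t: "0 \<le> t" and s: "0 \<le> s" and r: "0 \<le> r"
  have "{\<omega>\<in>alive P X x y t. X s \<omega> = a \<and> X r \<omega> = b} = {\<omega>\<in>alive P X x y t. X s \<omega> = a} \<inter> (X r -` {b} \<inter> space (P x))"
    by (auto simp: alive_def)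
  then show ?thesis using alive_X_sets[OF t s] measurable_sets[OF X_measurable[OF r], of "{b}"] by auto
qed

text \<open>Keeping only the paths through \<open>b\<close> at time \<open>s\<close> suffices to
  propagate positivity.\<close>

lemma chapman_kolmogorov_ge:
  assumes "0 \<le> s" "0 \<le> t"
  shows "trans_prob P X s a b * trans_prob P X t b d \<le> trans_prob P X (s + t) a d"
proof -
  interpret prob_space "P a" by (rule prob_P)
  interpret pa: sigma_algebra "space (P a)" "past (P a) X s" by (rule past_sigma)
  have "trans_prob P X s a b * trans_prob P X t b d
      = measure (P a) {\<omega>\<in>space (P a). X s \<omega> = b \<and> X (s + t) \<omega> = d}"
    using markov_property[OF assms pa.top, of b d] by (simp add: trans_prob_def)
  also have "\<dots> \<le> trans_prob P X (s + t) a d"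
    unfolding trans_prob_def using measurable_sets[OF X_measurable[of "s + t" a], of "{d}"] assms
    by (intro finite_measure_mono) (auto simp: vimage_def Int_def conj_commute)
  finally show ?thesis .
qed

lemma trans_prob_self_limit: "((\<lambda>t. trans_prob P X t a a) \<longlongrightarrow> 1) (at_right 0)"
proof -
  have "((\<lambda>t. trans_prob P X t a b) \<longlongrightarrow> 0) (at_right 0)" if "b \<noteq> a" for b
  proof -
    have lim: "((\<lambda>t. trans_prob P X t a b / t * t) \<longlongrightarrow> w a b * 0) (at_right 0)"
      using that by (intro tendsto_mult trans_prob_rate tendsto_ident_at) auto
    have ev: "\<forall>\<^sub>F t in at_right 0. trans_prob P X t a b / t * t = trans_prob P X t a b"
      unfolding eventually_at_right_field by (intro exI[of _ 1]) auto
    show ?thesis using Lim_transform_eventually[OF lim ev] by simp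
  qed
  then have lim: "((\<lambda>t. 1 - (\<Sum>b\<in>UNIV - {a}. trans_prob P X t a b)) \<longlongrightarrow> 1 - (\<Sum>b\<in>UNIV - {a}. 0)) (at_right 0)"
    by (intro tendsto_intros) auto
  have ev: "\<forall>\<^sub>F t in at_right 0. 1 - (\<Sum>b\<in>UNIV - {a}. trans_prob P X t a b) = trans_prob P X t a a"
    unfolding eventually_at_right_field
  proof (intro exI[of _ 1] conjI allI impI)
    fix t :: real assume "0 < t"
    then have "(\<Sum>b\<in>UNIV. trans_prob P X t a b) = 1" by (intro trans_prob_sum) simp
    then show "1 - (\<Sum>b\<in>UNIV - {a}. trans_prob P X t a b) = trans_prob P X t a a"
      using sum.remove[of UNIV a "trans_prob P X t a"] by simp
  qed simp
  show ?thesis using Lim_transform_eventually[OF lim ev] by simp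
qed

text \<open>For a small step \<open>h\<close> every edge and every stay has positive probability.
  Paths given by irreducibility are concatenated, and waiting steps bring all pairs to one common
  time.\<close>

lemma trans_prob_all_positive:
  assumes irr: "irreducible_rates w"
  obtains t where "t > 0" "\<And>a b. trans_prob P X t a b > 0"
proof -
  have "\<forall>\<^sub>F t in at_right 0. trans_prob P X t a b > 0" if "(a, b) \<in> edges w" for a b
  proof -
    have ab: "a \<noteq> b" "0 < w a b" using that by (auto simp: edges_def)
    have "\<forall>\<^sub>F t in at_right 0. trans_prob P X t a b / t > 0"
      using order_tendstoD(1)[OF trans_prob_rate[OF ab(1)] ab(2)] .
    moreover have "\<forall>\<^sub>F t::real in at_right 0. 0 < t"
      unfolding eventually_at_right_field by (intro exI[of _ 1]) auto
    ultimately show ?thesis by eventually_elim (simp add: zero_less_divide_iff)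
  qed
  then have "\<forall>\<^sub>F t in at_right 0. \<forall>e\<in>edges w. trans_prob P X t (fst e) (snd e) > 0"
    by (intro eventually_ball_finite) auto
  moreover have "\<forall>\<^sub>F t in at_right 0. \<forall>a\<in>UNIV. trans_prob P X t a a > 0"
    by (intro eventually_ball_finite ballI order_tendstoD(1)[OF trans_prob_self_limit]) auto
  moreover have "\<forall>\<^sub>F t::real in at_right 0. 0 < t"
    unfolding eventually_at_right_field by (intro exI[of _ 1]) auto
  ultimately have ev: "\<forall>\<^sub>F t in at_right 0. 0 < t \<and> (\<forall>e\<in>edges w. trans_prob P X t (fst e) (snd e) > 0) \<and>
      (\<forall>a\<in>UNIV. trans_prob P X t a a > 0)"
    by eventually_elim auto
  obtain h where "0 < h" "\<forall>e\<in>edges w. trans_prob P X h (fst e) (snd e) > 0" "\<forall>a\<in>UNIV. trans_prob P X h a a > 0"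
    using eventually_happens[OF ev] trivial_limit_at_right_real[of "0::real"] by blast
  then have h: "0 < h" "\<And>a b. (a, b) \<in> edges w \<Longrightarrow> trans_prob P X h a b > 0"
      "\<And>a. trans_prob P X h a a > 0"
    by force+
  have extend: "trans_prob P X (real (Suc n) * h) a d > 0"
    if "trans_prob P X (real n * h) a b > 0" "trans_prob P X h b d > 0" for n a b d
  proof -
    have "0 < trans_prob P X (real n * h) a b * trans_prob P X h b d" using that by simp
    also have "\<dots> \<le> trans_prob P X (real n * h + h) a d" by (rule chapman_kolmogorov_ge) (use h in auto)
    finally show ?thesis by (simp add: algebra_simps)
  qed
  have mono: "trans_prob P X (real (n + k) * h) a b > 0" if "trans_prob P X (real n * h) a b > 0" for n k a b
  proof (induction k)
    case (Suc k)
    show ?case unfolding add_Suc_right by (rule extend[OF Suc h(3)])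
  qed (use that in simp)
  have "\<exists>n. trans_prob P X (real (Suc n) * h) a b > 0" for a b
  proof -
    have "(a, b) \<in> (edges w)\<^sup>*" using irr by (simp add: irreducible_rates_def)
    then show ?thesis
    proof (induction rule: rtrancl_induct)
      case base
      show ?case using h(3)[of a] by (intro exI[of _ 0]) simp
    next
      case (step b d)
      then show ?case using extend[OF _ h(2)] by blast
    qed
  qed
  then have ex: "\<exists>n. trans_prob P X (real (Suc n) * h) a b > 0" for a b .
  define n where "n a b = (SOME n. trans_prob P X (real (Suc n) * h) a b > 0)" for a b
  have n: "trans_prob P X (real (Suc (n a b)) * h) a b > 0" for a b
    unfolding n_def by (rule someI_ex[OF ex])
  let ?M = "Max (range (\<lambda>(a, b). n a b))"
  show ?thesis
  proof (rule that[of "real (Suc ?M) * h"])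
    show "0 < real (Suc ?M) * h" using h(1) by simp
    fix a b
    have "n a b \<le> ?M" by (rule Max_ge) auto
    then have "Suc (n a b) + (?M - n a b) = Suc ?M" by simp
    then show "0 < trans_prob P X (real (Suc ?M) * h) a b" using mono[OF n[of a b], of "?M - n a b"] by metis
  qed
qed

end

text \<open>The expectation of this functional underlies \<open>killing_before\<close>; for the
  indicator of \<open>{a}\<close> that expectation is the Green function of the process stopped at
  \<open>y\<close>.\<close>

definition occupation :: "(real \<Rightarrow> 'w \<Rightarrow> 'x) \<Rightarrow> 'x \<Rightarrow> ('x \<Rightarrow> real) \<Rightarrow> 'w \<Rightarrow> ennreal" where
  "occupation X y q \<omega> = (\<integral>\<^sup>+t. ennreal (q (X t \<omega>)) *
     indicator {t. 0 \<le> t \<and> ereal t < hitting_time (\<lambda>t. X t \<omega>) y} t \<partial>lborel)"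

definition grid_occupation ::
    "('x \<Rightarrow> 'w measure) \<Rightarrow> (real \<Rightarrow> 'w \<Rightarrow> 'x) \<Rightarrow> 'x \<Rightarrow> 'x \<Rightarrow> real \<Rightarrow> 'x \<Rightarrow> 'w \<Rightarrow> ennreal" where
  "grid_occupation P X x y h a \<omega> =
     (\<Sum>k. ennreal h * indicator {\<omega>\<in>alive P X x y (real k * h). X (real k * h) \<omega> = a} \<omega>)"

definition grid_crossings ::
    "('x \<Rightarrow> 'w measure) \<Rightarrow> (real \<Rightarrow> 'w \<Rightarrow> 'x) \<Rightarrow> 'x \<Rightarrow> 'x \<Rightarrow> real \<Rightarrow> 'x \<Rightarrow> 'x \<Rightarrow> 'w \<Rightarrow> ennreal" where
  "grid_crossings P X x y h a b \<omega> =
     (\<Sum>k. indicator {\<omega>\<in>alive P X x y (real k * h). X (real k * h) \<omega> = a \<and> X (real k * h + h) \<omega> = b} \<omega>)"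

section \<open>Tail of the hitting time and expectations on the grid\<close>

context
  fixes w :: "'x::finite \<Rightarrow> 'x \<Rightarrow> real" and P :: "'x \<Rightarrow> 'w measure" and X :: "real \<Rightarrow> 'w \<Rightarrow> 'x"
    and x y :: 'x
  assumes mp: "markov_process w P X"
begin

interpretation prob_space "P x" by (rule prob_P[OF mp])

text \<open>Survival until the next multiple of \<open>t\<close> forces the state there to differ
  from \<open>y\<close>; by the Markov property this has conditional probability at most
  \<open>1 - e\<close> from every state.\<close>

lemma alive_decay:
  assumes t: "0 < t" and e: "\<And>a. e \<le> trans_prob P X t a y"
  shows "measure (P x) (alive P X x y (real (Suc k) * t)) \<le> (1 - e) * measure (P x) (alive P X x y (real k * t))"
proof -
  let ?s = "real k * t" and ?B = "alive P X x y (real k * t)"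
  let ?u = "\<lambda>a. measure (P x) {\<omega>\<in>?B. X ?s \<omega> = a}"
  let ?E = "\<lambda>(a, b). {\<omega>\<in>?B. X ?s \<omega> = a \<and> X (?s + t) \<omega> = b}"
  have s: "0 \<le> ?s" "0 \<le> ?s + t" using t by auto
  have E: "?E p \<in> sets (P x)" for p
    using alive_XX_sets[OF mp s(1) s(1) s(2)] by (cases p) simp
  have sub: "alive P X x y (real (Suc k) * t) \<subseteq> (\<Union>p\<in>UNIV \<times> (UNIV - {y}). ?E p)"
  proof
    fix \<omega> assume *: "\<omega> \<in> alive P X x y (real (Suc k) * t)"
    then have \<omega>: "\<omega> \<in> space (P x)" by (simp add: alive_def)
    have st: "real (Suc k) * t = ?s + t" by (simp add: algebra_simps)
    have al: "\<forall>r\<in>{0..?s + t}. X r \<omega> \<noteq> y"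
      using * less_hitting_time_iff[OF X_path[OF mp \<omega>] s(2), of y] unfolding st alive_def by simp
    then have "\<omega> \<in> ?B"
      using less_hitting_time_iff[OF X_path[OF mp \<omega>] s(1), of y] t \<omega> unfolding alive_def by auto
    moreover have "X (?s + t) \<omega> \<noteq> y" using al s by auto
    ultimately show "\<omega> \<in> (\<Union>p\<in>UNIV \<times> (UNIV - {y}). ?E p)" by auto
  qed
  have "measure (P x) (alive P X x y (real (Suc k) * t)) \<le> measure (P x) (\<Union>p\<in>UNIV \<times> (UNIV - {y}). ?E p)"
    by (rule finite_measure_mono[OF sub]) (use E in auto)
  also have "\<dots> \<le> (\<Sum>p\<in>UNIV \<times> (UNIV - {y}). measure (P x) (?E p))"
    by (rule finite_measure_subadditive_finite) (use E in auto)
  also have "\<dots> = (\<Sum>(a, b)\<in>UNIV \<times> (UNIV - {y}). ?u a * trans_prob P X t a b)"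
    using markov_property[OF mp s(1) less_imp_le[OF t] alive_past[OF mp s(1)]] by (intro sum.cong) auto
  also have "\<dots> = (\<Sum>a\<in>UNIV. ?u a * (\<Sum>b\<in>UNIV - {y}. trans_prob P X t a b))"
    by (simp add: sum.cartesian_product[symmetric] sum_distrib_left)
  also have "\<dots> \<le> (\<Sum>a\<in>UNIV. ?u a * (1 - e))"
  proof (intro sum_mono mult_left_mono)
    fix a
    show "(\<Sum>b\<in>UNIV - {y}. trans_prob P X t a b) \<le> 1 - e"
      using sum.remove[of UNIV y "trans_prob P X t a"] trans_prob_sum[OF mp less_imp_le[OF t], of a] e[of a] by simp
  qed simp
  also have "\<dots> = (1 - e) * (\<Sum>a\<in>UNIV. ?u a)" by (simp add: sum_distrib_left mult.commute)
  also have "(\<Sum>a\<in>UNIV. ?u a) = measure (P x) (\<Union>a\<in>UNIV. {\<omega>\<in>?B. X ?s \<omega> = a})"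
    by (rule finite_measure_finite_Union[symmetric])
      (auto simp: disjoint_family_on_def intro: alive_X_sets[OF mp s(1) s(1)])
  also have "(\<Union>a\<in>UNIV. {\<omega>\<in>?B. X ?s \<omega> = a}) = ?B" by auto
  finally show ?thesis .
qed

text \<open>\<open>D\<close> rounds the hitting time up to the grid of step \<open>t\<close>, so it
  is a series of survival indicators, and the geometric tail makes it integrable.\<close>

lemma hitting_time_dominated:
  assumes irr: "irreducible_rates w"
  obtains D where "D \<in> borel_measurable (P x)" "(\<integral>\<^sup>+\<omega>. D \<omega> \<partial>P x) < \<infinity>"
    "\<And>\<omega>. \<omega> \<in> space (P x) \<Longrightarrow> e2ennreal (hitting_time (\<lambda>t. X t \<omega>) y) \<le> D \<omega>"
proof -
  obtain t where t: "t > 0" "\<And>a b. trans_prob P X t a b > 0"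
    using trans_prob_all_positive[OF mp irr] by blast
  define e where "e = Min (range (\<lambda>a. trans_prob P X t a y))"
  have e0: "0 < e" unfolding e_def using t(2) by (subst Min_gr_iff) auto
  have e: "e \<le> trans_prob P X t a y" for a unfolding e_def by (rule Min_le) auto
  have "trans_prob P X t y y \<le> 1" by (simp add: trans_prob_def prob_space.prob_le_1[OF prob_P[OF mp]])
  then have e1: "e \<le> 1" using e[of y] by simp
  have geo: "measure (P x) (alive P X x y (real k * t)) \<le> (1 - e) ^ k" for k
  proof (induction k)
    case (Suc k)
    have "(1 - e) * measure (P x) (alive P X x y (real k * t)) \<le> (1 - e) * (1 - e) ^ k"
      by (rule mult_left_mono[OF Suc]) (use e1 in simp)
    then show ?case using alive_decay[OF t(1) e, of k] by simp
  qed simp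
  define D where "D \<omega> = (\<Sum>k. ennreal t * indicator (alive P X x y (real k * t)) \<omega>)" for \<omega>
  have al: "alive P X x y (real k * t) \<in> sets (P x)" for k
    using alive_sets[OF mp, of "real k * t"] t(1) by simp
  have "D \<in> borel_measurable (P x)" unfolding D_def using al by measurable
  moreover have "(\<integral>\<^sup>+\<omega>. D \<omega> \<partial>P x) < \<infinity>"
  proof -
    have "(\<integral>\<^sup>+\<omega>. D \<omega> \<partial>P x) = (\<Sum>k. \<integral>\<^sup>+\<omega>. ennreal t * indicator (alive P X x y (real k * t)) \<omega> \<partial>P x)"
      unfolding D_def by (rule nn_integral_suminf) (use al in measurable)
    also have "\<dots> = (\<Sum>k. ennreal t * ennreal (measure (P x) (alive P X x y (real k * t))))"
      using al by (simp add: nn_integral_cmult_indicator emeasure_eq_measure)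
    also have "\<dots> \<le> (\<Sum>k. ennreal (t * (1 - e) ^ k))"
      using geo t(1) by (intro suminf_le) (auto simp: ennreal_mult'[symmetric] intro!: ennreal_leI mult_left_mono)
    also have "\<dots> = ennreal (\<Sum>k. t * (1 - e) ^ k)"
      using t(1) e0 e1 by (intro suminf_ennreal2 summable_mult summable_geometric) auto
    also have "\<dots> < \<infinity>" by simp
    finally show ?thesis .
  qed
  moreover have "e2ennreal (hitting_time (\<lambda>t. X t \<omega>) y) \<le> D \<omega>" if \<omega>: "\<omega> \<in> space (P x)" for \<omega>
  proof -
    let ?T = "hitting_time (\<lambda>t. X t \<omega>) y"
    \<comment> \<open>Each multiple of \<open>t\<close> before the hitting time contributes
      \<open>t\<close> to \<open>D\<close>; this also forces \<open>D\<close> to be infinite on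
      paths that never hit \<open>y\<close>.\<close>
    have part: "ennreal (real n * t) \<le> D \<omega>" if "\<And>k. k < n \<Longrightarrow> ereal (real k * t) < ?T" for n
    proof -
      have "ennreal (real n * t) = (\<Sum>k<n. ennreal t)" using t(1) by (simp add: ennreal_mult' ennreal_of_nat_eq_real_of_nat)
      also have "\<dots> = (\<Sum>k<n. ennreal t * indicator (alive P X x y (real k * t)) \<omega>)"
        by (rule sum.cong) (use that \<omega> in \<open>auto simp: alive_def\<close>)
      also have "\<dots> \<le> D \<omega>" unfolding D_def by (rule sum_le_suminf) auto
      finally show ?thesis .
    qed
    show ?thesis
    proof (cases "?T < \<infinity>")
      case True
      then obtain \<tau> where \<tau>: "?T = ereal \<tau>" "0 \<le> \<tau>"
        by (rule hitting_time_finite[OF X_path[OF mp \<omega>]]) blast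
      have "\<tau> \<le> of_int \<lceil>\<tau> / t\<rceil> * t" by (rule ceiling_divide_upper[OF t(1)])
      also have "\<dots> \<le> real (nat \<lceil>\<tau> / t\<rceil>) * t" using t(1) by (intro mult_right_mono) auto
      finally have "ennreal \<tau> \<le> ennreal (real (nat \<lceil>\<tau> / t\<rceil>) * t)" by (rule ennreal_leI)
      also have "\<dots> \<le> D \<omega>" by (rule part) (simp add: \<tau>(1) grid_before_iff[OF t(1)])
      finally show ?thesis by (simp add: \<tau>(1) ennreal.abs_eq e2ennreal_ereal)
    next
      case False
      then have T: "?T = \<infinity>" by simp
      have "D \<omega> = \<top>"
      proof (rule ccontr)
        assume "D \<omega> \<noteq> \<top>"
        then obtain r where r: "D \<omega> = ennreal r" "0 \<le> r" by (cases "D \<omega>") auto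
        obtain n where "r < real n * t" using reals_Archimedean3[OF t(1)] by blast
        moreover have "ennreal (real n * t) \<le> ennreal r" using part[of n] T r(1) by simp
        ultimately show False using r(2) by (simp add: ennreal_le_iff)
      qed
      then show ?thesis by simp
    qed
  qed
  ultimately show ?thesis using that by blast
qed

lemma grid_occupation_measurable: "0 < h \<Longrightarrow> grid_occupation P X x y h a \<in> borel_measurable (P x)"
  unfolding grid_occupation_def[abs_def]
  using alive_X_sets[OF mp, of "real _ * h" "real _ * h"] by measurable

lemma grid_crossings_measurable: "0 < h \<Longrightarrow> grid_crossings P X x y h a b \<in> borel_measurable (P x)"
  unfolding grid_crossings_def[abs_def]
  using alive_XX_sets[OF mp, of "real _ * h" "real _ * h" "real _ * h + h"] by measurable

text \<open>Survival and position at \<open>k * h\<close> belong to the past, so each term factors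
  by the Markov property. The factor \<open>h\<close> is shifted to make occupation time and jump
  rate visible.\<close>

lemma nn_integral_grid_crossings:
  assumes h: "0 < h"
  shows "(\<integral>\<^sup>+\<omega>. grid_crossings P X x y h a b \<omega> \<partial>P x) =
    (\<integral>\<^sup>+\<omega>. grid_occupation P X x y h a \<omega> \<partial>P x) * ennreal (trans_prob P X h a b / h)"
proof -
  let ?u = "\<lambda>k. measure (P x) {\<omega>\<in>alive P X x y (real k * h). X (real k * h) \<omega> = a}"
  have s: "0 \<le> real k * h" "0 \<le> real k * h + h" for k using h by auto
  note S = alive_X_sets[OF mp s(1) s(1)] and SS = alive_XX_sets[OF mp s(1) s(1) s(2)]
  have "(\<integral>\<^sup>+\<omega>. grid_crossings P X x y h a b \<omega> \<partial>P x) = (\<Sum>k. ennreal (?u k * trans_prob P X h a b))"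
    unfolding grid_crossings_def using SS
    by (subst nn_integral_suminf)
      (simp_all add: emeasure_eq_measure markov_property[OF mp s(1) less_imp_le[OF h] alive_past[OF mp s(1)]])
  also have "\<dots> = (\<Sum>k. ennreal h * ennreal (?u k) * ennreal (trans_prob P X h a b / h))"
  proof (rule suminf_cong)
    fix k
    have mult: "ennreal (h * r * s) = ennreal h * ennreal r * ennreal s" if "0 \<le> r" "0 \<le> s" for r s
      using h that by (simp add: ennreal_mult)
    show "ennreal (?u k * trans_prob P X h a b) = ennreal h * ennreal (?u k) * ennreal (trans_prob P X h a b / h)"
      using mult[of "?u k" "trans_prob P X h a b / h"] h by (simp add: trans_prob_nonneg)
  qed
  also have "\<dots> = (\<Sum>k. ennreal h * ennreal (?u k)) * ennreal (trans_prob P X h a b / h)" by simp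
  also have "(\<Sum>k. ennreal h * ennreal (?u k)) = (\<integral>\<^sup>+\<omega>. grid_occupation P X x y h a \<omega> \<partial>P x)"
    unfolding grid_occupation_def using S
    by (subst nn_integral_suminf) (simp_all add: nn_integral_cmult_indicator emeasure_eq_measure)
  finally show ?thesis .
qed

context
  fixes \<omega> and \<tau> :: real
  assumes \<omega>: "\<omega> \<in> space (P x)" and T: "hitting_time (\<lambda>t. X t \<omega>) y = ereal \<tau>"
begin

lemma grid_occupation_path:
  assumes h: "0 < h"
  shows "grid_occupation P X x y h a \<omega> = (\<Sum>k<nat \<lceil>\<tau> / h\<rceil>. ennreal h * indicator {a} (X (real k * h) \<omega>))"
proof -
  have "grid_occupation P X x y h a \<omega>
      = (\<Sum>k<nat \<lceil>\<tau> / h\<rceil>. ennreal h * indicator {\<omega>\<in>alive P X x y (real k * h). X (real k * h) \<omega> = a} \<omega>)"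
    unfolding grid_occupation_def
    by (rule suminf_finite) (auto simp: alive_def T grid_before_iff[OF h])
  also have "\<dots> = (\<Sum>k<nat \<lceil>\<tau> / h\<rceil>. ennreal h * indicator {a} (X (real k * h) \<omega>))"
    by (rule sum.cong) (auto simp: alive_def T grid_before_iff[OF h] \<omega> indicator_def)
  finally show ?thesis .
qed

lemma grid_occupation_bound:
  assumes h: "0 < h" "h \<le> 1" and \<tau>: "0 \<le> \<tau>"
  shows "grid_occupation P X x y h a \<omega> \<le> ennreal \<tau> + 1"
proof -
  have "grid_occupation P X x y h a \<omega> \<le> (\<Sum>k<nat \<lceil>\<tau> / h\<rceil>. ennreal h)"
    unfolding grid_occupation_path[OF h(1)] by (rule sum_mono) (auto simp: indicator_def)
  also have "\<dots> = ennreal (real (nat \<lceil>\<tau> / h\<rceil>) * h)"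
    using h(1) by (simp add: ennreal_mult' ennreal_of_nat_eq_real_of_nat)
  also have "\<dots> \<le> ennreal (\<tau> + 1)"
  proof (rule ennreal_leI)
    have "0 \<le> \<tau> / h" using \<tau> h(1) by simp
    then have "real (nat \<lceil>\<tau> / h\<rceil>) = of_int \<lceil>\<tau> / h\<rceil>" by simp
    then show "real (nat \<lceil>\<tau> / h\<rceil>) * h \<le> \<tau> + 1"
      using ceiling_divide_lower[OF h(1), of \<tau>] h(2) by (simp add: algebra_simps)
  qed
  also have "\<dots> = ennreal \<tau> + 1" using \<tau> by (simp add: ennreal_plus)
  finally show ?thesis .
qed

lemma grid_occupation_weighted:
  assumes h: "0 < h" and q: "\<And>x. 0 \<le> q x"
  shows "(\<Sum>a\<in>UNIV. ennreal (q a) * grid_occupation P X x y h a \<omega>)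
    = (\<Sum>k<nat \<lceil>\<tau> / h\<rceil>. ennreal h * ennreal (q (X (real k * h) \<omega>)))"
proof -
  have "(\<Sum>a\<in>UNIV. ennreal (q a) * grid_occupation P X x y h a \<omega>)
      = (\<Sum>k<nat \<lceil>\<tau> / h\<rceil>. \<Sum>a\<in>UNIV. ennreal (q a) * (ennreal h * indicator {a} (X (real k * h) \<omega>)))"
    unfolding grid_occupation_path[OF h] sum_distrib_left by (rule sum.swap)
  also have "\<dots> = (\<Sum>k<nat \<lceil>\<tau> / h\<rceil>. \<Sum>a\<in>UNIV. if a = X (real k * h) \<omega> then ennreal h * ennreal (q a) else 0)"
    by (intro sum.cong) (auto simp: indicator_def mult.commute)
  finally show ?thesis by simp
qed

lemma grid_crossings_path:
  assumes h: "0 < h"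
  shows "grid_crossings P X x y h a b \<omega> = of_nat (card (grid_jumps (\<lambda>t. X t \<omega>) \<tau> h a b))"
proof -
  let ?G = "grid_jumps (\<lambda>t. X t \<omega>) \<tau> h a b"
  have suc: "real (Suc k) * h = real k * h + h" for k by (simp add: algebra_simps)
  have G: "k \<in> ?G \<longleftrightarrow> k < nat \<lceil>\<tau> / h\<rceil> \<and> X (real k * h) \<omega> = a \<and> X (real k * h + h) \<omega> = b" for k
    unfolding grid_jumps_def mem_Collect_eq grid_before_iff[OF h] suc ..
  have "grid_crossings P X x y h a b \<omega> = (\<Sum>k<nat \<lceil>\<tau> / h\<rceil>. if k \<in> ?G then 1 else 0)"
    unfolding grid_crossings_def
  proof (subst suminf_finite)
    show "(\<Sum>k<nat \<lceil>\<tau> / h\<rceil>. indicator {\<omega>\<in>alive P X x y (real k * h). X (real k * h) \<omega> = a \<and> X (real k * h + h) \<omega> = b} \<omega>)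
        = (\<Sum>k<nat \<lceil>\<tau> / h\<rceil>. if k \<in> ?G then 1 else 0)"
      by (rule sum.cong) (auto simp: alive_def T grid_before_iff[OF h] \<omega> indicator_def G)
  qed (auto simp: alive_def T grid_before_iff[OF h])
  also have "\<dots> = of_nat (card ({..<nat \<lceil>\<tau> / h\<rceil>} \<inter> ?G))"
    by (simp add: sum.If_cases)
  also have "{..<nat \<lceil>\<tau> / h\<rceil>} \<inter> ?G = ?G" using G by auto
  finally show ?thesis .
qed

end

end

abbreviation (input) mesh :: "nat \<Rightarrow> real" where "mesh m \<equiv> inverse (real (Suc m))"

lemma mesh: "mesh \<longlonglongrightarrow> 0" "0 < mesh m" "mesh m \<le> 1"
  using LIMSEQ_inverse_real_of_nat by (auto simp: field_simps)

section \<open>Passage from the grid to continuous time\<close>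

context
  fixes w :: "'x::finite \<Rightarrow> 'x \<Rightarrow> real" and P :: "'x \<Rightarrow> 'w measure" and X :: "real \<Rightarrow> 'w \<Rightarrow> 'x"
    and x y :: 'x
  assumes mp: "markov_process w P X" and irr: "irreducible_rates w" and w: "\<And>x y. w x y \<ge> 0"
begin

interpretation prob_space "P x" by (rule prob_P[OF mp])

abbreviation (input) green :: "'x \<Rightarrow> ennreal" where
  "green a \<equiv> \<integral>\<^sup>+\<omega>. occupation X y (indicator {a}) \<omega> \<partial>P x"

text \<open>Integrability of \<open>D\<close> makes it finite almost surely, hence the hitting time
  too. All path facts used later are bundled into one almost sure event.\<close>

lemma AE_hitting_time_finite:
  obtains D where "D \<in> borel_measurable (P x)" "(\<integral>\<^sup>+\<omega>. D \<omega> \<partial>P x) < \<infinity>"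
    "AE \<omega> in P x. \<omega> \<in> space (P x) \<and> X 0 \<omega> = x \<and> (\<exists>\<tau>. hitting_time (\<lambda>t. X t \<omega>) y = ereal \<tau> \<and> 0 \<le> \<tau> \<and>
       X \<tau> \<omega> = y \<and> (\<forall>s. 0 \<le> s \<longrightarrow> s < \<tau> \<longrightarrow> X s \<omega> \<noteq> y) \<and> ennreal \<tau> \<le> D \<omega>)"
proof -
  obtain D where D: "D \<in> borel_measurable (P x)" "(\<integral>\<^sup>+\<omega>. D \<omega> \<partial>P x) < \<infinity>"
    "\<And>\<omega>. \<omega> \<in> space (P x) \<Longrightarrow> e2ennreal (hitting_time (\<lambda>t. X t \<omega>) y) \<le> D \<omega>"
    using hitting_time_dominated[OF mp irr] by blast
  have "AE \<omega> in P x. D \<omega> \<noteq> \<infinity>"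
    using D(2) by (intro nn_integral_PInf_AE[OF D(1)]) auto
  then have "AE \<omega> in P x. \<omega> \<in> space (P x) \<and> X 0 \<omega> = x \<and> (\<exists>\<tau>. hitting_time (\<lambda>t. X t \<omega>) y = ereal \<tau> \<and> 0 \<le> \<tau> \<and>
       X \<tau> \<omega> = y \<and> (\<forall>s. 0 \<le> s \<longrightarrow> s < \<tau> \<longrightarrow> X s \<omega> \<noteq> y) \<and> ennreal \<tau> \<le> D \<omega>)"
    using X_start[OF mp, of x] AE_space
  proof eventually_elim
    case (elim \<omega>)
    have "hitting_time (\<lambda>t. X t \<omega>) y < \<infinity>"
      using D(3)[OF elim(3)] elim(1) by (cases "hitting_time (\<lambda>t. X t \<omega>) y") (auto simp: top_unique)
    then obtain \<tau> where \<tau>: "hitting_time (\<lambda>t. X t \<omega>) y = ereal \<tau>" "0 \<le> \<tau>" "X \<tau> \<omega> = y"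
      "\<And>s. 0 \<le> s \<Longrightarrow> s < \<tau> \<Longrightarrow> X s \<omega> \<noteq> y"
      by (rule hitting_time_finite[OF X_path[OF mp elim(3)]]) blast
    moreover have "ennreal \<tau> \<le> D \<omega>"
      using D(3)[OF elim(3)] by (simp add: \<tau>(1) e2ennreal_ereal)
    ultimately show ?case using elim by blast
  qed
  then show ?thesis using that D by blast
qed

lemma occupation_expectation_limit:
  assumes q: "\<And>x. 0 \<le> q x"
  shows "(\<lambda>m. \<Sum>a\<in>UNIV. ennreal (q a) * (\<integral>\<^sup>+\<omega>. grid_occupation P X x y (mesh m) a \<omega> \<partial>P x))
    \<longlonglongrightarrow> (\<integral>\<^sup>+\<omega>. occupation X y q \<omega> \<partial>P x)"
    and "(\<integral>\<^sup>+\<omega>. occupation X y q \<omega> \<partial>P x) < \<infinity>"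
proof -
  obtain D where D: "D \<in> borel_measurable (P x)" "(\<integral>\<^sup>+\<omega>. D \<omega> \<partial>P x) < \<infinity>"
    "AE \<omega> in P x. \<omega> \<in> space (P x) \<and> X 0 \<omega> = x \<and> (\<exists>\<tau>. hitting_time (\<lambda>t. X t \<omega>) y = ereal \<tau> \<and> 0 \<le> \<tau> \<and>
       X \<tau> \<omega> = y \<and> (\<forall>s. 0 \<le> s \<longrightarrow> s < \<tau> \<longrightarrow> X s \<omega> \<noteq> y) \<and> ennreal \<tau> \<le> D \<omega>)"
    by (rule AE_hitting_time_finite)
  note [measurable] = D(1) grid_occupation_measurable[OF mp mesh(2)]
  let ?C = "\<lambda>m \<omega>. \<Sum>a\<in>UNIV. ennreal (q a) * grid_occupation P X x y (mesh m) a \<omega>"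
  \<comment> \<open>The grid overshoots the hitting time by at most one step, which is at most
    1.\<close>
  let ?W = "\<lambda>\<omega>. \<Sum>a\<in>UNIV. ennreal (q a) * (D \<omega> + 1)"
  have fin: "(\<integral>\<^sup>+\<omega>. ?W \<omega> \<partial>P x) < \<infinity>"
    using D(2) by (simp add: nn_integral_sum nn_integral_cmult nn_integral_add emeasure_space_1 ennreal_mult_less_top)
  have bound: "AE \<omega> in P x. ?C m \<omega> \<le> ?W \<omega>" for m
    using D(3)
  proof eventually_elim
    case (elim \<omega>)
    then obtain \<tau> where \<tau>: "hitting_time (\<lambda>t. X t \<omega>) y = ereal \<tau>" "0 \<le> \<tau>" "ennreal \<tau> \<le> D \<omega>" by blast
    have "grid_occupation P X x y (mesh m) a \<omega> \<le> D \<omega> + 1" for a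
      using grid_occupation_bound[OF mp _ \<tau>(1) mesh(2,3) \<tau>(2), of x m a] elim \<tau>(3)
      by (meson add_right_mono order_trans)
    then show ?case by (intro sum_mono mult_left_mono) auto
  qed
  have lim: "AE \<omega> in P x. (\<lambda>m. ?C m \<omega>) \<longlonglongrightarrow> occupation X y q \<omega>"
    using D(3)
  proof eventually_elim
    case (elim \<omega>)
    then obtain \<tau> where \<tau>: "hitting_time (\<lambda>t. X t \<omega>) y = ereal \<tau>" "0 \<le> \<tau>" "X \<tau> \<omega> = y"
      "\<And>s. 0 \<le> s \<Longrightarrow> s < \<tau> \<Longrightarrow> X s \<omega> \<noteq> y" by blast
    have \<omega>: "\<omega> \<in> space (P x)" using elim by blast
    show ?case
      unfolding grid_occupation_weighted[OF mp \<omega> \<tau>(1) mesh(2) q] occupation_def \<tau>(1) ereal_less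
      using occupation_limit[OF X_path[OF mp \<omega>] \<tau>(2-4) q mesh] by simp
  qed
  have "(\<lambda>m. \<integral>\<^sup>+\<omega>. ?C m \<omega> \<partial>P x) \<longlonglongrightarrow> (\<integral>\<^sup>+\<omega>. occupation X y q \<omega> \<partial>P x)"
    by (rule nn_integral_dominated_convergence_AE[OF _ _ bound fin lim]) measurable
  moreover have "(\<integral>\<^sup>+\<omega>. ?C m \<omega> \<partial>P x) = (\<Sum>a\<in>UNIV. ennreal (q a) * (\<integral>\<^sup>+\<omega>. grid_occupation P X x y (mesh m) a \<omega> \<partial>P x))" for m
    by (subst nn_integral_sum) (simp_all add: nn_integral_cmult del: of_nat_Suc)
  ultimately show *: "(\<lambda>m. \<Sum>a\<in>UNIV. ennreal (q a) * (\<integral>\<^sup>+\<omega>. grid_occupation P X x y (mesh m) a \<omega> \<partial>P x))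
    \<longlonglongrightarrow> (\<integral>\<^sup>+\<omega>. occupation X y q \<omega> \<partial>P x)" by simp
  have "(\<integral>\<^sup>+\<omega>. occupation X y q \<omega> \<partial>P x) \<le> (\<integral>\<^sup>+\<omega>. ?W \<omega> \<partial>P x)"
  proof (rule LIMSEQ_le_const2)
    show "(\<lambda>m. \<integral>\<^sup>+\<omega>. ?C m \<omega> \<partial>P x) \<longlonglongrightarrow> (\<integral>\<^sup>+\<omega>. occupation X y q \<omega> \<partial>P x)" by fact
  qed (use bound in \<open>auto intro: nn_integral_mono_AE\<close>)
  then show "(\<integral>\<^sup>+\<omega>. occupation X y q \<omega> \<partial>P x) < \<infinity>" using fin by (rule le_less_trans)
qed

lemma grid_occupation_limit:
  "(\<lambda>m. \<integral>\<^sup>+\<omega>. grid_occupation P X x y (mesh m) a \<omega> \<partial>P x) \<longlonglongrightarrow> green a"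
proof -
  have "(\<Sum>b\<in>UNIV. ennreal (indicator {a} b) * f b) = (f a :: ennreal)" for f
  proof -
    have "(\<Sum>b\<in>UNIV. ennreal (indicator {a} b) * f b) = (\<Sum>b\<in>UNIV. if b = a then f b else 0)"
      by (rule sum.cong) (auto simp: indicator_def)
    then show ?thesis by simp
  qed
  then show ?thesis using occupation_expectation_limit(1)[of "indicator {a}"] by simp
qed

lemma green_finite: "green a < \<infinity>"
  by (rule occupation_expectation_limit(2)) (simp add: indicator_def)

text \<open>Linearity in \<open>q\<close> is visible on the grid, and both sides are limits of the
  same sequence.\<close>

lemma occupation_expectation:
  assumes q: "\<And>x. 0 \<le> q x"
  shows "(\<integral>\<^sup>+\<omega>. occupation X y q \<omega> \<partial>P x) = (\<Sum>a\<in>UNIV. ennreal (q a) * green a)"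
proof (rule LIMSEQ_unique[OF occupation_expectation_limit(1)[OF q]])
  show "(\<lambda>m. \<Sum>a\<in>UNIV. ennreal (q a) * (\<integral>\<^sup>+\<omega>. grid_occupation P X x y (mesh m) a \<omega> \<partial>P x))
    \<longlonglongrightarrow> (\<Sum>a\<in>UNIV. ennreal (q a) * green a)"
    by (intro tendsto_sum ennreal_tendsto_cmult grid_occupation_limit) simp
qed

lemma grid_crossings_expectation_limit:
  assumes ab: "a \<noteq> b"
  shows "(\<lambda>m. \<integral>\<^sup>+\<omega>. grid_crossings P X x y (mesh m) a b \<omega> \<partial>P x) \<longlonglongrightarrow> green a * ennreal (w a b)"
proof -
  have "filterlim mesh (at_right 0) sequentially"
    using mesh by (intro filterlim_atI' tendsto_imp_filterlim_at_right) auto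
  then have "(\<lambda>m. trans_prob P X (mesh m) a b / mesh m) \<longlonglongrightarrow> w a b"
    by (rule filterlim_compose[OF trans_prob_rate[OF mp ab]])
  then have "(\<lambda>m. ennreal (trans_prob P X (mesh m) a b / mesh m)) \<longlonglongrightarrow> ennreal (w a b)"
    by (rule tendsto_ennrealI)
  then have "(\<lambda>m. (\<integral>\<^sup>+\<omega>. grid_occupation P X x y (mesh m) a \<omega> \<partial>P x) * ennreal (trans_prob P X (mesh m) a b / mesh m))
      \<longlonglongrightarrow> green a * ennreal (w a b)"
    using green_finite[of a] by (intro tendsto_mult_ennreal grid_occupation_limit) auto
  then show ?thesis
    unfolding nn_integral_grid_crossings[OF mp mesh(2)] .
qed

lemma crossings_expectation_limits:
  shows "a \<noteq> b \<Longrightarrow> AE \<omega> in P x. (\<lambda>m. grid_crossings P X x y (mesh m) a b \<omega>) \<longlonglongrightarrow>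
      crossings (\<lambda>t. X t \<omega>) (hitting_time (\<lambda>t. X t \<omega>) y) (a, b)"
    and "a \<noteq> b \<Longrightarrow> (\<integral>\<^sup>+\<omega>. crossings (\<lambda>t. X t \<omega>) (hitting_time (\<lambda>t. X t \<omega>) y) (a, b) \<partial>P x) = green a * ennreal (w a b)"
proof -
  obtain D where D: "AE \<omega> in P x. \<omega> \<in> space (P x) \<and> X 0 \<omega> = x \<and> (\<exists>\<tau>. hitting_time (\<lambda>t. X t \<omega>) y = ereal \<tau> \<and> 0 \<le> \<tau> \<and>
       X \<tau> \<omega> = y \<and> (\<forall>s. 0 \<le> s \<longrightarrow> s < \<tau> \<longrightarrow> X s \<omega> \<noteq> y) \<and> ennreal \<tau> \<le> D \<omega>)"
    by (rule AE_hitting_time_finite)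
  note [measurable] = grid_crossings_measurable[OF mp mesh(2)]
  let ?cr = "\<lambda>a b \<omega>. crossings (\<lambda>t. X t \<omega>) (hitting_time (\<lambda>t. X t \<omega>) y) (a, b)"
  let ?N = "\<lambda>m a b \<omega>. grid_crossings P X x y (mesh m) a b \<omega>"
  let ?O = "{(a, b). a \<noteq> (b :: 'x)}"
  have path: "(\<lambda>m. ?N m a b \<omega>) \<longlonglongrightarrow> ?cr a b \<omega> \<and> (\<forall>m. ?N m a b \<omega> \<le> (\<Sum>(a, b)\<in>?O. ?cr a b \<omega>))"
    if ab: "a \<noteq> b" and *: "\<omega> \<in> space (P x) \<and> X 0 \<omega> = x \<and> (\<exists>\<tau>. hitting_time (\<lambda>t. X t \<omega>) y = ereal \<tau> \<and> 0 \<le> \<tau> \<and>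
       X \<tau> \<omega> = y \<and> (\<forall>s. 0 \<le> s \<longrightarrow> s < \<tau> \<longrightarrow> X s \<omega> \<noteq> y) \<and> ennreal \<tau> \<le> D \<omega>)" for a b \<omega>
  proof -
    obtain \<tau> where \<tau>: "hitting_time (\<lambda>t. X t \<omega>) y = ereal \<tau>" "0 \<le> \<tau>" "X \<tau> \<omega> = y"
      "\<And>s. 0 \<le> s \<Longrightarrow> s < \<tau> \<Longrightarrow> X s \<omega> \<noteq> y" using * by blast
    have \<omega>: "\<omega> \<in> space (P x)" using * by blast
    let ?c = "\<lambda>t. X t \<omega>"
    note path = X_path[OF mp \<omega>] \<tau>(2-4)
    have cr: "?cr a b \<omega> = of_nat (card (jumps ?c \<tau> a b))" if "a \<noteq> b" for a b
      unfolding \<tau>(1) by (rule crossings_eq_card_jumps[OF path that])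
    have N: "?N m a b \<omega> = of_nat (card (grid_jumps ?c \<tau> (mesh m) a b))" for m a b
      by (rule grid_crossings_path[OF mp \<omega> \<tau>(1) mesh(2)])
    have "\<forall>\<^sub>F m in sequentially. \<forall>a b. a \<noteq> b \<longrightarrow> card (grid_jumps ?c \<tau> (mesh m) a b) = card (jumps ?c \<tau> a b)"
      by (rule card_grid_jumps_eventually[OF path mesh(1,2)])
    then have "\<forall>\<^sub>F m in sequentially. ?N m a b \<omega> = ?cr a b \<omega>"
      by eventually_elim (use ab in \<open>simp add: N cr del: of_nat_Suc\<close>)
    moreover have "?N m a b \<omega> \<le> (\<Sum>(a, b)\<in>?O. ?cr a b \<omega>)" for m
    proof -
      have "?N m a b \<omega> \<le> of_nat (\<Sum>(a, b)\<in>?O. card (jumps ?c \<tau> a b))"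
        unfolding N of_nat_le_iff by (rule card_grid_jumps_le[OF path mesh(2) ab])
      also have "\<dots> = (\<Sum>(a, b)\<in>?O. ?cr a b \<omega>)"
        unfolding of_nat_sum by (rule sum.cong) (auto simp: cr)
      finally show ?thesis .
    qed
    ultimately show ?thesis by (auto intro: tendsto_eventually)
  qed
  have lim: "AE \<omega> in P x. (\<lambda>m. ?N m a b \<omega>) \<longlonglongrightarrow> ?cr a b \<omega>" if "a \<noteq> b" for a b
    using D by eventually_elim (use path[OF that] in blast)
  \<comment> \<open>A measurable version of the total number of jumps, assembled from the measurable
    grid counts.\<close>
  let ?W = "\<lambda>\<omega>. \<Sum>(a, b)\<in>?O. liminf (\<lambda>m. ?N m a b \<omega>)"
  have W: "AE \<omega> in P x. (\<Sum>(a, b)\<in>?O. ?cr a b \<omega>) = ?W \<omega>"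
    using D
  proof eventually_elim
    case (elim \<omega>)
    show ?case
    proof (intro sum.cong refl, clarify)
      fix a b :: 'x assume ab: "a \<noteq> b"
      show "?cr a b \<omega> = liminf (\<lambda>m. ?N m a b \<omega>)"
        by (rule lim_imp_Liminf[OF _ conjunct1[OF path[OF ab elim]], symmetric]) simp
    qed
  qed
  have bound: "AE \<omega> in P x. ?N m a b \<omega> \<le> ?W \<omega>" if "a \<noteq> b" for m a b
    using D W by eventually_elim (use path[OF that] in metis)
  have fin: "(\<integral>\<^sup>+\<omega>. ?W \<omega> \<partial>P x) < \<infinity>"
  proof -
    have "(\<integral>\<^sup>+\<omega>. ?W \<omega> \<partial>P x) = (\<Sum>(a, b)\<in>?O. \<integral>\<^sup>+\<omega>. liminf (\<lambda>m. ?N m a b \<omega>) \<partial>P x)"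
      unfolding case_prod_beta' by (rule nn_integral_sum) measurable
    also have "\<dots> \<le> (\<Sum>(a, b)\<in>?O. green a * ennreal (w a b))"
    proof (rule sum_mono, clarify)
      fix a b :: 'x assume "a \<noteq> b"
      have "(\<integral>\<^sup>+\<omega>. liminf (\<lambda>m. ?N m a b \<omega>) \<partial>P x) \<le> liminf (\<lambda>m. \<integral>\<^sup>+\<omega>. ?N m a b \<omega> \<partial>P x)"
        by (rule nn_integral_liminf) measurable
      also have "\<dots> = green a * ennreal (w a b)"
        by (rule lim_imp_Liminf[OF _ grid_crossings_expectation_limit[OF \<open>a \<noteq> b\<close>]]) simp
      finally show "(\<integral>\<^sup>+\<omega>. liminf (\<lambda>m. ?N m a b \<omega>) \<partial>P x) \<le> green a * ennreal (w a b)" .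
    qed
    also have "\<dots> < \<infinity>"
      using green_finite by (auto simp: ennreal_sum_less_top ennreal_mult_less_top)
    finally show ?thesis .
  qed
  show "a \<noteq> b \<Longrightarrow> AE \<omega> in P x. (\<lambda>m. ?N m a b \<omega>) \<longlonglongrightarrow> ?cr a b \<omega>" by (rule lim)
  assume ab: "a \<noteq> b"
  have "(\<lambda>m. \<integral>\<^sup>+\<omega>. ?N m a b \<omega> \<partial>P x) \<longlonglongrightarrow> (\<integral>\<^sup>+\<omega>. ?cr a b \<omega> \<partial>P x)"
    by (rule nn_integral_dominated_convergence_AE[OF _ _ bound[OF ab] fin lim[OF ab]])
      (unfold case_prod_beta', measurable)
  then show "(\<integral>\<^sup>+\<omega>. ?cr a b \<omega> \<partial>P x) = green a * ennreal (w a b)"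
    by (rule LIMSEQ_unique[OF _ grid_crossings_expectation_limit[OF ab]])
qed

end

section \<open>Dynkin's formula and the Green function\<close>

context
  fixes w :: "'x::finite \<Rightarrow> 'x \<Rightarrow> real" and P :: "'x \<Rightarrow> 'w measure" and X :: "real \<Rightarrow> 'w \<Rightarrow> 'x"
    and x y :: 'x
  assumes mp: "markov_process w P X" and irr: "irreducible_rates w" and w: "\<And>x y. w x y \<ge> 0"
begin

interpretation prob_space "P x" by (rule prob_P[OF mp])

text \<open>Integrating the pathwise telescoping identity gives Dynkin's formula, still free of
  subtraction.\<close>

lemma crossings_balance:
  assumes f: "\<And>x. 0 \<le> f x"
  shows "(\<Sum>(a, b) | a \<noteq> b. ennreal (f b) * ((\<integral>\<^sup>+\<omega>. occupation X y (indicator {a}) \<omega> \<partial>P x) * ennreal (w a b))) + ennreal (f x)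
    = (\<Sum>(a, b) | a \<noteq> b. ennreal (f a) * ((\<integral>\<^sup>+\<omega>. occupation X y (indicator {a}) \<omega> \<partial>P x) * ennreal (w a b))) + ennreal (f y)"
proof -
  let ?O = "{(a, b). a \<noteq> (b :: 'x)}"
  let ?cr = "\<lambda>p \<omega>. crossings (\<lambda>t. X t \<omega>) (hitting_time (\<lambda>t. X t \<omega>) y) p"
  \<comment> \<open>The liminf of the grid counts again stands in for the crossing number, so that
    linearity of the integral can be used.\<close>
  let ?L = "\<lambda>p \<omega>. liminf (\<lambda>m. grid_crossings P X x y (mesh m) (fst p) (snd p) \<omega>)"
  let ?g = "\<lambda>a. \<integral>\<^sup>+\<omega>. occupation X y (indicator {a}) \<omega> \<partial>P x"
  obtain D where D: "AE \<omega> in P x. \<omega> \<in> space (P x) \<and> X 0 \<omega> = x \<and> (\<exists>\<tau>. hitting_time (\<lambda>t. X t \<omega>) y = ereal \<tau> \<and> 0 \<le> \<tau> \<and>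
       X \<tau> \<omega> = y \<and> (\<forall>s. 0 \<le> s \<longrightarrow> s < \<tau> \<longrightarrow> X s \<omega> \<noteq> y) \<and> ennreal \<tau> \<le> D \<omega>)"
    by (rule AE_hitting_time_finite[OF mp irr w])
  note [measurable] = grid_crossings_measurable[OF mp mesh(2)]
  have L: "AE \<omega> in P x. ?cr p \<omega> = ?L p \<omega>" if "p \<in> ?O" for p
  proof -
    have "AE \<omega> in P x. (\<lambda>m. grid_crossings P X x y (mesh m) (fst p) (snd p) \<omega>) \<longlonglongrightarrow> ?cr (fst p, snd p) \<omega>"
      by (rule crossings_expectation_limits(1)[OF mp irr w]) (use that in auto)
    then show ?thesis by eventually_elim (simp add: lim_imp_Liminf)
  qed
  have int: "(\<integral>\<^sup>+\<omega>. (\<Sum>p\<in>?O. ennreal (g p) * ?L p \<omega>) + ennreal r \<partial>P x)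
      = (\<Sum>p\<in>?O. ennreal (g p) * (?g (fst p) * ennreal (w (fst p) (snd p)))) + ennreal r" for g r
  proof -
    have "(\<integral>\<^sup>+\<omega>. ?L p \<omega> \<partial>P x) = ?g (fst p) * ennreal (w (fst p) (snd p))" if p: "p \<in> ?O" for p
    proof -
      have "(\<integral>\<^sup>+\<omega>. ?L p \<omega> \<partial>P x) = (\<integral>\<^sup>+\<omega>. ?cr (fst p, snd p) \<omega> \<partial>P x)"
        using L[OF p] by (intro nn_integral_cong_AE) auto
      also have "\<dots> = ?g (fst p) * ennreal (w (fst p) (snd p))"
        by (rule crossings_expectation_limits(2)[OF mp irr w]) (use p in auto)
      finally show ?thesis .
    qed
    note eq = this
    have m: "?L p \<in> borel_measurable (P x)" for p by measurable
    then have mc: "(\<lambda>\<omega>. ennreal (g p) * ?L p \<omega>) \<in> borel_measurable (P x)" for p by measurable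
    have "(\<integral>\<^sup>+\<omega>. (\<Sum>p\<in>?O. ennreal (g p) * ?L p \<omega>) + ennreal r \<partial>P x)
        = (\<integral>\<^sup>+\<omega>. (\<Sum>p\<in>?O. ennreal (g p) * ?L p \<omega>) \<partial>P x) + (\<integral>\<^sup>+\<omega>. ennreal r \<partial>P x)"
      by (intro nn_integral_add borel_measurable_sum mc) simp
    also have "(\<integral>\<^sup>+\<omega>. ennreal r \<partial>P x) = ennreal r" by (simp add: emeasure_space_1)
    also have "(\<integral>\<^sup>+\<omega>. (\<Sum>p\<in>?O. ennreal (g p) * ?L p \<omega>) \<partial>P x) = (\<Sum>p\<in>?O. \<integral>\<^sup>+\<omega>. ennreal (g p) * ?L p \<omega> \<partial>P x)"
      by (rule nn_integral_sum[OF mc])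
    also have "\<dots> = (\<Sum>p\<in>?O. ennreal (g p) * (?g (fst p) * ennreal (w (fst p) (snd p))))"
      by (intro sum.cong refl) (simp only: nn_integral_cmult[OF m] eq)
    finally show ?thesis .
  qed
  have "AE \<omega> in P x. \<forall>p\<in>?O. ?cr p \<omega> = ?L p \<omega>" using L by (intro AE_finite_allI) auto
  then have "AE \<omega> in P x. (\<Sum>p\<in>?O. ennreal (f (snd p)) * ?L p \<omega>) + ennreal (f x)
      = (\<Sum>p\<in>?O. ennreal (f (fst p)) * ?L p \<omega>) + ennreal (f y)"
    using D
  proof eventually_elim
    case (elim \<omega>)
    obtain \<tau> where \<tau>: "hitting_time (\<lambda>t. X t \<omega>) y = ereal \<tau>" "0 \<le> \<tau>" "X \<tau> \<omega> = y"
      "\<And>s. 0 \<le> s \<Longrightarrow> s < \<tau> \<Longrightarrow> X s \<omega> \<noteq> y" using elim(2) by blast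
    have \<omega>: "\<omega> \<in> space (P x)" "X 0 \<omega> = x" using elim(2) by blast+
    have sub: "(\<Sum>p\<in>?O. ennreal (g p) * ?L p \<omega>) = (\<Sum>p\<in>?O. ennreal (g p) * ?cr p \<omega>)" for g
      by (rule sum.cong) (use elim(1) in auto)
    have "(\<Sum>(a, b) | a \<noteq> b. ennreal (f b) * crossings (\<lambda>t. X t \<omega>) (ereal \<tau>) (a, b)) + ennreal (f (X 0 \<omega>))
      = (\<Sum>(a, b) | a \<noteq> b. ennreal (f a) * crossings (\<lambda>t. X t \<omega>) (ereal \<tau>) (a, b)) + ennreal (f y)"
      by (rule crossings_telescope[OF X_path[OF mp \<omega>(1)] \<tau>(2-4) f])
    then show ?case unfolding sub \<tau>(1) \<omega>(2) by (simp add: case_prod_beta')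
  qed
  then have "(\<integral>\<^sup>+\<omega>. (\<Sum>p\<in>?O. ennreal (f (snd p)) * ?L p \<omega>) + ennreal (f x) \<partial>P x)
      = (\<integral>\<^sup>+\<omega>. (\<Sum>p\<in>?O. ennreal (f (fst p)) * ?L p \<omega>) + ennreal (f y) \<partial>P x)"
    by (rule nn_integral_cong_AE)
  then show ?thesis unfolding int by (simp add: case_prod_beta')
qed

lemma green_function:
  obtains G :: "'x \<Rightarrow> real" where "\<And>a. 0 \<le> G a"
    "\<And>q. (\<And>x. 0 \<le> q x) \<Longrightarrow> killing_before P X q x y = (\<Sum>a\<in>UNIV. q a * G a)"
    "\<And>a b. a \<noteq> b \<Longrightarrow> cross_pos P X y x (a, b) = G a * w a b"
    "\<And>f. (\<Sum>a\<in>UNIV. G a * generator w f a) = f y - f x"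
proof -
  let ?g = "\<lambda>a. \<integral>\<^sup>+\<omega>. occupation X y (indicator {a}) \<omega> \<partial>P x"
  define G where "G a = enn2real (?g a)" for a
  have g: "?g a = ennreal (G a)" for a
    unfolding G_def using green_finite[OF mp irr w, of x y a] by (simp add: ennreal_enn2real)
  have G0: "0 \<le> G a" for a by (simp add: G_def)
  have "killing_before P X q x y = (\<Sum>a\<in>UNIV. q a * G a)" if q: "\<And>x. 0 \<le> q x" for q
  proof -
    have "killing_before P X q x y = enn2real (\<integral>\<^sup>+\<omega>. occupation X y q \<omega> \<partial>P x)"
      by (simp add: killing_before_def occupation_def)
    also have "\<dots> = enn2real (ennreal (\<Sum>a\<in>UNIV. q a * G a))"
      unfolding occupation_expectation[OF mp irr w q] g
      using q G0 by (simp add: ennreal_mult[symmetric] sum_ennreal)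
    finally show ?thesis using q G0 by (simp add: sum_nonneg)
  qed
  moreover have "cross_pos P X y x (a, b) = G a * w a b" if "a \<noteq> b" for a b
    unfolding cross_pos_def crossings_expectation_limits(2)[OF mp irr w that] g
    using G0 w by (simp add: ennreal_mult[symmetric])
  moreover have "(\<Sum>a\<in>UNIV. G a * generator w f a) = f y - f x" for f
  proof -
    \<comment> \<open>Adding the constant \<open>r\<close> makes the function nonnegative and leaves
      all its increments unchanged.\<close>
    define r where "r = (\<Sum>z\<in>UNIV. \<bar>f z\<bar>)"
    define F where "F z = f z + r" for z
    have F0: "0 \<le> F z" for z
    proof -
      have "\<bar>f z\<bar> \<le> r" unfolding r_def by (rule member_le_sum) auto
      then show ?thesis by (simp add: F_def)
    qed
    let ?O = "{p. fst p \<noteq> snd (p :: 'x \<times> 'x)}"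
    have "(\<Sum>p\<in>?O. F (snd p) * (G (fst p) * w (fst p) (snd p))) + F x
        = (\<Sum>p\<in>?O. F (fst p) * (G (fst p) * w (fst p) (snd p))) + F y" (is "?l = ?r")
    proof -
      have "ennreal ?l = ennreal ?r"
        using crossings_balance[of F] F0 G0 w unfolding g
        by (simp add: case_prod_beta' ennreal_mult[symmetric] sum_ennreal sum_nonneg ennreal_plus)
      moreover have "0 \<le> ?l" "0 \<le> ?r" using F0 G0 w by (auto intro!: add_nonneg_nonneg sum_nonneg)
      ultimately show ?thesis by (simp only: ennreal_inj)
    qed
    then have "F y - F x = (\<Sum>p\<in>?O. G (fst p) * (w (fst p) (snd p) * (F (snd p) - F (fst p))))"
      by (simp add: algebra_simps sum_subtractf)
    also have "\<dots> = (\<Sum>p\<in>UNIV. G (fst p) * (w (fst p) (snd p) * (F (snd p) - F (fst p))))"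
      by (rule sum.mono_neutral_left) auto
    also have "\<dots> = (\<Sum>a\<in>UNIV. \<Sum>b\<in>UNIV. G a * (w a b * (F b - F a)))"
      by (simp add: sum.cartesian_product case_prod_beta' UNIV_Times_UNIV[symmetric] del: UNIV_Times_UNIV)
    finally show ?thesis by (simp add: F_def generator_def sum_distrib_left)
  qed
  ultimately show ?thesis using that G0 by blast
qed

end

section \<open>The kernels\<close>

text \<open>The diagonal rate \<open>w a a\<close> cancels in the generator, so the diagonal of
  \<open>W\<close> is free to carry \<open>q\<close>.\<close>

lemma choice_matrix_row:
  fixes w :: "'x::finite \<Rightarrow> 'x \<Rightarrow> real"
  shows "(\<Sum>j\<in>UNIV. choice_matrix c (\<lambda>a b. if a = b then q a else w a b) $ a $ j * v j)
    = q a * v c - generator w v a"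
proof -
  let ?W = "\<lambda>a b. if a = b then q a else w a b"
  have "(\<Sum>j\<in>UNIV. choice_matrix c ?W $ a $ j * v j)
      = (\<Sum>j\<in>UNIV. \<Sum>b\<in>UNIV. ?W a b * (choice_row c a b $ j * v j))"
    by (simp add: choice_matrix_def sum_distrib_right mult.assoc)
  also have "\<dots> = (\<Sum>b\<in>UNIV. ?W a b * (\<Sum>j\<in>UNIV. choice_row c a b $ j * v j))"
    by (subst sum.swap) (simp add: sum_distrib_left)
  also have "\<dots> = (\<Sum>b\<in>UNIV. (if b = a then q a * v c else 0) - w a b * (v b - v a))"
    unfolding choice_row_inner by (intro sum.cong) (auto simp: algebra_simps)
  finally show ?thesis by (simp add: sum_subtractf generator_def)
qed

theorem theorem6:
  fixes w :: "'x::finite \<Rightarrow> 'x \<Rightarrow> real"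
    and q :: "'x \<Rightarrow> real"
    and P :: "'x \<Rightarrow> 'w measure" and X :: "real \<Rightarrow> 'w \<Rightarrow> 'x"
    and N :: "'o measure" and \<tau>\<^sub>Q :: "'o \<Rightarrow> ('x \<times> 'x) set"
    and A :: "('x \<times> 'x) set"
  assumes "\<And>x y. w x y \<ge> 0" and "irreducible_rates w"
    and "markov_process w P X"
    and "\<And>x. q x \<ge> 0" and "\<exists>x. q x \<noteq> 0"
    and "random_rooted_tree w q N \<tau>\<^sub>Q"
    and "A \<subseteq> edges w"
  shows "measure N {\<omega>\<in>space N. A \<subseteq> \<tau>\<^sub>Q \<omega>} = det_on A (H_plus P X q) \<and>
    ((\<forall>e\<in>A. prod.swap e \<notin> A) \<longrightarrow>
      measure N {\<omega>\<in>space N. \<forall>e\<in>A. e \<in> \<tau>\<^sub>Q \<omega> \<or> prod.swap e \<in> \<tau>\<^sub>Q \<omega>} = det_on A (H_net P X q))"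
proof -
  note w = assms(1) and irr = assms(2) and mp = assms(3) and q = assms(4) and tree = assms(6)
  \<comment> \<open>The reference state is arbitrary; the final kernel does not depend on
    it.\<close>
  obtain c :: 'x where True by simp
  let ?W = "\<lambda>a b. if a = b then q a else w a b"
  obtain F :: "real ^ 'x ^ 'x" where F: "choice_matrix c ?W ** F = mat 1"
    and contains: "\<And>A. (\<And>e. e \<in> A \<Longrightarrow> fst e \<noteq> snd e) \<Longrightarrow> measure N {\<omega>\<in>space N. A \<subseteq> \<tau>\<^sub>Q \<omega>} =
      det_on A (\<lambda>e e'. (F $ fst e $ fst e' - F $ snd e $ fst e') * w (fst e') (snd e'))"
    using random_tree_contains[OF tree w] by blast
  define \<beta> where "\<beta> = killing_before P X q"
  have L: "generator w (\<lambda>a. F $ a $ z) a = q a * F $ c $ z - (if a = z then 1 else 0)" for a z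
  proof -
    have "(\<Sum>j\<in>UNIV. choice_matrix c ?W $ a $ j * F $ j $ z) = (choice_matrix c ?W ** F) $ a $ z"
      by (simp add: matrix_matrix_mult_def)
    also have "\<dots> = (if a = z then 1 else 0)" by (simp add: F mat_def)
    finally show ?thesis using choice_matrix_row[of c q w a "\<lambda>a. F $ a $ z"] by simp
  qed
  have ex: "\<exists>G. (\<forall>a. 0 \<le> G a) \<and> \<beta> x y = (\<Sum>a\<in>UNIV. q a * G a) \<and>
      (\<forall>a b. a \<noteq> b \<longrightarrow> cross_pos P X y x (a, b) = G a * w a b) \<and>
      (\<forall>f. (\<Sum>a\<in>UNIV. G a * generator w f a) = f y - f x)"
    (is "\<exists>G. ?green x y G") for x y
    by (rule green_function[OF mp irr w, of x y]) (unfold \<beta>_def, use q in blast)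
  define G where "G x y = (SOME G. ?green x y G)" for x y
  have "?green x y (G x y)" for x y unfolding G_def by (rule someI_ex[OF ex])
  then have G: "\<And>x y a. 0 \<le> G x y a" "\<And>x y. \<beta> x y = (\<Sum>a\<in>UNIV. q a * G x y a)"
      "\<And>x y a b. a \<noteq> b \<Longrightarrow> cross_pos P X y x (a, b) = G x y a * w a b"
      "\<And>x y f. (\<Sum>a\<in>UNIV. G x y a * generator w f a) = f y - f x"
    by blast+
  \<comment> \<open>Dynkin's formula is applied to the column \<open>z\<close> of \<open>F\<close>.
    The source term isolates \<open>G x y z\<close>, and the constant multiple of \<open>q\<close>
    integrates to \<open>\<beta> x y\<close>.\<close>
  have G_eq: "G x y z = F $ x $ z - F $ y $ z + F $ c $ z * \<beta> x y" for x y z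
  proof -
    have "F $ y $ z - F $ x $ z = (\<Sum>a\<in>UNIV. G x y a * (q a * F $ c $ z) - (if a = z then G x y a else 0))"
      unfolding G(4)[of x y "\<lambda>a. F $ a $ z", symmetric] L
      by (intro sum.cong) (auto simp: algebra_simps)
    also have "\<dots> = F $ c $ z * \<beta> x y - G x y z"
      unfolding G(2) sum_distrib_left by (simp add: sum_subtractf algebra_simps)
    finally show ?thesis by simp
  qed
  \<comment> \<open>Adding \<open>G_eq\<close> for both orders cancels the differences of
    \<open>F\<close>. If the sum of the \<open>\<beta>\<close> vanished, the nonnegative Green
    functions would vanish, contradicting Dynkin's formula for the indicator of
    \<open>y\<close>.\<close>
  have \<beta>0: "\<beta> y x + \<beta> x y \<noteq> 0" if "x \<noteq> y" for x y
  proof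
    assume z: "\<beta> y x + \<beta> x y = 0"
    have "G x y a + G y x a = 0" for a
    proof -
      have "G x y a + G y x a = F $ c $ a * (\<beta> y x + \<beta> x y)"
        unfolding G_eq by (simp add: algebra_simps)
      then show ?thesis by (simp add: z)
    qed
    then have "G x y a = 0" for a using G(1)[of x y a] G(1)[of y x a] by (smt (verit))
    then have "(\<Sum>a\<in>UNIV. G x y a * generator w (indicator {y}) a) = 0" by simp
    then show False using G(4)[of x y "indicator {y}"] that by simp
  qed
  define K where "K = (\<lambda>e e'. (F $ fst e $ fst e' - F $ snd e $ fst e') * w (fst e') (snd e'))"
  have H_plus: "H_plus P X q e e' = K e e'" if e: "fst e \<noteq> snd e" "fst e' \<noteq> snd e'" for e e'
  proof -
    obtain u v where uv: "e = (u, v)" by (cases e)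
    obtain a b where ab: "e' = (a, b)" by (cases e')
    have "a \<noteq> b" using e(2) ab by simp
    then have cross: "cross_pos P X y x e' = (F $ x $ a - F $ y $ a + F $ c $ a * \<beta> x y) * w a b" for x y
      unfolding ab G_eq[symmetric] by (rule G(3))
    \<comment> \<open>The terms with \<open>F $ c $ a\<close> carry the symmetric product
      \<open>\<beta> v u * \<beta> u v\<close> and cancel.\<close>
    have "\<beta> v u * cross_pos P X v u e' - \<beta> u v * cross_pos P X u v e'
        = (\<beta> v u + \<beta> u v) * K e e'"
      unfolding cross unfolding uv ab K_def fst_conv snd_conv by algebra
    moreover have "\<beta> v u + \<beta> u v \<noteq> 0" using \<beta>0[of u v] e uv by simp
    ultimately show ?thesis by (simp add: H_plus_def \<beta>_def[symmetric] uv Let_def)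
  qed
  have H_net: "H_net P X q e e' = K e e' - K e (prod.swap e')" if e: "fst e \<noteq> snd e" "fst e' \<noteq> snd e'" for e e'
  proof -
    \<comment> \<open>Reversing an edge negates its net flow, which turns the plus sign of
      \<open>H_net\<close> into the minus sign of \<open>H_plus\<close>.\<close>
    have "H_net P X q e e' = H_plus P X q e e' - H_plus P X q e (prod.swap e')"
      by (simp add: H_net_def H_plus_def Let_def net_flow_def diff_divide_distrib[symmetric] algebra_simps)
    then show ?thesis using e by (simp add: H_plus)
  qed
  have nl: "fst e \<noteq> snd e" if "e \<in> A" for e using that assms(7) by (auto simp: edges_def)
  have "measure N {\<omega>\<in>space N. A \<subseteq> \<tau>\<^sub>Q \<omega>} = det_on A K"
    unfolding K_def by (rule contains[OF nl])
  also have "\<dots> = det_on A (H_plus P X q)" by (rule det_on_cong) (simp add: H_plus nl)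
  finally have first: "measure N {\<omega>\<in>space N. A \<subseteq> \<tau>\<^sub>Q \<omega>} = det_on A (H_plus P X q)" .
  have second: "measure N {\<omega>\<in>space N. \<forall>e\<in>A. e \<in> \<tau>\<^sub>Q \<omega> \<or> prod.swap e \<in> \<tau>\<^sub>Q \<omega>} = det_on A (H_net P X q)"
    if ori: "\<forall>e\<in>A. prod.swap e \<notin> A"
  proof -
    have "measure N {\<omega>\<in>space N. \<forall>e\<in>A. e \<in> \<tau>\<^sub>Q \<omega> \<or> prod.swap e \<in> \<tau>\<^sub>Q \<omega>}
        = (\<Sum>B\<in>Pow A. measure N {\<omega>\<in>space N. (\<lambda>e. if e \<in> B then prod.swap e else e) ` A \<subseteq> \<tau>\<^sub>Q \<omega>})"
      by (rule random_tree_contains_unoriented[OF tree]) (use ori in blast)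
    also have "\<dots> = (\<Sum>B\<in>Pow A. det_on ((\<lambda>e. if e \<in> B then prod.swap e else e) ` A) K)"
      unfolding K_def by (intro sum.cong refl contains) (use nl in \<open>fastforce split: if_splits\<close>)
    also have "\<dots> = det_on A (\<lambda>e e'. K e e' - K e (prod.swap e'))"
      by (rule det_on_antisymmetrized[symmetric]) (use ori in \<open>auto simp: K_def algebra_simps\<close>)
    also have "\<dots> = det_on A (H_net P X q)" by (rule det_on_cong) (simp add: H_net nl)
    finally show ?thesis .
  qed
  show ?thesis using first second by blast
qed

end
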